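(* Let $\ell\in\mathbb Z$ and let $m>n\ge1$ be integers. Then for $\tau=it$, $t\in\mathbb R^+$, and for any $N\in\mathbb N_0$, as $t\to0^+$, $$\mathrm{tr}_{L_{m,n}(\Lambda_{(\ell)})}q^{L_0}=e^{\frac{\pi t}{12}(n-m+1)+\frac{\pi}{12t}(m+2n-1)}\,\frac{\sqrt t}{2^n}\left(\sum_{r=0}^N a_r(m,n,\ell)\frac{t^r}{r!}+O\left(t^{N+1}\right)\right),$$ where $$a_r(m,n,\ell):=(-\pi)^r\sum_{k=0}^r\binom rk(m-n)^k(2i\ell)^{r-k}\,\mathcal E_{k+r,n}.$$
   Context: Notation: $q=e^{2\pi i\tau}$, $\tau\in\mathbb H$, and $\zeta=e^{2\pi iz}$. Define $\mathrm{ch}F_\ell$ as the coefficients of the Laurent expansion, in the annulus $|q|^{1/2}<|\zeta|<|q|^{-1/2}$, $$\prod_{k=1}^\infty\frac{\left(1+\zeta q^{k-\frac12}\right)^m\left(1+\zeta^{-1}q^{k-\frac12}\right)^m}{\left(1-\zeta q^{k-\frac12}\right)^n\left(1-\zeta^{-1}q^{k-\frac12}\right)^n}=\sum_{\ell\in\mathbb Z}\mathrm{ch}F_\ell\,\zeta^\ell$$ (the Kac–Wakimoto generating function for $s\ell(m|n)^\wedge$ with all formal variables $e^{\Lambda_0},w_s$ set equal to $1$), and $$\mathrm{tr}_{L_{m,n}(\Lambda_{(\ell)})}q^{L_0}=\mathrm{ch}F_\ell\cdot\prod_{k\ge1}(1-q^k).$$ The "higher" Euler numbers $\mathcal E_{k,n}$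 ($k\ge0$, $n\ge1$) are defined by the initial conditions $$\mathcal E_{k,1}=(-2i)^{-k}E_k,\qquad \mathcal E_{k,2}=\frac{2i^{-k}}{\pi}B_k\left(\tfrac12\right),$$ where $E_k$ are the Euler numbers, $\sum_{k\ge0}E_k\frac{x^k}{k!}=\frac{2}{e^x+e^{-x}}$, and $B_k(z)$ are the Bernoulli polynomials, $\sum_{k\ge0}B_k(z)\frac{x^k}{k!}=\frac{xe^{zx}}{e^x-1}$, together with the recurrence, for $n\ge1$, $k\ge0$, $$\mathcal E_{k,n+2}=\frac{n}{n+1}\,\mathcal E_{k,n}-\frac{k(k-1)}{\pi^2n(n+1)}\,\mathcal E_{k-2,n},$$ with $\mathcal E_{k,n}:=0$ if $k<0$. *)

theory Defs
  imports "HOL-Analysis.Analysis" "HOL-Library.Landau_Symbols"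
begin

text \<open>
  \<^term>\<open>nome_pow \<tau> s\<close> is \<open>q\<^sup>s\<close> for \<open>q = e\<^bsup>2\<pi>i\<tau>\<^esup>\<close>. The branch for non-integral \<open>s\<close> is the one
  determined by \<open>\<tau>\<close>; the principal branch of \<^term>\<open>(powr)\<close> would be wrong for general \<open>\<tau>\<close>.
\<close>
definition nome_pow :: "complex \<Rightarrow> real \<Rightarrow> complex" where
  "nome_pow \<tau> s = exp (2 * of_real pi * \<i> * \<tau> * of_real s)"

text \<open>The factor of index \<open>j\<close> is the one for \<open>k = j + 1\<close>, so that \<open>k - 1/2 = j + 1/2\<close>.\<close>
definition kw_product :: "nat \<Rightarrow> nat \<Rightarrow> complex \<Rightarrow> complex \<Rightarrow> complex" where
  "kw_product m n \<tau> \<zeta> =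
     (\<Prod>j. ((1 + \<zeta> * nome_pow \<tau> (real j + 1/2)) ^ m *
            (1 + inverse \<zeta> * nome_pow \<tau> (real j + 1/2)) ^ m) /
           ((1 - \<zeta> * nome_pow \<tau> (real j + 1/2)) ^ n *
            (1 - inverse \<zeta> * nome_pow \<tau> (real j + 1/2)) ^ n))"

text \<open>
  The coefficient family of the Laurent expansion of \<open>f\<close> in the annulus \<open>r < |z| < R\<close>. It exists
  and is unique whenever \<open>f\<close> is holomorphic there and \<open>0 \<le> r < R\<close>. The two-sided series is taken as
  an unordered sum, since a Laurent series converges absolutely in its open annulus.
\<close>
definition laurent_coeff :: "(complex \<Rightarrow> complex) \<Rightarrow> real \<Rightarrow> real \<Rightarrow> int \<Rightarrow> complex" where
  "laurent_coeff f r R =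
     (THE c. \<forall>z. r < norm z \<and> norm z < R \<longrightarrow>
        ((\<lambda>l. c l * z powi l) has_sum f z) UNIV)"

definition chF :: "nat \<Rightarrow> nat \<Rightarrow> int \<Rightarrow> complex \<Rightarrow> complex" where
  "chF m n l \<tau> =
     laurent_coeff (kw_product m n \<tau>)
       (norm (nome_pow \<tau> 1) powr (1/2)) (norm (nome_pow \<tau> 1) powr (-1/2)) l"

definition tr_L :: "nat \<Rightarrow> nat \<Rightarrow> int \<Rightarrow> complex \<Rightarrow> complex" where
  "tr_L m n l \<tau> = chF m n l \<tau> * (\<Prod>j. 1 - nome_pow \<tau> 1 ^ Suc j)"

text \<open>
  Euler numbers and Bernoulli polynomials, read off from their exponential generating functions
  \<open>2 / (e\<^sup>x + e\<^bsup>-x\<^esup>)\<close> and \<open>x e\<^bsup>zx\<^esup> / (e\<^sup>x - 1)\<close>. In the latter, division of formal power series cancels the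
  common factor \<open>x\<close>.
\<close>
definition euler_number :: "nat \<Rightarrow> real" where
  "euler_number k = fact k * fps_nth (2 / (fps_exp 1 + fps_exp (- 1))) k"

definition bernoulli_poly :: "nat \<Rightarrow> real \<Rightarrow> real" where
  "bernoulli_poly k z = fact k * fps_nth (fps_X * fps_exp z / (fps_exp 1 - 1)) k"

text \<open>
  \<open>higher_euler k n\<close> is \<open>\<E>\<^bsub>k,n\<^esub>\<close>. Only \<open>n \<ge> 1\<close> is meaningful; the value at \<open>n = 0\<close> is a dummy that the
  recurrence never reaches. The conditional implements \<open>\<E>\<^bsub>k,n\<^esub> = 0\<close> for \<open>k < 0\<close>.
\<close>
fun higher_euler :: "nat \<Rightarrow> nat \<Rightarrow> complex" where
  "higher_euler k 0 = 0"
| "higher_euler k (Suc 0) = (- 2 * \<i>) powi (- int k) * of_real (euler_number k)"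
| "higher_euler k (Suc (Suc 0)) =
     2 * \<i> powi (- int k) / of_real pi * of_real (bernoulli_poly k (1/2))"
| "higher_euler k (Suc (Suc (Suc j))) =
     (let n = Suc j in
        of_nat n / of_nat (n + 1) * higher_euler k n
        - of_nat k * (of_nat k - 1) / (of_real pi ^ 2 * of_nat n * of_nat (n + 1)) *
          (if k < 2 then 0 else higher_euler (k - 2) n))"

definition asym_coeff :: "nat \<Rightarrow> nat \<Rightarrow> int \<Rightarrow> nat \<Rightarrow> complex" where
  "asym_coeff m n l r =
     (- of_real pi) ^ r *
     (\<Sum>k=0..r. of_nat (r choose k) * (of_nat m - of_nat n) ^ k *
                (2 * \<i> * of_int l) ^ (r - k) * higher_euler (k + r) n)"

end

theory Submission
  imports Defs "HOL-Probability.Probability" "HOL-Complex_Analysis.Complex_Analysis" "HOL-Real_Asymp.Real_Asymp"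
begin

text \<open>
  Let \<open>q = exp (- 2 * pi * t)\<close>, \<open>p = exp (- pi * t)\<close> and \<open>\<theta> x = (\<Sum>j. exp (- pi * (x - j)\<^sup>2 / t))\<close>, the sum
  over all integers. By the Jacobi triple product, \<open>\<Prod>(1 - q^k)\<close> times the product
  \<open>\<Prod>(1 + \<zeta> q^(k-1/2)) (1 + \<zeta>\<^sup>-\<^sup>1 q^(k-1/2))\<close> is the theta series \<open>\<Sum>p^(j\<^sup>2) \<zeta>^j\<close>, and Poisson summation turns this
  series, at \<open>\<zeta> = exp (2 * pi * \<i> * x)\<close>, into \<open>\<theta> x / sqrt t\<close>; the sign change \<open>- \<zeta>\<close> in the denominators
  becomes the shift \<open>x + 1/2\<close>. Hence the coefficient \<open>ch F\<^sub>l\<close> is, up to an explicit factor, the Fourier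
  coefficient of \<open>\<theta> x ^ m / \<theta> (x + 1/2) ^ n\<close> over one period.

  The inverted series are the right ones for small \<open>t\<close>: on \<open>\<bar>x\<bar> \<le> 1/2\<close> one summand dominates \<open>\<theta> x\<close>, and
  two summands, which together form a hyperbolic cosine, dominate \<open>\<theta> (x + 1/2)\<close>. The quotient is therefore
  \<open>exp (pi * n / (4 * t)) * exp (- pi * (m - n) * x\<^sup>2 / t) / (2 * cosh (pi * x / t)) ^ n\<close> up to a relative
  error that is only bounded near \<open>\<bar>x\<bar> = 1/2\<close>; there the Gaussian, present because \<open>m > n\<close>, makes the absolute
  error exponentially small after the first factor is removed. Substituting \<open>x = t * u\<close> leads to
  \<open>\<integral> exp (- pi * t * ((m - n) * u\<^sup>2 + 2 * \<i> * l * u)) / cosh (pi * u) ^ n\<close>. Truncation to \<open>\<bar>u\<bar> \<le> 1 / (2 * t)\<close> costs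
  less than any power of \<open>t\<close>, and expanding the exponential in powers of \<open>t\<close> produces the moments
  \<open>\<integral> u ^ k / cosh (pi * u) ^ n\<close>. They are the numbers \<open>\<E>\<^bsub>k,n\<^esub>\<close>: the recurrence in \<open>n\<close> is integration by
  parts, and for \<open>n = 1, 2\<close> shifting the contour by \<open>\<plusminus> \<i>/2\<close> gives the convolution identities that characterise
  the Euler numbers and the values \<open>B\<^sub>k (1/2)\<close>.

  The remaining prefactor is a power of \<open>\<Prod>(1 - q^k)\<close>. Its behaviour as \<open>t \<rightarrow> 0\<close> comes from the same two
  theorems: Euler's pentagonal number theorem is the triple product for \<open>p\<^sup>3\<close> at \<open>\<zeta> = - p\<close>, and the inverted
  series then has two dominant terms.

  The steps are carried by \<open>Jacobi_triple_product\<close>, \<open>theta_inversion\<close>, \<open>euler_prod_asymp\<close>,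
  \<open>higher_euler_eq_sech_moment\<close>, \<open>tr_L_eq_integral\<close>, \<open>theta_ratio_approx\<close>, \<open>phase_integral_expansion\<close> and
  \<open>truncated_phase_integral\<close>.
\<close>

section \<open>Two-sided sums\<close>

text \<open>
  Sums over the integers are integrated term by term by enumerating the integers, which reduces the
  statement to the theorem for series.
\<close>
lemma has_sum_integral:
  fixes f :: "int \<Rightarrow> 'a \<Rightarrow> complex"
  assumes int: "\<And>i. integrable M (f i)"
    and summ: "(\<lambda>i. \<integral>x. norm (f i x) \<partial>M) summable_on UNIV"
    and ptw: "\<And>x. x \<in> space M \<Longrightarrow> ((\<lambda>i. f i x) has_sum F x) UNIV"
  shows "integrable M F" "((\<lambda>i. \<integral>x. f i x \<partial>M) has_sum (\<integral>x. F x \<partial>M)) UNIV"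
proof -
  have bij: "bij_betw int_decode UNIV UNIV" by (rule bij_int_decode)
  define g where "g = (\<lambda>n. f (int_decode n))"
  have F: "(\<Sum>n. g n x) = F x" and sg: "summable (\<lambda>n. norm (g n x))" if "x \<in> space M" for x
  proof -
    have "((\<lambda>n. g n x) has_sum F x) UNIV"
      unfolding g_def using has_sum_reindex_bij_betw[OF bij, of "\<lambda>i. f i x"] ptw[OF that] by simp
    from sums_unique[OF has_sum_imp_sums[OF this]] show "(\<Sum>n. g n x) = F x" by simp
    have "(\<lambda>i. norm (f i x)) summable_on UNIV"
      using has_sum_imp_summable[OF ptw[OF that]]
      by (rule summable_on_iff_abs_summable_on_complex[THEN iffD1])
    then have "(\<lambda>n. norm (g n x)) summable_on UNIV"
      unfolding g_def using summable_on_reindex_bij_betw[OF bij, of "\<lambda>i. norm (f i x)"] by simp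
    then show "summable (\<lambda>n. norm (g n x))" by (rule summable_on_imp_summable)
  qed
  have s2: "summable (\<lambda>n. \<integral>x. norm (g n x) \<partial>M)"
    unfolding g_def
    using summable_on_reindex_bij_betw[OF bij, of "\<lambda>i. \<integral>x. norm (f i x) \<partial>M"] summ
    by (intro summable_on_imp_summable) simp
  have ig: "integrable M (g n)" for n unfolding g_def by (rule int)
  have "integrable M (\<lambda>x. \<Sum>n. g n x)"
    by (rule integrable_suminf[OF ig _ s2]) (rule AE_I2, rule sg)
  also have "integrable M (\<lambda>x. \<Sum>n. g n x) \<longleftrightarrow> integrable M F"
    by (rule Bochner_Integration.integrable_cong[OF refl F])
  finally show "integrable M F" .
  have "(\<lambda>n. \<integral>x. g n x \<partial>M) sums (\<integral>x. (\<Sum>n. g n x) \<partial>M)"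
    by (rule sums_integral[OF ig _ s2]) (rule AE_I2, rule sg)
  also have "(\<integral>x. (\<Sum>n. g n x) \<partial>M) = (\<integral>x. F x \<partial>M)"
    by (rule Bochner_Integration.integral_cong[OF refl F])
  finally have sums: "(\<lambda>n. \<integral>x. g n x \<partial>M) sums (\<integral>x. F x \<partial>M)" .
  have "summable (\<lambda>n. norm (\<integral>x. g n x \<partial>M))"
    by (rule summable_comparison_test'[OF s2, of 0]) (simp add: integral_norm_bound)
  then have "((\<lambda>n. \<integral>x. g n x \<partial>M) has_sum (\<integral>x. F x \<partial>M)) UNIV"
    by (rule norm_summable_imp_has_sum[OF _ sums])
  then show "((\<lambda>i. \<integral>x. f i x \<partial>M) has_sum (\<integral>x. F x \<partial>M)) UNIV"
    unfolding g_def using has_sum_reindex_bij_betw[OF bij, of "\<lambda>i. \<integral>x. f i x \<partial>M"] by simp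
qed

lemma summable_exp_abs_int:
  assumes "c > 0"
  shows "(\<lambda>j::int. exp (- c * \<bar>of_int j\<bar>) :: real) summable_on UNIV"
proof -
  have s: "(\<lambda>n. exp (- c * real n)) summable_on UNIV"
  proof (rule norm_summable_imp_summable_on)
    have "summable (\<lambda>n. exp (- c) ^ n)" using assms by (intro summable_geometric) simp
    then show "summable (\<lambda>n. norm (exp (- c * real n)))"
      by (simp add: exp_of_nat_mult[symmetric] mult.commute)
  qed
  have b1: "bij_betw int UNIV {0..}" by (rule bij_betwI[where g = nat]) auto
  have b2: "bij_betw (\<lambda>n. - int n) UNIV {..0}" by (rule bij_betwI[where g = "\<lambda>j. nat (- j)"]) auto
  have "(\<lambda>j::int. exp (- c * \<bar>of_int j\<bar>) :: real) summable_on {0..}"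
    "(\<lambda>j::int. exp (- c * \<bar>of_int j\<bar>) :: real) summable_on {..0}"
    using s by (subst summable_on_reindex_bij_betw[OF b1, symmetric] summable_on_reindex_bij_betw[OF b2, symmetric]; simp)+
  then have "(\<lambda>j::int. exp (- c * \<bar>of_int j\<bar>) :: real) summable_on ({0..} \<union> {..0})"
    by (rule summable_on_union)
  also have "({0..} \<union> {..0}) = (UNIV :: int set)" by auto
  finally show ?thesis .
qed

lemma filterlim_symmetric_intervals_int: "filterlim (\<lambda>n. {- int n..int n}) (finite_subsets_at_top UNIV) sequentially"
  unfolding filterlim_finite_subsets_at_top
proof (intro allI impI)
  fix X :: "int set" assume X: "finite X \<and> X \<subseteq> UNIV"
  define N where "N = Max (insert 0 ((\<lambda>x. nat \<bar>x\<bar>) ` X))"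
  have "x \<in> {- int n..int n}" if "x \<in> X" "n \<ge> N" for x n
  proof -
    have "nat \<bar>x\<bar> \<le> N" unfolding N_def using X that by (intro Max_ge) auto
    then show ?thesis using that by auto
  qed
  then show "eventually (\<lambda>n. finite {- int n..int n} \<and> X \<subseteq> {- int n..int n} \<and> {- int n..int n} \<subseteq> UNIV) sequentially"
    using X by (auto simp: eventually_sequentially intro!: exI[of _ N])
qed

text \<open>
  Tails of theta series will be bounded by multiples of this constant.
\<close>
definition exp_abs_sum :: real where
  "exp_abs_sum = (\<Sum>\<^sub>\<infinity>j::int. exp (- \<bar>of_int j\<bar>))"

lemma exp_abs_sum_nonneg: "exp_abs_sum \<ge> 0"
  unfolding exp_abs_sum_def by (rule infsum_nonneg) simp

lemma has_sum_tail_bound: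
  fixes f :: "int \<Rightarrow> 'a::{banach, real_normed_algebra_1}"
  assumes S: "(f has_sum S) UNIV" and K: "finite K"
    and B: "\<And>j. j \<notin> K \<Longrightarrow> norm (f j) \<le> B * exp (- \<bar>of_int j\<bar>)" and "B \<ge> 0"
  shows "norm (S - (\<Sum>j\<in>K. f j)) \<le> B * exp_abs_sum"
proof -
  have "((\<lambda>j. if j \<in> K then f j else 0) has_sum (\<Sum>j\<in>K. f j)) UNIV"
    by (rule has_sum_finite_neutralI[OF K]) auto
  from has_sum_add[OF S has_sum_uminusI[OF this]]
  have "((\<lambda>j. f j - (if j \<in> K then f j else 0)) has_sum (S - (\<Sum>j\<in>K. f j))) UNIV" by simp
  moreover have "((\<lambda>j::int. B * exp (- \<bar>of_int j\<bar>)) has_sum B * exp_abs_sum) UNIV"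
    unfolding exp_abs_sum_def using summable_exp_abs_int[of 1] by (intro has_sum_cmult_right has_sum_infsum) simp
  moreover have "norm (f j - (if j \<in> K then f j else 0)) \<le> B * exp (- \<bar>of_int j\<bar>)" for j
    using B[of j] \<open>B \<ge> 0\<close> by auto
  ultimately show ?thesis by (rule norm_infsum_le)
qed

section \<open>Fourier and Laurent coefficients\<close>

text \<open>
  The half-open interval makes the integer translates of the period a partition of the real line.
\<close>
definition period :: "real measure" where
  "period = restrict_space lborel {-1/2..<1/2}"

definition fourier_coeff :: "(real \<Rightarrow> complex) \<Rightarrow> int \<Rightarrow> complex" where
  "fourier_coeff f k = (\<integral>x. f x * cis (- 2 * pi * of_int k * x) \<partial>period)"

lemma space_period [simp]: "space period = {-(1/2)..<1/2}"
  by (simp add: period_def space_restrict_space)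

lemma finite_measure_period: "finite_measure period"
  by (rule finite_measureI) (simp add: period_def emeasure_restrict_space space_restrict_space)

lemma measure_period [simp]: "measure period {-(1/2)..<1/2} = 1"
  by (simp add: period_def measure_restrict_space)

lemma borel_measurable_period: "f \<in> borel_measurable borel \<Longrightarrow> f \<in> borel_measurable period"
  unfolding period_def by (rule measurable_restrict_space1) simp

lemma integrable_period_bounded:
  fixes f :: "real \<Rightarrow> 'a::{banach, second_countable_topology}"
  assumes "f \<in> borel_measurable period" "\<And>x. \<bar>x\<bar> \<le> 1/2 \<Longrightarrow> norm (f x) \<le> B"
  shows "integrable period f"
proof -
  interpret finite_measure period by (rule finite_measure_period)
  show ?thesis
    by (intro integrable_const_bound[where B = B] AE_I2 assms)
       (auto simp: abs_le_iff)
qed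

lemma cis_borel [measurable]: "cis \<in> borel_measurable borel"
  by (intro borel_measurable_continuous_onI continuous_intros)

lemma cis_period [measurable]: "(\<lambda>x. cis (a * x)) \<in> borel_measurable period"
  by (intro borel_measurable_period) measurable

lemma integrable_period_mode:
  assumes "f \<in> borel_measurable period" "\<And>x. \<bar>x\<bar> \<le> 1/2 \<Longrightarrow> norm (f x) \<le> B"
  shows "integrable period (\<lambda>x. f x * cis (- 2 * pi * of_int k * x))"
proof (rule integrable_period_bounded[where B = B])
  show "(\<lambda>x. f x * cis (- 2 * pi * of_int k * x)) \<in> borel_measurable period"
    by (rule borel_measurable_times[OF assms(1) cis_period])
qed (use assms(2) in \<open>simp add: norm_mult\<close>)

lemma integral_cis_period:
  "(\<integral>x. cis (2 * pi * of_int k * x) \<partial>period) = (if k = 0 then 1 else 0)"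
proof (cases "k = 0")
  case True
  have "(\<integral>x. 1 \<partial>period) = (1::complex)"
    by simp
  then show ?thesis using True by simp
next
  case False
  define F where "F = (\<lambda>x. cis (2 * pi * of_int k * x) / (2 * pi * \<i> * of_int k))"
  have "(\<integral>x. cis (2 * pi * of_int k * x) \<partial>period) =
        (\<integral>x. indicator {-1/2..<1/2} x *\<^sub>R cis (2 * pi * of_int k * x) \<partial>lborel)"
    unfolding period_def by (subst integral_restrict_space) auto
  also have "\<dots> = (\<integral>x. indicator {-1/2..1/2} x *\<^sub>R cis (2 * pi * of_int k * x) \<partial>lborel)"
  proof (rule integral_cong_AE)
    show "AE x in lborel. indicator {-1/2..<1/2} x *\<^sub>R cis (2 * pi * of_int k * x) =
        indicator {-1/2..1/2} x *\<^sub>R cis (2 * pi * of_int k * x)"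
      using AE_lborel_singleton[of "1/2::real"] by eventually_elim (auto simp: indicator_def)
  qed measurable
  also have "\<dots> = F (1/2) - F (-1/2)"
  proof (rule integral_FTC_Icc)
    fix x :: real
    have "((\<lambda>z. exp (\<i> * (2 * pi * of_int k * z)) / (2 * pi * \<i> * of_int k)) has_field_derivative
        exp (\<i> * (2 * pi * of_int k * of_real x))) (at (of_real x))"
      using False by (auto intro!: derivative_eq_intros)
    from has_vector_derivative_real_field[OF this]
    have "((\<lambda>x. exp (\<i> * of_real (2 * pi * of_int k * x)) / (2 * pi * \<i> * of_int k)) has_vector_derivative
        exp (\<i> * of_real (2 * pi * of_int k * x))) (at x within {-1/2..1/2})" by simp
    then show "(F has_vector_derivative cis (2 * pi * of_int k * x)) (at x within {-1/2..1/2})"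
      unfolding F_def cis_conv_exp .
  qed (auto intro!: continuous_intros)
  also have "F (1/2) - F (-1/2) = 0"
  proof -
    have "2 * pi * of_int k * (1/2) = 2 * pi * of_int k * (- 1/2) + 2 * pi * of_int k" by (simp add: field_simps)
    then have "cis (2 * pi * of_int k * (1/2)) = cis (2 * pi * of_int k * (- 1/2)) * cis (2 * pi * of_int k)"
      by (simp only: cis_mult)
    also have "cis (2 * pi * of_int k) = 1"
      by (rule cis_multiple_2pi) simp
    finally show ?thesis unfolding F_def by simp
  qed
  finally show ?thesis using False by simp
qed

text \<open>
  A trigonometric series with absolutely summable coefficients may be integrated termwise, so it is the
  Fourier series of its sum. The same termwise argument shows that the sum is integrable.
\<close>
lemma fourier_coeff_series:
  assumes c: "(\<lambda>l. norm (c l)) summable_on (UNIV :: int set)"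
    and f: "\<And>x. ((\<lambda>l. c l * cis (2 * pi * of_int l * x)) has_sum f x) UNIV"
  shows "integrable period (\<lambda>x. f x * cis (- 2 * pi * of_int k * x))" "fourier_coeff f k = c k"
proof -
  let ?g = "\<lambda>l x. c l * cis (2 * pi * of_int (l - k) * x)"
  have int: "integrable period (?g i)" for i
  proof (rule integrable_period_bounded[where B = "norm (c i)"])
    show "?g i \<in> borel_measurable period"
      by (intro borel_measurable_times borel_measurable_const cis_period)
  qed (simp add: norm_mult)
  have summ: "(\<lambda>i. \<integral>x. norm (?g i x) \<partial>period) summable_on UNIV"
    using c by (simp add: norm_mult)
  have ptw: "((\<lambda>i. ?g i x) has_sum f x * cis (- 2 * pi * of_int k * x)) UNIV" for x
  proof -
    have "c l * cis (2 * pi * of_int l * x) * cis (- 2 * pi * of_int k * x) = ?g l x" for l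
      unfolding mult.assoc cis_mult by (simp add: algebra_simps)
    with has_sum_cmult_left[OF f, of x "cis (- 2 * pi * of_int k * x)"] show ?thesis by (simp only:)
  qed
  show "integrable period (\<lambda>x. f x * cis (- 2 * pi * of_int k * x))"
    by (rule has_sum_integral(1)[OF int summ ptw])
  have "(\<lambda>l. \<integral>x. ?g l x \<partial>period) = (\<lambda>l. if l = k then c k else 0)"
    by (simp only: integral_mult_right_zero integral_cis_period) auto
  moreover have "((\<lambda>l. if l = k then c k else 0) has_sum c k) UNIV"
    by (rule has_sum_finite_neutralI[of "{k}"]) auto
  ultimately show "fourier_coeff f k = c k"
    using has_sum_unique[OF has_sum_integral(2)[OF int summ ptw], of "c k"]
    unfolding fourier_coeff_def by simp
qed

text \<open>
  On the unit circle a Laurent series is a trigonometric series.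
\<close>
lemma fourier_coeff_Laurent:
  assumes "\<And>z. norm z = 1 \<Longrightarrow> ((\<lambda>l. c l * z powi l) has_sum f z) UNIV"
  shows "integrable period (\<lambda>x. f (cis (2 * pi * x)) * cis (- 2 * pi * of_int k * x))"
    and "c k = fourier_coeff (\<lambda>x. f (cis (2 * pi * x))) k"
proof -
  have c: "(\<lambda>l. norm (c l)) summable_on UNIV"
    using summable_on_iff_abs_summable_on_complex[THEN iffD1, OF has_sum_imp_summable[OF assms[of 1]]]
    by simp
  have f: "((\<lambda>l. c l * cis (2 * pi * of_int l * x)) has_sum f (cis (2 * pi * x))) UNIV" for x
    using assms[of "cis (2 * pi * x)"] by (simp add: Complex.cis_power_int mult_ac)
  show "integrable period (\<lambda>x. f (cis (2 * pi * x)) * cis (- 2 * pi * of_int k * x))"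
    by (rule fourier_coeff_series(1)[OF c f])
  show "c k = fourier_coeff (\<lambda>x. f (cis (2 * pi * x))) k"
    by (rule fourier_coeff_series(2)[OF c f, symmetric])
qed

text \<open>
  The unit circle lies in the annulus, so the coefficients of any expansion are Fourier coefficients of
  the function on the circle; this gives uniqueness as well as the formula.
\<close>
lemma laurent_coeff_eqI:
  assumes "r < 1" "1 < R"
    and "\<And>z. r < norm z \<Longrightarrow> norm z < R \<Longrightarrow> ((\<lambda>l. c l * z powi l) has_sum f z) UNIV"
  shows "laurent_coeff f r R k = fourier_coeff (\<lambda>x. f (cis (2 * pi * x))) k"
proof -
  have "laurent_coeff f r R = c"
    unfolding laurent_coeff_def
  proof (rule the_equality)
    fix d assume d: "\<forall>z. r < norm z \<and> norm z < R \<longrightarrow> ((\<lambda>l. d l * z powi l) has_sum f z) UNIV"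
    show "d = c"
    proof
      fix k show "d k = c k"
        using fourier_coeff_Laurent(2)[of d f k] fourier_coeff_Laurent(2)[of c f k] assms d by simp
    qed
  qed (use assms in auto)
  then show ?thesis using fourier_coeff_Laurent(2)[of c f k] assms by simp
qed

text \<open>
  The coefficient of \<open>z ^ l\<close> in the product of \<open>\<Sum>a i * z ^ i\<close> and \<open>\<Sum>b j * z ^ (- j)\<close>.
\<close>
definition laurent_conv :: "(nat \<Rightarrow> complex) \<Rightarrow> (nat \<Rightarrow> complex) \<Rightarrow> int \<Rightarrow> complex" where
  "laurent_conv a b l = (\<Sum>\<^sub>\<infinity>(i, j)\<in>{(i, j). int i - int j = l}. a i * b j)"

text \<open>
  The double series over pairs \<open>(i, j)\<close> converges absolutely and may be summed first along the diagonals
  \<open>i - j = l\<close>. This produces Laurent expansions in an annulus out of power series alone.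
\<close>
lemma has_sum_laurent_conv:
  assumes z: "z \<noteq> 0" and a: "(\<lambda>i. a i * z ^ i) sums f" "summable (\<lambda>i. norm (a i * z ^ i))"
    and b: "(\<lambda>j. b j * inverse z ^ j) sums g" "summable (\<lambda>j. norm (b j * inverse z ^ j))"
  shows "((\<lambda>l. laurent_conv a b l * z powi l) has_sum f * g) UNIV"
proof -
  define F where "F = (\<lambda>(i, j). a i * z ^ i * (b j * inverse z ^ j))"
  have ha: "((\<lambda>i. a i * z ^ i) has_sum f) UNIV" and hb: "((\<lambda>j. b j * inverse z ^ j) has_sum g) UNIV"
    by (rule norm_summable_imp_has_sum[OF a(2) a(1)], rule norm_summable_imp_has_sum[OF b(2) b(1)])
  have na: "(\<lambda>i. norm (a i * z ^ i)) summable_on UNIV" and nb: "(\<lambda>j. norm (b j * inverse z ^ j)) summable_on UNIV"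
    using a(2) b(2) by (auto intro!: norm_summable_imp_summable_on simp del: norm_mult)
  have "(\<lambda>p. norm (F p)) summable_on UNIV \<times> UNIV"
  proof (rule summable_on_SigmaI[where g = "\<lambda>i. norm (a i * z ^ i) * (\<Sum>\<^sub>\<infinity>j. norm (b j * inverse z ^ j))"])
    show "((\<lambda>y. norm (F (x, y))) has_sum norm (a x * z ^ x) * (\<Sum>\<^sub>\<infinity>j. norm (b j * inverse z ^ j))) UNIV" for x
      using has_sum_cmult_right[OF has_sum_infsum[OF nb], of "norm (a x * z ^ x)"]
      by (simp add: F_def norm_mult)
    show "(\<lambda>i. norm (a i * z ^ i) * (\<Sum>\<^sub>\<infinity>j. norm (b j * inverse z ^ j))) summable_on UNIV"
      by (intro summable_on_cmult_left na)
  qed auto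
  then have sF: "F summable_on UNIV \<times> UNIV" by (rule Infinite_Sum.abs_summable_summable)
  have hF: "(F has_sum f * g) (UNIV \<times> UNIV)"
  proof (rule has_sum_SigmaI[where g = "\<lambda>i. a i * z ^ i * g"])
    show "((\<lambda>y. F (x, y)) has_sum a x * z ^ x * g) UNIV" for x
      unfolding F_def by (auto intro: has_sum_cmult_right hb)
    show "((\<lambda>i. a i * z ^ i * g) has_sum f * g) UNIV"
      by (intro has_sum_cmult_left ha)
  qed (use sF in auto)
  define S where "S = (\<lambda>l::int. {(i, j). int i - int j = l})"
  have "bij_betw snd (Sigma UNIV S) (UNIV \<times> UNIV)"
    unfolding S_def by (rule bij_betwI[where g = "\<lambda>(i, j). (int i - int j, (i, j))"]) auto
  from has_sum_reindex_bij_betw[OF this, of F] hF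
  have "((\<lambda>x. F (snd x)) has_sum f * g) (Sigma UNIV S)" by simp
  then have hS: "((\<lambda>(l, p). F p) has_sum f * g) (Sigma UNIV S)" by (simp add: case_prod_unfold)
  have "(F has_sum laurent_conv a b l * z powi l) (S l)" for l
  proof -
    have eq: "F p = (case p of (i, j) \<Rightarrow> a i * b j) * z powi l" if "p \<in> S l" for p
    proof -
      obtain i j where p: "p = (i, j)" "int i - int j = l" using \<open>p \<in> S l\<close> by (auto simp: S_def)
      have "z ^ i * inverse z ^ j = z powi l"
        using z unfolding p(2)[symmetric] by (simp add: power_int_diff field_simps)
      then show ?thesis unfolding F_def p by (simp add: algebra_simps)
    qed
    have "F summable_on S l"
      using sF by (rule summable_on_subset_banach) (auto simp: S_def)
    then have "(\<lambda>p. (case p of (i, j) \<Rightarrow> a i * b j) * z powi l) summable_on S l"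
      by (subst (asm) summable_on_cong[OF eq])
    then have "(\<lambda>(i, j). a i * b j) summable_on S l"
      using z by (subst (asm) summable_on_cmult_left') auto
    then have "((\<lambda>(i, j). a i * b j) has_sum laurent_conv a b l) (S l)"
      unfolding laurent_conv_def S_def by simp
    then have "((\<lambda>p. (case p of (i, j) \<Rightarrow> a i * b j) * z powi l) has_sum laurent_conv a b l * z powi l) (S l)"
      by (rule has_sum_cmult_left)
    then show ?thesis by (subst has_sum_cong[OF eq])
  qed
  then show ?thesis
    by (intro has_sum_SigmaD[OF hS]) simp
qed

section \<open>The Jacobi triple product\<close>

text \<open>
  With \<open>p = q^(1/2)\<close> this is the factor of the triple product that is entire in \<open>z\<close>.
\<close>
definition theta_half :: "real \<Rightarrow> complex \<Rightarrow> complex" where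
  "theta_half p z = (\<Prod>j. 1 + z * of_real (p ^ (2 * j + 1)))"

text \<open>
  With \<open>p = q^(1/2)\<close> this is \<open>\<Prod>(1 - q^k)\<close>.
\<close>
definition euler_prod :: "real \<Rightarrow> real" where
  "euler_prod p = (\<Prod>j. 1 - p ^ (2 * j + 2))"

text \<open>
  Euler's coefficients \<open>q^(k\<^sup>2/2) / ((1 - q) \<dots> (1 - q^k))\<close> of the power series of \<open>theta_half\<close>.
\<close>
definition euler_coeff :: "real \<Rightarrow> nat \<Rightarrow> real" where
  "euler_coeff p k = p ^ (k ^ 2) / (\<Prod>i<k. 1 - p ^ (2 * i + 2))"

lemma convergent_prod_1_plus:
  fixes f :: "nat \<Rightarrow> 'a::{real_normed_field,banach,complete_space,comm_ring_1}"
  assumes "summable (\<lambda>j. norm (f j))"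
  shows "convergent_prod (\<lambda>j. 1 + f j)"
  by (rule abs_convergent_prod_imp_convergent_prod) (use assms in \<open>simp add: abs_convergent_prod_conv_summable\<close>)

context
  fixes p :: real
  assumes p: "0 < p" "p < 1"
begin

lemma summable_p_odd: "summable (\<lambda>j. p ^ (2 * j + 1))" and summable_p_even: "summable (\<lambda>j. p ^ (2 * j + 2))"
proof -
  have "norm (p ^ 2) < 1" using p by (simp add: power_less_one_iff abs_square_less_1)
  then have "summable (\<lambda>j. p * (p ^ 2) ^ j)" "summable (\<lambda>j. p ^ 2 * (p ^ 2) ^ j)"
    by (intro summable_mult summable_geometric; simp)+
  moreover have "p * (p ^ 2) ^ j = p ^ (2 * j + 1)" "p ^ 2 * (p ^ 2) ^ j = p ^ (2 * j + 2)" for j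
    by (simp_all add: power_add power_even_eq power_mult_distrib power2_eq_square)
  ultimately show "summable (\<lambda>j. p ^ (2 * j + 1))" "summable (\<lambda>j. p ^ (2 * j + 2))"
    by simp_all
qed

lemma convergent_theta_half: "convergent_prod (\<lambda>j. 1 + z * complex_of_real (p ^ (2 * j + 1)))"
  by (rule convergent_prod_1_plus)
     (use summable_mult[OF summable_p_odd, of "norm z"] p in \<open>simp add: norm_mult norm_power\<close>)

lemma pow_even_less_1: "p ^ (2 * i + 2) < 1"
  using p power_strict_decreasing[of 0 "2 * i + 2" p] by simp

lemma convergent_euler_prod: "convergent_prod (\<lambda>j. 1 - p ^ (2 * j + 2))"
  using convergent_prod_1_plus[of "\<lambda>j. - (p ^ (2 * j + 2))"] summable_p_even p by (simp add: norm_power)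

lemma euler_prod_LIMSEQ: "(\<lambda>n. \<Prod>i<n. 1 - p ^ (2 * i + 2)) \<longlonglongrightarrow> euler_prod p"
  using convergent_prod_LIMSEQ[OF convergent_euler_prod]
  unfolding euler_prod_def by (subst LIMSEQ_lessThan_iff_atMost)

lemma partial_euler_prod_pos: "0 < (\<Prod>i<n. 1 - p ^ (2 * i + 2))"
  using pow_even_less_1 by (intro prod_pos) (simp add: less_diff_eq)

lemma euler_prod_pos: "0 < euler_prod p" and euler_prod_le: "euler_prod p \<le> (\<Prod>i<n. 1 - p ^ (2 * i + 2))"
proof -
  have nz: "euler_prod p \<noteq> 0"
    unfolding euler_prod_def using pow_even_less_1 
    by (intro prodinf_nonzero convergent_euler_prod) (simp add: less_imp_neq)
  have "decseq (\<lambda>n. \<Prod>i<n. 1 - p ^ (2 * i + 2))"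
  proof (rule decseq_SucI)
    show "(\<Prod>i<Suc n. 1 - p ^ (2 * i + 2)) \<le> (\<Prod>i<n. 1 - p ^ (2 * i + 2))" for n
      using partial_euler_prod_pos[of n] p by (simp add: mult_le_cancel_left1)
  qed
  then show "euler_prod p \<le> (\<Prod>i<n. 1 - p ^ (2 * i + 2))"
    by (rule decseq_ge[OF _ euler_prod_LIMSEQ])
  have "0 \<le> euler_prod p"
    by (rule LIMSEQ_le_const[OF euler_prod_LIMSEQ]) (use less_imp_le[OF partial_euler_prod_pos] in auto)
  with nz show "0 < euler_prod p" by simp
qed

lemma euler_coeff_nonneg: "0 \<le> euler_coeff p k"
  unfolding euler_coeff_def using p partial_euler_prod_pos[of k] by simp

lemma euler_coeff_Suc: "euler_coeff p (Suc k) * (1 - p ^ (2 * k + 2)) = p ^ (2 * k + 1) * euler_coeff p k"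
proof -
  have "1 - p ^ (2 * k + 2) \<noteq> 0" using pow_even_less_1[of k] by simp
  moreover have "p ^ (Suc k)\<^sup>2 = p ^ (2 * k + 1) * p ^ k\<^sup>2"
    unfolding power_add[symmetric] by (rule arg_cong[of _ _ "\<lambda>n. p ^ n"]) (simp add: power2_eq_square)
  ultimately show ?thesis unfolding euler_coeff_def by simp
qed

lemma euler_coeff_summable: "summable (\<lambda>k. norm (complex_of_real (euler_coeff p k) * z ^ k))"
proof -
  define K where "K = norm z / (1 - p ^ 2)"
  have p2: "p ^ 2 < 1" using p by (simp add: power_less_one_iff abs_square_less_1)
  have "(\<lambda>k. p ^ (2 * k + 1) * K) \<longlonglongrightarrow> 0 * K"
    by (intro tendsto_mult summable_LIMSEQ_zero summable_p_odd tendsto_const)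
  then have "eventually (\<lambda>k. p ^ (2 * k + 1) * K < 1 / 2) sequentially"
    by (intro order_tendstoD(2)[where y = "0 * K"]) auto
  then obtain N where N: "\<And>k. k \<ge> N \<Longrightarrow> p ^ (2 * k + 1) * K < 1 / 2"
    by (auto simp: eventually_sequentially)
  show ?thesis
  proof (rule summable_ratio_test[of "1/2" N])
    fix k assume "k \<ge> N"
    have le: "1 - p ^ 2 \<le> 1 - p ^ (2 * k + 2)" using p power_decreasing[of 2 "2 * k + 2" p] by simp
    have pos: "0 < 1 - p ^ (2 * k + 2)" using le p2 by linarith
    have a: "euler_coeff p (Suc k) = p ^ (2 * k + 1) / (1 - p ^ (2 * k + 2)) * euler_coeff p k"
      using euler_coeff_Suc[of k] pos by (simp add: field_simps)
    have "p ^ (2 * k + 1) / (1 - p ^ (2 * k + 2)) * norm z \<le> p ^ (2 * k + 1) / (1 - p ^ 2) * norm z"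
      using le p p2 by (intro mult_right_mono divide_left_mono) auto
    also have "\<dots> \<le> 1 / 2" using N[OF \<open>k \<ge> N\<close>] by (simp add: K_def)
    finally have r: "p ^ (2 * k + 1) / (1 - p ^ (2 * k + 2)) * norm z \<le> 1 / 2" .
    have "norm (complex_of_real (euler_coeff p (Suc k)) * z ^ Suc k) =
       (p ^ (2 * k + 1) / (1 - p ^ (2 * k + 2)) * norm z) * (euler_coeff p k * norm z ^ k)"
      unfolding norm_mult norm_power norm_of_real abs_of_nonneg[OF euler_coeff_nonneg] unfolding a by simp
    also have "\<dots> \<le> 1 / 2 * (euler_coeff p k * norm z ^ k)"
      by (rule mult_right_mono[OF r]) (simp add: euler_coeff_nonneg)
    finally show "norm (norm (complex_of_real (euler_coeff p (Suc k)) * z ^ Suc k)) \<le>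
        1 / 2 * norm (norm (complex_of_real (euler_coeff p k) * z ^ k))"
      using euler_coeff_nonneg[of k] by (simp add: norm_mult norm_power)
  qed simp
qed

text \<open>
  The recursion for the coefficients says that the power series satisfies the functional equation
  of the product.
\<close>
lemma euler_series_functional:
  fixes z :: complex
  shows "(\<Sum>k. complex_of_real (euler_coeff p k) * z ^ k) =
   (1 + z * p) * (\<Sum>k. complex_of_real (euler_coeff p k) * (of_real (p ^ 2) * z) ^ k)"
proof -
  let ?a = "\<lambda>k. complex_of_real (euler_coeff p k)"
  let ?w = "of_real (p ^ 2) * z"
  have s1: "summable (\<lambda>k. ?a k * z ^ k)" and s2: "summable (\<lambda>k. ?a k * ?w ^ k)"
    by (rule summable_norm_cancel, rule euler_coeff_summable)+
  have "(\<Sum>k. ?a k * z ^ k) - (\<Sum>k. ?a k * ?w ^ k) = (\<Sum>k. ?a k * z ^ k - ?a k * ?w ^ k)"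
    by (rule suminf_diff[OF s1 s2])
  also have "\<dots> = (\<Sum>k. ?a (Suc k) * z ^ Suc k - ?a (Suc k) * ?w ^ Suc k)"
    using suminf_split_head[OF summable_diff[OF s1 s2]] by simp
  also have "\<dots> = (\<Sum>k. z * p * (?a k * ?w ^ k))"
  proof (rule suminf_cong)
    fix k
    have "?a (Suc k) * (1 - of_real (p ^ (2 * k + 2))) = of_real (p ^ (2 * k + 1)) * ?a k"
      by (metis euler_coeff_Suc of_real_1 of_real_diff of_real_mult)
    moreover have "?a (Suc k) * z ^ Suc k - ?a (Suc k) * ?w ^ Suc k = 
       ?a (Suc k) * (1 - of_real (p ^ (2 * k + 2))) * z ^ Suc k"
      by (simp add: power_mult_distrib algebra_simps mult_2_right power_add power2_eq_square)
    moreover have "of_real (p ^ (2 * k + 1)) * ?a k * z ^ Suc k = z * p * (?a k * ?w ^ k)"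
      by (simp add: power_mult_distrib algebra_simps mult_2_right power_add power2_eq_square)
    ultimately show "?a (Suc k) * z ^ Suc k - ?a (Suc k) * ?w ^ Suc k = z * p * (?a k * ?w ^ k)" by simp
  qed
  also have "\<dots> = z * p * (\<Sum>k. ?a k * ?w ^ k)" by (rule suminf_mult[OF s2])
  finally show ?thesis by (simp add: algebra_simps)
qed

text \<open>
  Iterating the functional equation \<open>n\<close> times splits off the first \<open>n\<close> factors of the product; the
  remaining value of the series is taken at a point that tends to \<open>0\<close>, where the series equals \<open>1\<close>.
\<close>
lemma theta_half_eq_series: "theta_half p z = (\<Sum>k. complex_of_real (euler_coeff p k) * z ^ k)"
proof -
  let ?S = "\<lambda>z. \<Sum>k. complex_of_real (euler_coeff p k) * z ^ k"
  (* the tail of the product after n factors, expressed by the series itself *)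
  have iter: "?S z = (\<Prod>j<n. 1 + z * of_real (p ^ (2 * j + 1))) * ?S (of_real (p ^ (2 * n)) * z)" for n
  proof (induction n)
    case (Suc n)
    have "?S (of_real (p ^ (2 * n)) * z) = (1 + z * of_real (p ^ (2 * n + 1))) * ?S (of_real (p ^ (2 * Suc n)) * z)"
      by (subst euler_series_functional[of "of_real (p ^ (2 * n)) * z"]) (simp add: algebra_simps power_add power2_eq_square)
    with Suc show ?case by simp
  qed simp
  have "isCont ?S 0"
    by (rule isCont_powser[where K = 1]) (use summable_norm_cancel[OF euler_coeff_summable[of 1]] in auto)
  moreover have "(\<lambda>n. of_real (p ^ (2 * n)) * z) \<longlonglongrightarrow> of_real 0 * z"
  proof (intro tendsto_mult tendsto_of_real tendsto_const)
    have "(\<lambda>n. (p ^ 2) ^ n) \<longlonglongrightarrow> 0" using p by (intro LIMSEQ_realpow_zero) (auto simp: power_less_one_iff abs_square_less_1)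
    then show "(\<lambda>n. p ^ (2 * n)) \<longlonglongrightarrow> 0" by (simp add: power_mult)
  qed
  ultimately have "(\<lambda>n. ?S (of_real (p ^ (2 * n)) * z)) \<longlonglongrightarrow> ?S 0"
    by (intro isCont_tendsto_compose[where g = ?S]) auto
  moreover have "?S 0 = 1" by (subst powser_zero) (simp add: euler_coeff_def)
  moreover have "(\<lambda>n. \<Prod>j<n. 1 + z * of_real (p ^ (2 * j + 1))) \<longlonglongrightarrow> theta_half p z"
    using convergent_prod_LIMSEQ[OF convergent_theta_half] unfolding theta_half_def
    by (subst LIMSEQ_lessThan_iff_atMost)
  ultimately have "(\<lambda>n. (\<Prod>j<n. 1 + z * of_real (p ^ (2 * j + 1))) * ?S (of_real (p ^ (2 * n)) * z)) \<longlonglongrightarrow> theta_half p z * 1"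
    by (intro tendsto_mult) auto
  then have "(\<lambda>n. ?S z) \<longlonglongrightarrow> theta_half p z" unfolding iter[symmetric] by simp
  then show ?thesis by (simp add: LIMSEQ_const_iff)
qed

lemma theta_half_sums: "(\<lambda>k. complex_of_real (euler_coeff p k) * z ^ k) sums theta_half p z"
  unfolding theta_half_eq_series by (rule summable_sums[OF summable_norm_cancel[OF euler_coeff_summable]])

lemma theta_half_functional: "theta_half p z = (1 + z * p) * theta_half p (of_real (p ^ 2) * z)"
  unfolding theta_half_eq_series by (rule euler_series_functional)

definition theta_coeff :: "int \<Rightarrow> complex" where
  "theta_coeff = laurent_conv (\<lambda>k. of_real (euler_coeff p k)) (\<lambda>k. of_real (euler_coeff p k))"

lemma has_sum_theta_coeff:
  assumes "z \<noteq> 0"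
  shows "((\<lambda>l. theta_coeff l * z powi l) has_sum theta_half p z * theta_half p (inverse z)) UNIV"
  unfolding theta_coeff_def
  by (intro has_sum_laurent_conv theta_half_sums euler_coeff_summable assms)

text \<open>
  The product \<open>A z = theta_half p z * theta_half p (1/z)\<close> satisfies \<open>A (p\<^sup>2 * z) = A z / (p * z)\<close>. Comparing
  Laurent coefficients on the unit circle yields a first-order recursion.
\<close>
lemma theta_coeff_Suc: "theta_coeff (l + 1) = of_real (p powi (2 * l + 1)) * theta_coeff l"
proof -
  let ?w = "complex_of_real (p ^ 2)"
  let ?f = "\<lambda>z::complex. theta_half p (?w * z) * theta_half p (inverse (?w * z))"
  have 1: "((\<lambda>l. (theta_coeff l * ?w powi l) * z powi l) has_sum ?f z) UNIV" if "norm z = 1" for z :: complex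
  proof -
    have nz: "?w * z \<noteq> 0" using that p by auto
    have "theta_coeff l * (?w * z) powi l = theta_coeff l * ?w powi l * z powi l" for l
      by (simp only: power_int_mult_distrib mult.assoc)
    then show ?thesis using has_sum_theta_coeff[OF nz] by (simp only:)
  qed
  have 2: "((\<lambda>l. (theta_coeff (l + 1) * inverse (of_real p)) * z powi l) has_sum ?f z) UNIV" if "norm z = 1" for z :: complex
  proof -
    have z: "z \<noteq> 0" using that by auto
    have "theta_half p (inverse (?w * z)) = (1 + inverse (?w * z) * p) * theta_half p (inverse z)"
    proof -
      have "?w * inverse (?w * z) = inverse z" using p by simp
      then show ?thesis using theta_half_functional[of "inverse (?w * z)"] by (simp only:)
    qed
    also have "1 + inverse (?w * z) * p = (1 + z * p) * inverse (p * z)"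
      using z p by (simp add: field_simps power2_eq_square)
    finally have f: "?f z = theta_half p z * theta_half p (inverse z) * inverse (p * z)"
      unfolding theta_half_functional[of z] by (simp only: mult_ac)
    have "bij_betw (\<lambda>l::int. l + 1) UNIV UNIV" by (rule bij_betwI[where g = "\<lambda>l. l - 1"]) auto
    from has_sum_reindex_bij_betw[OF this, of "\<lambda>l. theta_coeff l * z powi l"] has_sum_theta_coeff[OF z]
    have "((\<lambda>l. theta_coeff (l + 1) * z powi (l + 1)) has_sum theta_half p z * theta_half p (inverse z)) UNIV" by simp
    from has_sum_cmult_left[OF this, of "inverse (p * z)"]
    have "((\<lambda>l. theta_coeff (l + 1) * z powi (l + 1) * inverse (p * z)) has_sum ?f z) UNIV"
      unfolding f .
    moreover have "theta_coeff (l + 1) * z powi (l + 1) * inverse (p * z) = 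
        (theta_coeff (l + 1) * inverse (of_real p)) * z powi l" for l
      using z p by (simp add: power_int_add)
    ultimately show ?thesis by (simp only:)
  qed
  have "theta_coeff l * ?w powi l = fourier_coeff (\<lambda>x. ?f (cis (2 * pi * x))) l"
    by (rule fourier_coeff_Laurent(2)[where f = ?f]) (rule 1)
  also have "\<dots> = theta_coeff (l + 1) * inverse (of_real p)"
    by (rule fourier_coeff_Laurent(2)[where f = ?f, symmetric]) (rule 2)
  finally have eq: "theta_coeff l * ?w powi l = theta_coeff (l + 1) * inverse (of_real p)" .
  have "theta_coeff (l + 1) = (theta_coeff (l + 1) * inverse (of_real p)) * of_real p" using p by simp
  also have "\<dots> = ?w powi l * of_real p * theta_coeff l" unfolding eq[symmetric] by (simp only: mult_ac)
  also have "?w powi l * of_real p = of_real (p powi (2 * l + 1))"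
  proof -
    have "p powi (2 * l + 1) = p powi (2 * l) * p powi 1"
      using p by (intro power_int_add) simp
    then show ?thesis by (simp only: of_real_power_int of_real_mult power_int_mult power_int_numeral power_int_1_right)
  qed
  finally show ?thesis .
qed

lemma theta_coeff_eq_0: "theta_coeff l = of_real (p powi (l ^ 2)) * theta_coeff 0"
proof (induction l rule: int_induct[where k = 0])
  case base
  show ?case by simp
next
  case (step1 i)
  have "(i + 1) ^ 2 = (2 * i + 1) + i ^ 2" by (simp add: power2_eq_square algebra_simps)
  then have eq: "p powi ((i + 1) ^ 2) = p powi (2 * i + 1) * p powi (i ^ 2)"
    using p power_int_add[of p "2 * i + 1" "i ^ 2"] by simp
  show ?case unfolding theta_coeff_Suc[of i] step1(2) eq of_real_mult by (rule mult.assoc[symmetric])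
next
  case (step2 i)
  have "i ^ 2 = (2 * (i - 1) + 1) + (i - 1) ^ 2" by (simp add: power2_eq_square algebra_simps)
  then have eq: "p powi (i ^ 2) = p powi (2 * (i - 1) + 1) * p powi ((i - 1) ^ 2)"
    using p power_int_add[of p "2 * (i - 1) + 1" "(i - 1) ^ 2"] by simp
  have "of_real (p powi (2 * (i - 1) + 1)) * theta_coeff (i - 1) = theta_coeff i"
    using theta_coeff_Suc[of "i - 1"] by simp
  also have "\<dots> = of_real (p powi (2 * (i - 1) + 1)) * (of_real (p powi ((i - 1) ^ 2)) * theta_coeff 0)"
    unfolding step2(2) eq of_real_mult by (rule mult.assoc)
  finally show ?case using p by (subst (asm) mult_cancel_left) simp
qed

lemma theta_coeff_nat:
  "(\<lambda>k. of_real (euler_coeff p (k + l) * euler_coeff p k)) sums theta_coeff (int l)"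
proof -
  let ?a = "\<lambda>k. complex_of_real (euler_coeff p k)"
  have s: "(\<lambda>k. norm (?a (k + l) * ?a k)) summable_on UNIV"
  proof (rule norm_summable_imp_summable_on, rule summable_comparison_test')
    show "summable (\<lambda>k. norm (?a (k + l)) * (\<Sum>k. norm (?a k)))"
      using euler_coeff_summable[of 1] summable_ignore_initial_segment[of "\<lambda>k. norm (?a k)" l]
      by (intro summable_mult2) simp
    show "norm (norm (norm (?a (n + l) * ?a n))) \<le> norm (?a (n + l)) * (\<Sum>k. norm (?a k))" for n
      using sum_le_suminf[of "\<lambda>k. norm (?a k)" "{n}"] euler_coeff_summable[of 1]
      by (simp add: norm_mult mult_left_mono)
  qed
  then have "(\<lambda>k. ?a (k + l) * ?a k) summable_on UNIV" by (rule Infinite_Sum.abs_summable_summable)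
  then have *: "(\<lambda>k. ?a (k + l) * ?a k) sums (\<Sum>\<^sub>\<infinity>k. ?a (k + l) * ?a k)"
    by (intro has_sum_imp_sums has_sum_infsum)
  have bij: "bij_betw (\<lambda>k. (k + l, k)) UNIV {(i, j). int i - int j = int l}"
    by (rule bij_betwI[where g = snd]) auto
  have "theta_coeff (int l) = (\<Sum>\<^sub>\<infinity>k. ?a (k + l) * ?a k)"
    unfolding theta_coeff_def laurent_conv_def
    using infsum_reindex_bij_betw[OF bij, of "\<lambda>(i, j). ?a i * ?a j"] by simp
  then show ?thesis using * by simp
qed

text \<open>
  The recursion gives \<open>theta_coeff l = p^(l\<^sup>2) * theta_coeff 0\<close>, so \<open>theta_coeff 0\<close> is the limit of
  \<open>theta_coeff l / p^(l\<^sup>2)\<close> as \<open>l \<rightarrow> \<infinity>\<close>. In the convolution series for \<open>theta_coeff l\<close>, divided by \<open>p^(l\<^sup>2)\<close>,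
  the terms with \<open>k > 0\<close> tend to \<open>0\<close>, the term \<open>k = 0\<close> tends to the reciprocal of the Euler product, and
  Tannery's theorem allows the exchange of limits.
\<close>
lemma theta_coeff_0: "theta_coeff 0 = of_real (1 / euler_prod p)"
proof -
  let ?D = "\<lambda>n. \<Prod>i<n. 1 - p ^ (2 * i + 2)"
  (* the terms of the convolution series for index l, divided by p ^ l^2 *)
  define t where "t = (\<lambda>k l. euler_coeff p k * p ^ (k ^ 2 + 2 * k * l) / ?D (k + l))"
  have t: "(\<lambda>k. t k l) sums Re (theta_coeff 0)" for l
  proof -
    have "(\<lambda>k. euler_coeff p (k + l) * euler_coeff p k) sums Re (theta_coeff (int l))"
      using sums_Re[OF theta_coeff_nat[of l]] by simp
    then have "(\<lambda>k. euler_coeff p (k + l) * euler_coeff p k * inverse (p ^ (l ^ 2))) sums (Re (theta_coeff (int l)) * inverse (p ^ (l ^ 2)))"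
      by (rule sums_mult2)
    moreover have "Re (theta_coeff (int l)) * inverse (p ^ (l ^ 2)) = Re (theta_coeff 0)"
      unfolding theta_coeff_eq_0[of "int l"] using p by (simp add: power_int_def nat_power_eq)
    moreover have "euler_coeff p (k + l) * euler_coeff p k * inverse (p ^ (l ^ 2)) = t k l" for k
    proof -
      have "p ^ (k + l)\<^sup>2 = p ^ (k ^ 2 + 2 * k * l) * p ^ (l ^ 2)"
        unfolding power_add[symmetric]
        by (rule arg_cong[of _ _ "\<lambda>n. p ^ n"]) (simp add: power2_eq_square algebra_simps)
      then show ?thesis using p unfolding t_def euler_coeff_def[of p "k + l"] by simp
    qed
    ultimately show ?thesis by simp
  qed
  have "((\<lambda>l. suminf (\<lambda>k. t k l)) \<longlongrightarrow> suminf (\<lambda>k. if k = 0 then 1 / euler_prod p else 0)) sequentially"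
  proof (rule conjunct2[OF conjunct2[OF tannerys_theorem]])
    show "(\<lambda>l. t k l) \<longlonglongrightarrow> (if k = 0 then 1 / euler_prod p else 0)" for k
    proof -
      have D: "(\<lambda>l. ?D (k + l)) \<longlonglongrightarrow> euler_prod p"
        using LIMSEQ_ignore_initial_segment[OF euler_prod_LIMSEQ, of k] by (simp add: add.commute)
      show ?thesis
      proof (cases "k = 0")
        case True
        have "(\<lambda>l. 1 / ?D (k + l)) \<longlonglongrightarrow> 1 / euler_prod p"
          using euler_prod_pos by (intro tendsto_divide tendsto_const D) auto
        then show ?thesis using True unfolding t_def by (simp add: euler_coeff_def)
      next
        case False
        have "p ^ (2 * k) < 1" using p False by (intro power_less_one_iff[THEN iffD2]) auto
        then have "(\<lambda>l. (p ^ (2 * k)) ^ l) \<longlonglongrightarrow> 0" using p by (intro LIMSEQ_realpow_zero) auto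
        then have "(\<lambda>l. euler_coeff p k * (p ^ (k ^ 2) * (p ^ (2 * k)) ^ l) / ?D (k + l)) \<longlonglongrightarrow> euler_coeff p k * (p ^ (k ^ 2) * 0) / euler_prod p"
          using euler_prod_pos by (intro tendsto_divide tendsto_mult tendsto_const D) auto
        then show ?thesis using False unfolding t_def by (simp add: power_add power_mult)
      qed
    qed
    (* the partial products decrease to the Euler product, so its reciprocal is a uniform bound *)
    have b: "norm (t k l) \<le> euler_coeff p k * (1 / euler_prod p)" for k l
    proof -
      have "p ^ (k ^ 2 + 2 * k * l) / ?D (k + l) \<le> 1 / euler_prod p"
        using p euler_prod_pos euler_prod_le by (intro frac_le) (auto intro: power_le_one)
      moreover have "0 \<le> p ^ (k ^ 2 + 2 * k * l) / ?D (k + l)" 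
        using p partial_euler_prod_pos[of "k + l"] by simp
      ultimately have "norm (p ^ (k ^ 2 + 2 * k * l) / ?D (k + l)) \<le> 1 / euler_prod p" by (simp only: real_norm_def abs_of_nonneg)
      then have "norm (euler_coeff p k) * norm (p ^ (k ^ 2 + 2 * k * l) / ?D (k + l)) \<le> euler_coeff p k * (1 / euler_prod p)"
        using euler_coeff_nonneg[of k] by (intro mult_mono) auto
      then show ?thesis unfolding t_def by (simp only: times_divide_eq_right[symmetric] norm_mult)
    qed
    show "eventually (\<lambda>(k, l). norm (t k l) \<le> euler_coeff p k * (1 / euler_prod p)) (sequentially \<times>\<^sub>F sequentially)"
      using b by (intro always_eventually) auto
    show "summable (\<lambda>k. euler_coeff p k * (1 / euler_prod p))"
      using euler_coeff_summable[of 1] euler_coeff_nonneg by (intro summable_mult2) simp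
  qed simp
  moreover have "suminf (\<lambda>k. if k = 0 then 1 / euler_prod p else 0) = 1 / euler_prod p"
    using sums_unique[OF sums_single[of 0 "\<lambda>_. 1 / euler_prod p"]] by simp
  moreover have "suminf (\<lambda>k. t k l) = Re (theta_coeff 0)" for l using sums_unique[OF t[of l]] by simp
  ultimately have "Re (theta_coeff 0) = 1 / euler_prod p" by (simp add: LIMSEQ_const_iff)
  moreover have "Im (theta_coeff 0) = 0"
    using sums_unique2[OF sums_Im[OF theta_coeff_nat[of 0]], of 0] by simp
  ultimately show ?thesis by (simp add: complex_eq_iff)
qed

theorem Jacobi_triple_product:
  assumes "z \<noteq> 0"
  shows "((\<lambda>l. of_real (p powi (l ^ 2)) * z powi l) has_sum
           of_real (euler_prod p) * theta_half p z * theta_half p (inverse z)) UNIV"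
proof -
  have "((\<lambda>l. of_real (euler_prod p) * (theta_coeff l * z powi l)) has_sum
      of_real (euler_prod p) * (theta_half p z * theta_half p (inverse z))) UNIV"
    by (intro has_sum_cmult_right has_sum_theta_coeff assms)
  moreover have "of_real (euler_prod p) * (theta_coeff l * z powi l) = of_real (p powi (l ^ 2)) * z powi l" for l
    using euler_prod_pos unfolding theta_coeff_eq_0[of l] theta_coeff_0 by simp
  ultimately show ?thesis by (simp add: mult.assoc)
qed

end

section \<open>Convergence of Fourier series at a point\<close>

text \<open>
  Pythagoras for the projection onto one Fourier mode. Removing the modes one at a time from this
  identity gives Bessel's inequality by induction.
\<close>
lemma integral_norm_square_minus_mode:
  assumes f: "f \<in> borel_measurable period" "\<And>x. \<bar>x\<bar> \<le> 1/2 \<Longrightarrow> norm (f x) \<le> B"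
  shows "(\<integral>x. norm (f x - fourier_coeff f k * cis (2 * pi * of_int k * x)) ^ 2 \<partial>period) =
         (\<integral>x. norm (f x) ^ 2 \<partial>period) - norm (fourier_coeff f k) ^ 2"
proof -
  define c where "c = fourier_coeff f k"
  have eq: "norm (f x - c * cis (2 * pi * of_int k * x)) ^ 2 =
     norm (f x) ^ 2 - 2 * Re (cnj c * (f x * cis (- 2 * pi * of_int k * x))) + norm c ^ 2" for x
  proof -
    have "norm (a - b) ^ 2 = norm a ^ 2 - 2 * Re (cnj b * a) + norm b ^ 2" for a b :: complex
      unfolding cmod_power2 by (simp add: power2_eq_square algebra_simps)
    moreover have "cnj (c * cis (2 * pi * of_int k * x)) * f x = cnj c * (f x * cis (- 2 * pi * of_int k * x))"
      by (simp add: cis_cnj mult_ac)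
    ultimately show ?thesis by (simp only: norm_mult norm_cis mult_1_right)
  qed
  have i1: "integrable period (\<lambda>x. norm (f x) ^ 2)"
    by (rule integrable_period_bounded[where B = "B ^ 2"]) (use f in \<open>auto intro!: power_mono\<close>)
  have i2: "integrable period (\<lambda>x. f x * cis (- 2 * pi * of_int k * x))"
    using f by (rule integrable_period_mode)
  have i3: "integrable period (\<lambda>x. cnj c * (f x * cis (- 2 * pi * of_int k * x)))"
    using i2 by (rule integrable_mult_right)
  have "(\<integral>x. Re (cnj c * (f x * cis (- 2 * pi * of_int k * x))) \<partial>period) = Re (cnj c * c)"
    unfolding integral_Re[OF i3] by (simp only: integral_mult_right_zero c_def fourier_coeff_def)
  also have "\<dots> = norm c ^ 2" unfolding cmod_power2 by (simp add: power2_eq_square)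
  finally have r: "(\<integral>x. Re (cnj c * (f x * cis (- 2 * pi * of_int k * x))) \<partial>period) = norm c ^ 2" .
  have i4: "integrable period (\<lambda>x. norm c ^ 2)" by (rule integrable_period_bounded[where B = "norm c ^ 2"]) auto
  have "(\<integral>x. norm (f x - c * cis (2 * pi * of_int k * x)) ^ 2 \<partial>period) =
      (\<integral>x. norm (f x) ^ 2 \<partial>period) - 2 * (\<integral>x. Re (cnj c * (f x * cis (- 2 * pi * of_int k * x))) \<partial>period) + (\<integral>x. norm c ^ 2 \<partial>period)"
    unfolding eq Bochner_Integration.integral_add[OF Bochner_Integration.integrable_diff[OF i1 integrable_mult_right[OF integrable_Re[OF i3]]] i4]
      Bochner_Integration.integral_diff[OF i1 integrable_mult_right[OF integrable_Re[OF i3]]] integral_mult_right_zero ..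
  then show ?thesis unfolding r by (simp add: c_def)
qed

lemma fourier_coeff_minus_mode:
  assumes f: "f \<in> borel_measurable period" "\<And>x. \<bar>x\<bar> \<le> 1/2 \<Longrightarrow> norm (f x) \<le> B"
  shows "fourier_coeff (\<lambda>x. f x - c * cis (2 * pi * of_int k * x)) j = fourier_coeff f j - (if j = k then c else 0)"
proof -
  have i2: "integrable period (\<lambda>x. f x * cis (- 2 * pi * of_int j * x))"
    using f by (rule integrable_period_mode)
  have i3: "integrable period (\<lambda>x. c * cis (2 * pi * of_int (k - j) * x))"
    by (rule integrable_period_bounded[where B = "norm c"]) (auto simp: norm_mult)
  have "(f x - c * cis (2 * pi * of_int k * x)) * cis (- 2 * pi * of_int j * x) =
     f x * cis (- 2 * pi * of_int j * x) - c * cis (2 * pi * of_int (k - j) * x)" for x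
    unfolding left_diff_distrib mult.assoc cis_mult by (simp add: algebra_simps)
  then have "fourier_coeff (\<lambda>x. f x - c * cis (2 * pi * of_int k * x)) j =
      fourier_coeff f j - (\<integral>x. c * cis (2 * pi * of_int (k - j) * x) \<partial>period)"
    unfolding fourier_coeff_def using i2 i3 by simp
  also have "(\<integral>x. c * cis (2 * pi * of_int (k - j) * x) \<partial>period) = (if j = k then c else 0)"
    by (simp only: integral_mult_right_zero integral_cis_period) auto
  finally show ?thesis .
qed

lemma Bessel_inequality:
  assumes "finite K" "f \<in> borel_measurable period" "\<And>x. \<bar>x\<bar> \<le> 1/2 \<Longrightarrow> norm (f x) \<le> B"
  shows "(\<Sum>k\<in>K. norm (fourier_coeff f k) ^ 2) \<le> (\<integral>x. norm (f x) ^ 2 \<partial>period)"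
  using assms
proof (induction K arbitrary: f B rule: finite_induct)
  case (insert k K)
  define g where "g = (\<lambda>x. f x - fourier_coeff f k * cis (2 * pi * of_int k * x))"
  have "(\<Sum>j\<in>K. norm (fourier_coeff g j) ^ 2) \<le> (\<integral>x. norm (g x) ^ 2 \<partial>period)"
  proof (rule insert.IH)
    show "g \<in> borel_measurable period" unfolding g_def using insert.prems by measurable
    show "norm (g x) \<le> B + norm (fourier_coeff f k)" if "\<bar>x\<bar> \<le> 1/2" for x
      unfolding g_def using insert.prems(2)[OF that]
      by (intro norm_triangle_le_diff) (simp add: norm_mult)
  qed
  moreover have "(\<Sum>j\<in>K. norm (fourier_coeff g j) ^ 2) = (\<Sum>j\<in>K. norm (fourier_coeff f j) ^ 2)"
    unfolding g_def using insert.hyps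
    by (intro sum.cong) (auto simp: fourier_coeff_minus_mode[OF insert.prems, simplified])
  ultimately show ?case
    using integral_norm_square_minus_mode[OF insert.prems, of k] insert.hyps by (simp add: g_def)
qed simp

lemma Riemann_Lebesgue:
  assumes "f \<in> borel_measurable period" "\<And>x. \<bar>x\<bar> \<le> 1/2 \<Longrightarrow> norm (f x) \<le> B" and "inj (h :: nat \<Rightarrow> int)"
  shows "(\<lambda>n. fourier_coeff f (h n)) \<longlonglongrightarrow> 0"
proof -
  have "summable (\<lambda>n. norm (fourier_coeff f (h n)) ^ 2)"
  proof (rule bounded_imp_summable)
    show "(\<Sum>k\<le>n. norm (fourier_coeff f (h k)) ^ 2) \<le> (\<integral>x. norm (f x) ^ 2 \<partial>period)" for n
      using Bessel_inequality[of "h ` {..n}", OF _ assms(1,2)] assms(3)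
      by (simp add: sum.reindex inj_on_subset)
  qed simp
  then have "(\<lambda>n. norm (fourier_coeff f (h n)) ^ 2) \<longlonglongrightarrow> 0" by (rule summable_LIMSEQ_zero)
  then show ?thesis by (simp add: tendsto_norm_zero_iff)
qed

lemma norm_cis_minus_1_ge:
  assumes "\<bar>x\<bar> \<le> 1/2"
  shows "norm (cis (2 * pi * x) - 1) \<ge> \<bar>x\<bar>"
proof -
  have "cis (2 * pi * x) - 1 = cis (pi * x) * (cis (pi * x) - cis (- (pi * x)))"
    unfolding right_diff_distrib cis_mult by (simp add: mult.assoc)
  also have "norm \<dots> = 2 * \<bar>sin (pi * x)\<bar>"
  proof -
    have "cis (pi * x) - cis (- (pi * x)) = of_real (2 * sin (pi * x)) * \<i>" by (simp add: complex_eq_iff)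
    then show ?thesis by (simp add: norm_mult abs_mult)
  qed
  finally have *: "norm (cis (2 * pi * x) - 1) = 2 * \<bar>sin (pi * x)\<bar>" .
  have "\<bar>sin (pi * x) - pi * x\<bar> \<le> \<bar>pi * x\<bar> ^ 3 / 6"
    using Maclaurin_sin_bound[of "pi * x" 3] by (simp add: lessThan_nat_numeral sin_coeff_def fact_numeral field_simps)
  also have "\<dots> = \<bar>pi * x\<bar> * (\<bar>pi * x\<bar> ^ 2 / 6)" by (simp add: power3_eq_cube power2_eq_square)
  also have "\<dots> \<le> \<bar>pi * x\<bar> * (1 / 2)"
  proof (rule mult_left_mono)
    (* 1.6 ^ 2 / 6 < 1 / 2, so the cubic Taylor error is at most half of the linear term *)
    have "\<bar>pi * x\<bar> \<le> 3.2 * (1/2)" using assms pi_approx unfolding abs_mult by (intro mult_mono) auto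
    then have "\<bar>pi * x\<bar> ^ 2 \<le> (3.2 * (1/2)) ^ 2" by (intro power_mono) auto
    also have "\<dots> \<le> (3::real)" by (simp add: power2_eq_square)
    finally show "\<bar>pi * x\<bar> ^ 2 / 6 \<le> 1 / 2" by simp
  qed simp
  finally have "\<bar>sin (pi * x)\<bar> \<ge> \<bar>pi * x\<bar> / 2" by linarith
  moreover have "\<bar>pi * x\<bar> \<ge> \<bar>x\<bar>" using mult_right_mono[of 1 pi "\<bar>x\<bar>"] pi_gt3 by (simp add: abs_mult)
  ultimately show ?thesis unfolding * by linarith
qed

lemma sum_telescope_int: "(\<Sum>k\<in>{- int n..int n}. c (k - 1) - c k) = c (- int n - 1) - (c (int n) :: 'a::ab_group_add)"
proof (induction n)
  case (Suc n)
  have "{- int (Suc n)..int (Suc n)} = insert (- int (Suc n)) (insert (int (Suc n)) {- int n..int n})" by auto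
  moreover have "- int (Suc n) - 1 = - int n - 1 - 1" "int (Suc n) - 1 = int n" "- int (Suc n) = - int n - 1" by auto
  moreover have "- int n - 1 \<notin> insert (int (Suc n)) {- int n..int n}" "int (Suc n) \<notin> {- int n..int n}" by auto
  ultimately show ?case using Suc by (simp only: sum.insert finite_insert finite_atLeastAtMost_int if_False) simp
qed simp

text \<open>
  Chernoff's argument: the quotient \<open>g x = (f x - f 0) / (cis (2 * pi * x) - 1)\<close> is bounded because \<open>f\<close> is
  Lipschitz at \<open>0\<close>, and multiplying out shows that the \<open>k\<close>th coefficient of \<open>f - f 0\<close> is the difference
  of the coefficients of \<open>g\<close> at \<open>k - 1\<close> and \<open>k\<close>. The symmetric partial sums telescope, and the two boundary
  terms vanish by the Riemann-Lebesgue lemma.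
\<close>
theorem fourier_series_LIMSEQ_0:
  assumes f: "f \<in> borel_measurable period"
    and L: "\<And>x. \<bar>x\<bar> \<le> 1/2 \<Longrightarrow> norm (f x - f 0) \<le> L * \<bar>x\<bar>"
  shows "(\<lambda>n. \<Sum>k\<in>{- int n..int n}. fourier_coeff f k) \<longlonglongrightarrow> f 0"
proof -
  define g where "g = (\<lambda>x. (f x - f 0) / (cis (2 * pi * x) - 1))"
  have gB: "norm (g x) \<le> L" if "\<bar>x\<bar> \<le> 1/2" for x
  proof (cases "x = 0")
    case True
    have "0 \<le> L * \<bar>1/2\<bar>" by (rule order_trans[OF norm_ge_zero L]) simp
    then show ?thesis using True by (simp add: g_def)
  next
    case False
    have pos: "norm (cis (2 * pi * x) - 1) > 0" using norm_cis_minus_1_ge[OF that] False by linarith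
    have "0 \<le> L * \<bar>x\<bar>" using L[OF that] norm_ge_zero order_trans by blast
    then have "L \<ge> 0" using False by (simp add: zero_le_mult_iff)
    then have "norm (f x - f 0) \<le> L * norm (cis (2 * pi * x) - 1)"
      using L[OF that] norm_cis_minus_1_ge[OF that] mult_left_mono order_trans by blast
    then show ?thesis using pos by (simp add: g_def norm_divide divide_le_eq)
  qed
  have gm: "g \<in> borel_measurable period" unfolding g_def using f by measurable
  have fB: "norm (f x) \<le> norm (f 0) + L * (1/2)" if "\<bar>x\<bar> \<le> 1/2" for x
  proof -
    have "0 \<le> L" using gB[of 0] norm_ge_zero order_trans by (metis abs_zero zero_le_divide_1_iff zero_le_numeral)
    then have "L * \<bar>x\<bar> \<le> L * (1/2)" using that by (intro mult_left_mono) auto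
    then show ?thesis using L[OF that] norm_triangle_sub[of "f x" "f 0"] by linarith
  qed
  have fg: "f x - f 0 = g x * cis (2 * pi * x) - g x" if "x \<in> space period" for x
  proof (cases "x = 0")
    case False
    have "\<bar>x\<bar> \<le> 1/2" using that by auto
    then have "cis (2 * pi * x) - 1 \<noteq> 0" using norm_cis_minus_1_ge[of x] False by auto
    then have "g x * (cis (2 * pi * x) - 1) = f x - f 0" unfolding g_def by simp
    then show ?thesis by (simp add: algebra_simps)
  qed (simp add: g_def)
  have coeff: "fourier_coeff f k - (if k = 0 then f 0 else 0) = fourier_coeff g (k - 1) - fourier_coeff g k" for k
  proof -
    have "fourier_coeff f k - (if k = 0 then f 0 else 0) = fourier_coeff (\<lambda>x. f x - f 0) k"
      using fourier_coeff_minus_mode[OF f fB, of "f 0" 0 k] by simp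
    also have "\<dots> = (\<integral>x. g x * cis (- 2 * pi * of_int (k - 1) * x) - g x * cis (- 2 * pi * of_int k * x) \<partial>period)"
      unfolding fourier_coeff_def
    proof (rule Bochner_Integration.integral_cong[OF refl])
      fix x assume "x \<in> space period"
      then show "(f x - f 0) * cis (- 2 * pi * of_int k * x) =
          g x * cis (- 2 * pi * of_int (k - 1) * x) - g x * cis (- 2 * pi * of_int k * x)"
        unfolding fg[OF \<open>x \<in> space period\<close>] left_diff_distrib mult.assoc cis_mult by (simp add: algebra_simps)
    qed
    also have "\<dots> = fourier_coeff g (k - 1) - fourier_coeff g k"
    proof -
      have "integrable period (\<lambda>x. g x * cis (- 2 * pi * of_int k * x))" for k
        using gm gB by (rule integrable_period_mode)
      from Bochner_Integration.integral_diff[OF this[of "k - 1"] this[of k]]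
      show ?thesis unfolding fourier_coeff_def .
    qed
    finally show ?thesis .
  qed
  have "(\<Sum>k\<in>{- int n..int n}. fourier_coeff f k) - f 0 = fourier_coeff g (- int n - 1) - fourier_coeff g (int n)" for n
  proof -
    have "(\<Sum>k\<in>{- int n..int n}. fourier_coeff f k) - f 0 =
        (\<Sum>k\<in>{- int n..int n}. fourier_coeff f k - (if k = 0 then f 0 else 0))"
      by (simp add: sum_subtractf sum.delta)
    then show ?thesis unfolding coeff sum_telescope_int .
  qed
  moreover have "(\<lambda>n. fourier_coeff g (- int n - 1) - fourier_coeff g (int n)) \<longlonglongrightarrow> 0 - 0"
    by (intro tendsto_diff Riemann_Lebesgue[OF gm gB]) (auto intro: injI)
  ultimately have "(\<lambda>n. (\<Sum>k\<in>{- int n..int n}. fourier_coeff f k) - f 0) \<longlonglongrightarrow> 0" by simp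
  then show ?thesis by (simp add: LIM_zero_cancel)
qed

section \<open>Inversion of the theta series\<close>

lemma vector_derivative_bound_segment:
  fixes f :: "real \<Rightarrow> complex"
  assumes d: "\<And>y. y \<in> closed_segment a b \<Longrightarrow> (f has_vector_derivative f' y) (at y within closed_segment a b)"
    and B: "\<And>y. y \<in> closed_segment a b \<Longrightarrow> norm (f' y) \<le> B"
  shows "norm (f b - f a) \<le> B * norm (b - a)"
proof (rule differentiable_bound[OF convex_closed_segment[of a b], where f' = "\<lambda>y h. h *\<^sub>R f' y"])
  show "(f has_derivative (\<lambda>h. h *\<^sub>R f' y)) (at y within closed_segment a b)" if "y \<in> closed_segment a b" for y
    using d[OF that] by (simp add: has_vector_derivative_def)
  show "onorm (\<lambda>h. h *\<^sub>R f' y) \<le> B" if "y \<in> closed_segment a b" for y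
    using B[OF that] by (intro onorm_le) (simp add: mult.commute[of B] mult_left_mono)
qed auto

text \<open>
  The real part of \<open>w\<close> is absorbed by a translation, the imaginary part by the characteristic function
  of the normal distribution.
\<close>
lemma has_bochner_integral_complex_Gaussian:
  fixes w :: complex
  assumes t: "t > 0"
  shows "has_bochner_integral lborel (\<lambda>x. exp (- pi * (of_real x + w) ^ 2 / t)) (of_real (sqrt t))"
proof -
  define a b where "a = Re w" and "b = Im w"
  define c where "c = sqrt (t / (2 * pi))"
  define s where "s = - 2 * pi * b * c / t"
  have c: "c > 0" "c ^ 2 = t / (2 * pi)" using t by (auto simp: c_def)
  let ?f = "\<lambda>x::real. exp (- pi * (of_real x + w) ^ 2 / t)"
  let ?C = "sqrt (2 * pi) * exp (pi * b ^ 2 / t)"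
  have w: "w = of_real a + \<i> * of_real b" by (simp add: a_def b_def complex_eq_iff)
  have eq: "?f (- a + c * y) = of_real ?C * (std_normal_density y *\<^sub>R iexp (s * y))" for y
  proof -
    have "- pi * (of_real (- a + c * y) + w) ^ 2 / t =
       of_real (pi * b ^ 2 / t) + of_real (- (pi * c ^ 2 / t) * y ^ 2) + \<i> * of_real (s * y)"
      unfolding w s_def using t
      by (simp add: complex_eq_iff power2_eq_square field_simps)
    also have "- (pi * c ^ 2 / t) * y ^ 2 = - (y ^ 2) / 2" unfolding c(2) using t by simp
    finally have "?f (- a + c * y) = of_real (exp (pi * b ^ 2 / t)) * of_real (exp (- (y ^ 2) / 2)) * iexp (s * y)"
      by (simp only: exp_add exp_of_real)
    then show ?thesis by (simp add: std_normal_density_def scaleR_conv_of_real)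
  qed
  have i: "integrable lborel (\<lambda>y. std_normal_density y *\<^sub>R iexp (s * y))"
  proof (rule Bochner_Integration.integrable_bound)
    show "integrable lborel std_normal_density" by simp
    show "(\<lambda>y. std_normal_density y *\<^sub>R iexp (s * y)) \<in> borel_measurable lborel" by measurable
  qed simp
  have "(\<integral>y. std_normal_density y *\<^sub>R iexp (s * y) \<partial>lborel) = char std_normal_distribution s"
    unfolding char_def by (subst integral_density) auto
  also have "\<dots> = of_real (exp (- (s ^ 2) / 2))" by (simp add: char_std_normal_distribution)
  finally have v: "(\<integral>y. std_normal_density y *\<^sub>R iexp (s * y) \<partial>lborel) = of_real (exp (- (s ^ 2) / 2))" .
  have "integrable lborel (\<lambda>y. ?f (- a + c * y))" unfolding eq by (intro integrable_mult_right i)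
  then have int: "integrable lborel ?f" using lborel_integrable_real_affine_iff[of c ?f "- a"] c by simp
  have "(\<integral>x. ?f x \<partial>lborel) = \<bar>c\<bar> *\<^sub>R (\<integral>y. ?f (- a + c * y) \<partial>lborel)"
    by (rule lborel_integral_real_affine) (use c in auto)
  also have "(\<integral>y. ?f (- a + c * y) \<partial>lborel) = of_real ?C * of_real (exp (- (s ^ 2) / 2))"
    unfolding eq by (simp only: integral_mult_right_zero v)
  also have "\<bar>c\<bar> *\<^sub>R (of_real ?C * of_real (exp (- (s ^ 2) / 2))) = of_real (c * sqrt (2 * pi) * exp (pi * b ^ 2 / t - s ^ 2 / 2))"
  proof -
    have "exp (pi * b ^ 2 / t - s ^ 2 / 2) = exp (pi * b ^ 2 / t) * exp (- (s ^ 2) / 2)" by (simp flip: exp_add)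
    then show ?thesis using c(1) by (simp only: scaleR_conv_of_real of_real_mult abs_of_pos mult.assoc)
  qed
  also have "s ^ 2 / 2 = pi * b ^ 2 / t"
  proof -
    have "s ^ 2 = 4 * pi ^ 2 * b ^ 2 * c ^ 2 / t ^ 2" by (simp add: s_def power_divide power_mult_distrib)
    then show ?thesis unfolding c(2) using t by (simp add: field_simps power2_eq_square)
  qed
  also have "c * sqrt (2 * pi) = sqrt t" using t by (simp add: c_def real_sqrt_mult[symmetric] del: real_sqrt_mult)
  finally show ?thesis using int by (simp add: has_bochner_integral_iff)
qed

context
  fixes t :: real and z :: complex
  assumes t: "t > 0"
begin

definition gauss :: "real \<Rightarrow> complex" where
  "gauss x = exp (- pi * (of_real x + z) ^ 2 / t)"

text \<open>
  A constant for which \<open>gauss_maj * exp (- \<bar>j\<bar>)\<close> bounds both the Gaussian and its derivative on the \<open>j\<close>th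
  translate of the period.
\<close>
definition gauss_maj :: real where
  "gauss_maj = exp (pi * Im z ^ 2 / t + t / pi) * (1 + 2 * pi / t) * (1 + \<bar>Im z\<bar>) * exp (\<bar>Re z\<bar> + 1 / 2)"

text \<open>
  Completing the square in \<open>(pi / t) * (u - t / pi)\<^sup>2 \<ge> 0\<close> trades the Gaussian decay for exponential decay,
  which is easier to sum over the integers.
\<close>
lemma norm_gauss_le: "norm (gauss x) \<le> exp (pi * Im z ^ 2 / t + t / pi) * exp (- 2 * \<bar>x + Re z\<bar>)"
proof -
  let ?u = "\<bar>x + Re z\<bar>"
  have "norm (gauss x) = exp (pi * Im z ^ 2 / t - pi / t * ?u ^ 2)"
    unfolding gauss_def norm_exp_eq_Re using t by (simp add: power2_eq_square field_simps)
  moreover have "0 \<le> pi / t * (?u - t / pi) ^ 2" using t by simp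
  moreover have "pi / t * (?u - t / pi) ^ 2 = pi / t * ?u ^ 2 - 2 * ?u + t / pi"
    using t by (simp add: power2_eq_square field_simps)
  ultimately show ?thesis by (simp flip: exp_add)
qed

lemma gauss_deriv: "(gauss has_vector_derivative (- 2 * pi * (of_real x + z) / t * gauss x)) (at x within S)"
proof -
  have "((\<lambda>y. exp (- pi * (y + z) ^ 2 / t)) has_field_derivative (- 2 * pi * (of_real x + z) / t * gauss x)) (at (of_real x))"
    unfolding gauss_def by (rule derivative_eq_intros refl | use t in \<open>simp add: power2_eq_square\<close>)+
  from has_vector_derivative_real_field[OF this] show ?thesis unfolding gauss_def .
qed

lemma gauss_bounds:
  assumes "\<bar>x\<bar> \<le> 1/2"
  shows "norm (gauss (x - of_int j)) \<le> gauss_maj * exp (- \<bar>of_int j\<bar>)"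
    and "norm (- 2 * pi * (of_real (x - of_int j) + z) / t * gauss (x - of_int j)) \<le> gauss_maj * exp (- \<bar>of_int j\<bar>)"
proof -
  define y where "y = x - of_int j"
  let ?u = "\<bar>y + Re z\<bar>" and ?E = "exp (pi * Im z ^ 2 / t + t / pi)"
  have 1: "norm (gauss y) \<le> ?E * (exp (- ?u) * exp (- ?u))"
    using norm_gauss_le[of y] by (simp flip: exp_add)
  have "of_real y + z = Complex (y + Re z) (Im z)" by (simp add: complex_eq_iff)
  then have "norm (of_real y + z) \<le> ?u + \<bar>Im z\<bar>" using cmod_le[of "of_real y + z"] by simp
  also have "\<dots> \<le> exp ?u * (1 + \<bar>Im z\<bar>)"
  proof -
    have "1 + ?u \<le> exp ?u" "0 \<le> ?u" by (rule exp_ge_add_one_self, simp)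
    then have "?u \<le> exp ?u" "1 \<le> exp ?u" by linarith+
    then have "?u + 1 * \<bar>Im z\<bar> \<le> exp ?u + exp ?u * \<bar>Im z\<bar>" by (intro add_mono mult_right_mono) auto
    then show ?thesis by (simp add: algebra_simps)
  qed
  finally have 2: "norm (of_real y + z) \<le> exp ?u * (1 + \<bar>Im z\<bar>)" .
  have 3: "exp (- ?u) \<le> exp (\<bar>Re z\<bar> + 1 / 2) * exp (- \<bar>of_int j\<bar>)"
    using assms unfolding y_def by (simp flip: exp_add)
  have "norm (gauss y) \<le> ?E * (exp (- ?u) * 1)"
    by (rule order_trans[OF 1]) (intro mult_left_mono, auto)
  also have "\<dots> \<le> ?E * (1 + 2 * pi / t) * (1 + \<bar>Im z\<bar>) * exp (- ?u)"
  proof -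
    have "1 * 1 \<le> (1 + 2 * pi / t) * (1 + \<bar>Im z\<bar>)" using t by (intro mult_mono) auto
    then have "?E * exp (- ?u) * 1 \<le> ?E * exp (- ?u) * ((1 + 2 * pi / t) * (1 + \<bar>Im z\<bar>))" by (intro mult_left_mono) auto
    then show ?thesis by (simp only: mult_ac)
  qed
  also have *: "?E * (1 + 2 * pi / t) * (1 + \<bar>Im z\<bar>) * exp (- ?u) \<le> gauss_maj * exp (- \<bar>of_int j\<bar>)"
    unfolding gauss_maj_def mult.assoc using t 3 by (intro mult_left_mono) auto
  finally show "norm (gauss (x - of_int j)) \<le> gauss_maj * exp (- \<bar>of_int j\<bar>)" unfolding y_def .
  have "norm (- 2 * pi * (of_real y + z) / t * gauss y) = 2 * pi / t * (norm (of_real y + z) * norm (gauss y))"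
    using t by (simp add: norm_mult norm_divide)
  also have "\<dots> \<le> 2 * pi / t * ((exp ?u * (1 + \<bar>Im z\<bar>)) * (?E * (exp (- ?u) * exp (- ?u))))"
    using t by (intro mult_left_mono mult_mono 1 2) auto
  also have "\<dots> = ?E * (2 * pi / t) * (1 + \<bar>Im z\<bar>) * exp (- ?u)"
  proof -
    have "exp ?u * exp (- ?u) = 1" by (simp flip: exp_add)
    have "2 * pi / t * ((exp ?u * (1 + \<bar>Im z\<bar>)) * (?E * (exp (- ?u) * exp (- ?u)))) =
       (exp ?u * exp (- ?u)) * (?E * (2 * pi / t) * (1 + \<bar>Im z\<bar>) * exp (- ?u))" by (simp only: mult_ac)
    also have "\<dots> = ?E * (2 * pi / t) * (1 + \<bar>Im z\<bar>) * exp (- ?u)"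
      using \<open>exp ?u * exp (- ?u) = 1\<close> by (simp only: mult_1_left)
    finally show ?thesis .
  qed
  also have "\<dots> \<le> ?E * (1 + 2 * pi / t) * (1 + \<bar>Im z\<bar>) * exp (- ?u)"
    by (intro mult_right_mono mult_left_mono) auto
  also note *
  finally show "norm (- 2 * pi * (of_real (x - of_int j) + z) / t * gauss (x - of_int j)) \<le> gauss_maj * exp (- \<bar>of_int j\<bar>)"
    unfolding y_def .
qed

lemma gauss_maj_summable: "(\<lambda>j::int. gauss_maj * exp (- \<bar>of_int j\<bar>)) summable_on UNIV"
  using summable_exp_abs_int[of 1] by (intro summable_on_cmult_right) simp

definition gauss_sum :: "real \<Rightarrow> complex" where
  "gauss_sum x = (\<Sum>\<^sub>\<infinity>j::int. gauss (x - of_int j))"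

lemma has_sum_gauss_sum:
  assumes "\<bar>x\<bar> \<le> 1/2"
  shows "((\<lambda>j. gauss (x - of_int j)) has_sum gauss_sum x) UNIV"
proof -
  have "(\<lambda>j::int. norm (gauss (x - of_int j))) summable_on UNIV"
    by (rule summable_on_comparison_test[OF gauss_maj_summable]) (use gauss_bounds(1)[OF assms] in auto)
  then show ?thesis unfolding gauss_sum_def
    by (rule has_sum_infsum[OF Infinite_Sum.abs_summable_summable])
qed

lemma gauss_measurable: "(\<lambda>x. gauss (x - a)) \<in> borel_measurable borel"
  unfolding gauss_def by (intro borel_measurable_continuous_onI continuous_intros) (use t in auto)

text \<open>
  The mean value inequality, applied termwise with the common majorant of the derivatives.
\<close>
lemma gauss_sum_Lipschitz:
  assumes x: "\<bar>x\<bar> \<le> 1/2"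
  shows "norm (gauss_sum x - gauss_sum 0) \<le> (\<Sum>\<^sub>\<infinity>j::int. gauss_maj * exp (- \<bar>of_int j\<bar>)) * \<bar>x\<bar>"
proof -
  have "((\<lambda>j. gauss (x - of_int j) - gauss (0 - of_int j)) has_sum gauss_sum x - gauss_sum 0) UNIV"
    using has_sum_add[OF has_sum_gauss_sum[OF x] has_sum_uminusI[OF has_sum_gauss_sum[of 0]]] by simp
  moreover have "((\<lambda>j. gauss_maj * exp (- \<bar>of_int j\<bar>) * \<bar>x\<bar>) has_sum (\<Sum>\<^sub>\<infinity>j::int. gauss_maj * exp (- \<bar>of_int j\<bar>)) * \<bar>x\<bar>) UNIV"
    by (intro has_sum_cmult_left has_sum_infsum gauss_maj_summable)
  moreover have "norm (gauss (x - of_int j) - gauss (0 - of_int j)) \<le> gauss_maj * exp (- \<bar>of_int j\<bar>) * \<bar>x\<bar>" for j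
  proof -
    have "norm (gauss (x - of_int j) - gauss (0 - of_int j)) \<le> gauss_maj * exp (- \<bar>of_int j\<bar>) * norm (x - 0)"
    proof (rule vector_derivative_bound_segment)
      fix y assume "y \<in> closed_segment 0 x"
      then have y: "\<bar>y\<bar> \<le> 1/2" using x by (auto simp: closed_segment_eq_real_ivl split: if_splits)
      show "norm (- 2 * pi * (of_real (y - of_int j) + z) / t * gauss (y - of_int j)) \<le> gauss_maj * exp (- \<bar>of_int j\<bar>)"
        by (rule gauss_bounds(2)[OF y])
      have "((\<lambda>y. y - of_int j) has_vector_derivative 1) (at y within closed_segment 0 x)"
        by (auto intro!: derivative_eq_intros)
      from vector_diff_chain_within[OF this gauss_deriv]
      show "((\<lambda>y. gauss (y - of_int j)) has_vector_derivative (- 2 * pi * (of_real (y - of_int j) + z) / t * gauss (y - of_int j))) (at y within closed_segment 0 x)"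
        by (simp add: o_def)
    qed
    then show ?thesis by simp
  qed
  ultimately show ?thesis by (rule norm_infsum_le)
qed

text \<open>
  Completing the square in the exponent moves the Fourier mode into the centre of the Gaussian.
\<close>
lemma gauss_mode_integral:
  "has_bochner_integral lborel (\<lambda>x. gauss x * cis (- 2 * pi * of_int k * x))
     (of_real (sqrt t * exp (- pi * t) powi (k ^ 2)) * exp (2 * pi * \<i> * z) powi k)"
proof -
  let ?w = "z + \<i> * of_int k * t" and ?K = "exp (2 * pi * \<i> * of_int k * z - pi * of_int k ^ 2 * t)"
  have eq: "gauss x * cis (- 2 * pi * of_int k * x) = ?K * exp (- pi * (of_real x + ?w) ^ 2 / t)" for x
    unfolding gauss_def cis_conv_exp exp_add[symmetric]
    by (rule arg_cong[of _ _ exp]) (use t in \<open>simp add: field_simps power2_eq_square\<close>)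
  have eq2: "?K * of_real (sqrt t) =
     of_real (sqrt t * exp (- pi * t) powi (k ^ 2)) * exp (2 * pi * \<i> * z) powi k"
  proof -
    have "?K = exp (of_int k * (2 * pi * \<i> * z)) * of_real (exp (of_int (k ^ 2) * (- pi * t)))"
      unfolding exp_of_real[symmetric] exp_add[symmetric] by (rule arg_cong[of _ _ exp]) (simp add: algebra_simps)
    then show ?thesis by (simp only: exp_power_int of_real_mult mult_ac)
  qed
  show ?thesis unfolding eq eq2[symmetric]
    by (intro has_bochner_integral_mult_right has_bochner_integral_complex_Gaussian t)
qed

text \<open>
  Unfolding: the integral over one period of the sum of all translates is the integral over the line.
\<close>
lemma fourier_coeff_gauss_sum:
  "gauss_sum \<in> borel_measurable period" (is ?A)
  "fourier_coeff gauss_sum k = of_real (sqrt t * exp (- pi * t) powi (k ^ 2)) * exp (2 * pi * \<i> * z) powi k" (is ?B)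
proof -
  let ?H = "\<lambda>x. gauss x * cis (- 2 * pi * of_int k * x)"
  have cis_shift: "cis (- 2 * pi * of_int k * (x - of_int j)) = cis (- 2 * pi * of_int k * x)" for x and j :: int
  proof -
    have "cis (2 * pi * of_int (k * j)) = 1" by (rule cis_multiple_2pi) simp
    moreover have "- 2 * pi * of_int k * (x - of_int j) = - 2 * pi * of_int k * x + 2 * pi * of_int (k * j)" by (simp add: algebra_simps)
    ultimately show ?thesis by (metis cis_mult mult.right_neutral)
  qed
  have mg: "(\<lambda>x. gauss (x - of_int j)) \<in> borel_measurable period" for j
    by (intro borel_measurable_period gauss_measurable)
  have bd: "norm (gauss (x - of_int j)) \<le> gauss_maj * exp (- \<bar>of_int j\<bar>)" if "x \<in> space period" for x j
    using gauss_bounds(1)[of x j] that by auto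
  have intj: "integrable period (\<lambda>x. gauss (x - of_int j) * cis (- 2 * pi * of_int m * x))" for j m
    by (rule integrable_period_mode[OF mg]) (rule gauss_bounds(1))
  have nle: "(\<integral>x. norm (gauss (x - of_int j) * cis (- 2 * pi * of_int m * x)) \<partial>period) \<le> gauss_maj * exp (- \<bar>of_int j\<bar>)" for j m
  proof -
    have "(\<integral>x. norm (gauss (x - of_int j) * cis (- 2 * pi * of_int m * x)) \<partial>period) \<le> (\<integral>x. gauss_maj * exp (- \<bar>of_int j\<bar>) \<partial>period)"
    proof (rule integral_mono)
      show "integrable period (\<lambda>x. norm (gauss (x - of_int j) * cis (- 2 * pi * of_int m * x)))" by (rule integrable_norm[OF intj])
      show "integrable period (\<lambda>x. gauss_maj * exp (- \<bar>of_int j\<bar>))" by (rule integrable_period_bounded[where B = "\<bar>gauss_maj * exp (- \<bar>of_int j\<bar>)\<bar>"]) auto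
    qed (use bd in \<open>simp add: norm_mult\<close>)
    then show ?thesis by simp
  qed
  have summ: "(\<lambda>j. \<integral>x. norm (gauss (x - of_int j) * cis (- 2 * pi * of_int m * x)) \<partial>period) summable_on UNIV" for m
    by (rule summable_on_comparison_test[OF gauss_maj_summable nle]) simp
  have ptw: "((\<lambda>j. gauss (x - of_int j) * cis (- 2 * pi * of_int m * x)) has_sum gauss_sum x * cis (- 2 * pi * of_int m * x)) UNIV" if "x \<in> space period" for x m
    by (intro has_sum_cmult_left has_sum_gauss_sum) (use that in auto)
  show ?A using has_sum_integral(1)[OF intj summ ptw, of 0] by simp
  have 1: "((\<lambda>j. \<integral>x. gauss (x - of_int j) * cis (- 2 * pi * of_int k * x) \<partial>period) has_sum fourier_coeff gauss_sum k) UNIV"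
    unfolding fourier_coeff_def by (rule has_sum_integral(2)[OF intj summ ptw])
  let ?I = "\<lambda>j x. indicator {- (1/2)..<1/2} (x + of_int j) *\<^sub>R ?H x"
  have shift: "(\<integral>x. F (x - of_int j) \<partial>period) = (\<integral>x. indicator {- (1/2)..<1/2} (x + of_int j) *\<^sub>R F x \<partial>lborel)"
    for F :: "real \<Rightarrow> 'b::{banach, second_countable_topology}" and j
  proof -
    have "(\<integral>x. F (x - of_int j) \<partial>period) = (\<integral>x. indicator {- (1/2)..<1/2} x *\<^sub>R F (x - of_int j) \<partial>lborel)"
      unfolding period_def by (subst integral_restrict_space) auto
    also have "\<dots> = (\<integral>x. indicator {- (1/2)..<1/2} (x + of_int j) *\<^sub>R F x \<partial>lborel)"
      by (subst lborel_integral_real_affine[where c = 1 and t = "of_int j"]) (auto simp: add.commute)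
    finally show ?thesis .
  qed
  have tr: "(\<integral>x. gauss (x - of_int j) * cis (- 2 * pi * of_int k * x) \<partial>period) = (\<integral>x. ?I j x \<partial>lborel)" for j
    using shift[of ?H j] by (simp only: cis_shift)
  have Hint: "integrable lborel ?H" using gauss_mode_integral[of k] by (simp add: has_bochner_integral_iff)
  (* for given x, the only translate of the period that contains x has j = - floor (x + 1/2) *)
  have ind1: "((\<lambda>j. indicator {- (1/2)..<1/2} (x + of_int j) :: real) has_sum 1) UNIV" for x :: real
  proof -
    have "indicator {- (1/2)..<1/2} (x + of_int j) = (if j = - \<lfloor>x + 1/2\<rfloor> then 1 else 0 :: real)" for j
    proof -
      have "x + of_int j \<in> {- (1/2)..<1/2} \<longleftrightarrow> \<lfloor>x + 1/2\<rfloor> = - j" unfolding floor_eq_iff by auto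
      then show ?thesis by (auto simp: indicator_def)
    qed
    then show ?thesis by (simp only:) (rule has_sum_finite_neutralI[of "{- \<lfloor>x + 1/2\<rfloor>}"], auto)
  qed
  have meas: "(\<lambda>x::real. indicator {- (1/2)..<1/2} (x + of_int j) :: real) \<in> borel_measurable lborel" for j :: int
  proof -
    have "(\<lambda>x. indicator {- (1/2)..<1/2} (x + of_int j)) = (indicator {- (1/2) - of_int j..<1/2 - of_int j} :: real \<Rightarrow> real)"
      by (auto simp: indicator_def fun_eq_iff)
    then show ?thesis by simp
  qed
  have intI: "integrable lborel (?I j)" for j
    by (rule Bochner_Integration.integrable_bound[OF Hint])
       (use Hint meas in \<open>auto intro!: borel_measurable_scaleR simp: indicator_def\<close>)
  have "((\<lambda>j. \<integral>x. ?I j x \<partial>lborel) has_sum (\<integral>x. ?H x \<partial>lborel)) UNIV"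
  proof (rule has_sum_integral(2)[OF intI])
    show "((\<lambda>j. ?I j x) has_sum ?H x) UNIV" for x
      using has_sum_bounded_linear[OF bounded_linear_scaleR_left[of "?H x"] ind1[of x]] by simp
    have "(\<integral>x. norm (?I j x) \<partial>lborel) \<le> gauss_maj * exp (- \<bar>of_int j\<bar>)" for j
      using nle[of j k] shift[of "\<lambda>x. norm (?H x)" j] by (simp only: cis_shift) (simp add: norm_scaleR)
    then show "(\<lambda>j. \<integral>x. norm (?I j x) \<partial>lborel) summable_on UNIV"
      by (intro summable_on_comparison_test[OF gauss_maj_summable]) auto
  qed
  with 1 have "fourier_coeff gauss_sum k = (\<integral>x. ?H x \<partial>lborel)" unfolding tr by (rule has_sum_unique)
  then show ?B using gauss_mode_integral[of k] by (simp only: has_bochner_integral_iff)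
qed

text \<open>
  Poisson summation. The Fourier series of the periodised Gaussian, evaluated at \<open>0\<close>, is a theta series,
  which the triple product evaluates. The centre \<open>z\<close> is complex so that the theorem also covers the theta
  series off the unit circle.
\<close>
theorem theta_inversion:
  "((\<lambda>j::int. exp (- pi * (z - of_int j) ^ 2 / t)) has_sum
     of_real (sqrt t) * (of_real (euler_prod (exp (- pi * t))) * theta_half (exp (- pi * t)) (exp (2 * pi * \<i> * z))
       * theta_half (exp (- pi * t)) (exp (- (2 * pi * \<i> * z))))) UNIV"
proof -
  let ?p = "exp (- pi * t)" and ?w = "exp (2 * pi * \<i> * z)"
  let ?S = "of_real (euler_prod ?p) * theta_half ?p ?w * theta_half ?p (exp (- (2 * pi * \<i> * z)))"
  have p: "0 < ?p" "?p < 1" using t by auto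
  have "((\<lambda>k. of_real (sqrt t) * (of_real (?p powi (k ^ 2)) * ?w powi k)) has_sum of_real (sqrt t) * ?S) UNIV"
    unfolding exp_minus by (intro has_sum_cmult_right Jacobi_triple_product p) auto
  then have "(fourier_coeff gauss_sum has_sum of_real (sqrt t) * ?S) UNIV"
  proof -
    have "fourier_coeff gauss_sum = (\<lambda>k. of_real (sqrt t) * (of_real (?p powi (k ^ 2)) * ?w powi k))"
      by (rule ext) (simp only: fourier_coeff_gauss_sum(2) of_real_mult mult.assoc)
    then show "((\<lambda>k. of_real (sqrt t) * (of_real (?p powi (k ^ 2)) * ?w powi k)) has_sum of_real (sqrt t) * ?S) UNIV
      \<Longrightarrow> (fourier_coeff gauss_sum has_sum of_real (sqrt t) * ?S) UNIV" by (simp only:)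
  qed
  then have "(\<lambda>n. \<Sum>k\<in>{- int n..int n}. fourier_coeff gauss_sum k) \<longlonglongrightarrow> of_real (sqrt t) * ?S"
    unfolding has_sum_def by (rule filterlim_compose[OF _ filterlim_symmetric_intervals_int])
  moreover have "(\<lambda>n. \<Sum>k\<in>{- int n..int n}. fourier_coeff gauss_sum k) \<longlonglongrightarrow> gauss_sum 0"
    by (rule fourier_series_LIMSEQ_0[OF fourier_coeff_gauss_sum(1) gauss_sum_Lipschitz])
  ultimately have "gauss_sum 0 = of_real (sqrt t) * ?S" by (rule LIMSEQ_unique[symmetric])
  with has_sum_gauss_sum[of 0] show ?thesis by (simp add: gauss_def algebra_simps)
qed

end

section \<open>The Euler product near the unit circle\<close>

lemma square_minus_self_ge:
  fixes j :: int
  assumes "j \<notin> {0, 1}"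
  shows "real_of_int (j ^ 2 - j) \<ge> \<bar>of_int j\<bar>"
proof -
  have "j \<ge> 2 \<or> j \<le> - 1" using assms by auto
  then have "j ^ 2 - j \<ge> \<bar>j\<bar>"
  proof
    assume "j \<ge> 2"
    then have "0 \<le> j * (j - 2)" by simp
    then show ?thesis using \<open>j \<ge> 2\<close> by (simp add: power2_eq_square algebra_simps)
  next
    assume "j \<le> - 1"
    then show ?thesis by (simp add: power2_eq_square)
  qed
  then have "real_of_int \<bar>j\<bar> \<le> real_of_int (j ^ 2 - j)" by (rule of_int_le_iff[THEN iffD2])
  then show ?thesis by simp
qed

text \<open>
  One unit of \<open>s\<close> pays for summability in \<open>j\<close>, the rest for smallness.
\<close>
lemma exp_square_minus_self_le:
  fixes j :: int
  assumes "j \<notin> {0, 1}" "s \<ge> 1"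
  shows "exp (- s * real_of_int (j ^ 2 - j)) \<le> exp (1 - s) * exp (- \<bar>of_int j\<bar>)"
proof -
  let ?m = "real_of_int (j ^ 2 - j)"
  have m: "?m \<ge> \<bar>of_int j\<bar>" by (rule square_minus_self_ge[OF assms(1)])
  have "1 \<le> \<bar>j\<bar>" using assms by auto
  then have "1 \<le> ?m" using m by linarith
  then have "(s - 1) * 1 \<le> (s - 1) * ?m" using assms by (intro mult_left_mono) auto
  then have "- s * ?m \<le> 1 - s - \<bar>of_int j\<bar>" using m by (simp add: algebra_simps)
  then show ?thesis by (simp flip: exp_add)
qed

text \<open>
  The triple product for \<open>p ^ 3\<close> at \<open>z = - p\<close>: its three products collect the factors of the Euler product
  by residue classes modulo \<open>3\<close>.
\<close>
lemma euler_prod_pentagonal: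
  assumes p: "0 < p" "p < 1"
  shows "complex_of_real (euler_prod p) =
    of_real (euler_prod (p ^ 3)) * theta_half (p ^ 3) (- of_real p) * theta_half (p ^ 3) (inverse (- of_real p))"
proof -
  have q: "0 < p ^ 3" "p ^ 3 < 1" using p by (auto simp: power_less_one_iff)
  let ?f = "\<lambda>i. complex_of_real (1 - p ^ (2 * i + 2))"
  let ?A = "\<lambda>j. complex_of_real (1 - (p ^ 3) ^ (2 * j + 2))"
  let ?B = "\<lambda>j. 1 + (- complex_of_real p) * of_real ((p ^ 3) ^ (2 * j + 1))"
  let ?C = "\<lambda>j. 1 + inverse (- complex_of_real p) * of_real ((p ^ 3) ^ (2 * j + 1))"
  have A: "?A j = ?f (3 * j + 2)" for j
  proof -
    have "(p ^ 3) ^ (2 * j + 2) = p ^ (2 * (3 * j + 2) + 2)"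
      unfolding power_mult[symmetric] by (rule arg_cong[of _ _ "\<lambda>n. p ^ n"]) simp
    then show ?thesis by (simp only:)
  qed
  have B: "?B j = ?f (3 * j + 1)" for j
  proof -
    have "p * (p ^ 3) ^ (2 * j + 1) = p ^ (2 * (3 * j + 1) + 2)"
      unfolding power_mult[symmetric] power_Suc[symmetric] by (rule arg_cong[of _ _ "\<lambda>n. p ^ n"]) simp
    from arg_cong[OF this, of complex_of_real] show ?thesis by (simp only: of_real_mult of_real_diff of_real_1) simp
  qed
  have C: "?C j = ?f (3 * j)" for j
  proof -
    have "(p ^ 3) ^ (2 * j + 1) = p * p ^ (2 * (3 * j) + 2)"
      unfolding power_mult[symmetric] power_Suc[symmetric] by (rule arg_cong[of _ _ "\<lambda>n. p ^ n"]) simp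
    then show ?thesis using p by simp
  qed
  (* indices 3j, 3j + 1, 3j + 2 of the Euler product are the factors ?C j, ?B j, ?A j *)
  have prod3: "(\<Prod>j<n. ?A j) * (\<Prod>j<n. ?B j) * (\<Prod>j<n. ?C j) = (\<Prod>i<3*n. ?f i)" for n
  proof (induction n)
    case (Suc n)
    have "3 * Suc n = Suc (Suc (Suc (3 * n)))" by simp
    then have "(\<Prod>i<3 * Suc n. ?f i) = (\<Prod>i<3*n. ?f i) * ?f (3 * n) * ?f (3 * n + 1) * ?f (3 * n + 2)"
      by (simp only: prod.lessThan_Suc) simp
    then show ?case unfolding Suc[symmetric] A[symmetric] B[symmetric] C[symmetric] prod.lessThan_Suc
      by (simp only: mult_ac)
  qed simp
  have "(\<lambda>n. (\<Prod>j<n. ?A j)) \<longlonglongrightarrow> of_real (euler_prod (p ^ 3))"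
    unfolding of_real_prod[symmetric] by (intro tendsto_of_real euler_prod_LIMSEQ q)
  moreover have "(\<lambda>n. (\<Prod>j<n. ?B j)) \<longlonglongrightarrow> theta_half (p ^ 3) (- of_real p)"
    "(\<lambda>n. (\<Prod>j<n. ?C j)) \<longlonglongrightarrow> theta_half (p ^ 3) (inverse (- of_real p))"
    using convergent_prod_LIMSEQ[OF convergent_theta_half[OF q]] unfolding theta_half_def
    by (subst LIMSEQ_lessThan_iff_atMost, blast)+
  ultimately have "(\<lambda>n. (\<Prod>j<n. ?A j) * (\<Prod>j<n. ?B j) * (\<Prod>j<n. ?C j)) \<longlonglongrightarrow>
      of_real (euler_prod (p ^ 3)) * theta_half (p ^ 3) (- of_real p) * theta_half (p ^ 3) (inverse (- of_real p))"
    by (intro tendsto_mult)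
  moreover have "(\<lambda>n. \<Prod>i<3*n. ?f i) \<longlonglongrightarrow> of_real (euler_prod p)"
    unfolding of_real_prod[symmetric]
    using LIMSEQ_subseq_LIMSEQ[OF euler_prod_LIMSEQ[OF p], of "\<lambda>n. 3 * n"]
    by (intro tendsto_of_real) (simp add: strict_mono_def o_def)
  ultimately show ?thesis unfolding prod3 by (metis LIMSEQ_unique)
qed

text \<open>
  In the inverted theta series at \<open>z = 1/2 + \<i> * t / 2\<close>, for \<open>3 * t\<close> in place of \<open>t\<close>, the terms \<open>j = 0\<close> and
  \<open>j = 1\<close> have equal modulus and arguments \<open>\<minusplus> pi / 6\<close>; their sum contributes the factor \<open>sqrt 3\<close> that cancels
  the one in \<open>sqrt (3 * t)\<close>. All other terms are smaller by a factor \<open>exp (- 1 / t)\<close> at least.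
\<close>
theorem euler_prod_asymp:
  assumes t: "0 < t" "t \<le> 1"
  shows "\<bar>sqrt t * euler_prod (exp (- pi * t)) / exp (pi * t / 12 - pi / (12 * t)) - 1\<bar> \<le> exp 1 * exp_abs_sum * exp (- 1 / t)"
proof -
  define p where "p = exp (- pi * t)"
  define A where "A = exp (pi * t / 12 - pi / (12 * t))"
  have p: "0 < p" "p < 1" using t by (auto simp: p_def)
  let ?z = "1 / 2 + \<i> * t / 2 :: complex"
  let ?f = "\<lambda>j::int. exp (- pi * (?z - of_int j) ^ 2 / complex_of_real (3 * t))"
  let ?g = "\<lambda>j::int. of_real (exp (- (pi / (3 * t)) * real_of_int (j ^ 2 - j))) * cis (pi * (of_int j - 1 / 2) / 3)"
  have "exp (2 * pi * \<i> * ?z) = exp (\<i> * pi) * exp (of_real (- pi * t))"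
    unfolding exp_add[symmetric] by (rule arg_cong[of _ _ exp]) (simp add: complex_eq_iff)
  also have "\<dots> = - of_real p" unfolding p_def exp_of_real by simp
  finally have e1: "exp (2 * pi * \<i> * ?z) = - of_real p" .
  have e2: "exp (- (2 * pi * \<i> * ?z)) = inverse (- of_real p)" unfolding exp_minus e1 ..
  have e3: "exp (- pi * (3 * t)) = p ^ 3" unfolding p_def exp_of_nat_mult[symmetric] by simp
  have "(?f has_sum of_real (sqrt (3 * t)) * of_real (euler_prod p)) UNIV"
    using theta_inversion[of "3 * t" ?z] t unfolding e1 e2 e3 euler_prod_pentagonal[OF p, symmetric] by simp
  moreover have f: "?f j = of_real A * ?g j" for j
  proof -
    have "- pi * (?z - of_int j) ^ 2 / complex_of_real (3 * t) =
        of_real (pi * t / 12 - pi / (12 * t)) + (of_real (- (pi / (3 * t)) * real_of_int (j ^ 2 - j)) + \<i> * of_real (pi * (of_int j - 1 / 2) / 3))"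
      using t by (simp add: complex_eq_iff power2_eq_square field_simps)
    then show ?thesis unfolding A_def cis_conv_exp exp_of_real[symmetric] exp_add[symmetric] by (simp only:)
  qed
  ultimately have "((\<lambda>j. of_real A * ?g j)
      has_sum of_real (sqrt (3 * t)) * of_real (euler_prod p)) UNIV" by (simp only:)
  from has_sum_cmult_right[OF this, of "inverse (of_real A)"]
  have hs: "(?g
      has_sum of_real (sqrt 3 * (sqrt t * euler_prod p / A))) UNIV" 
    by (simp add: A_def real_sqrt_mult field_simps)
  have s: "pi / (3 * t) \<ge> 1 / t" "1 / t \<ge> 1" using t pi_gt3 by (auto simp: field_simps)
  have "norm (of_real (sqrt 3 * (sqrt t * euler_prod p / A)) - (\<Sum>j\<in>{0,1}. ?g j))
    \<le> exp (1 - 1 / t) * exp_abs_sum"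
  proof (rule has_sum_tail_bound[OF hs])
    fix j :: int assume j: "j \<notin> {0, 1}"
    have "norm (?g j) =
       exp (- (pi / (3 * t)) * real_of_int (j ^ 2 - j))" by (simp add: norm_mult)
    also have "\<dots> \<le> exp (1 - pi / (3 * t)) * exp (- \<bar>of_int j\<bar>)"
      using s by (intro exp_square_minus_self_le j) linarith
    also have "\<dots> \<le> exp (1 - 1 / t) * exp (- \<bar>of_int j\<bar>)" using s by (intro mult_right_mono) auto
    finally show "norm (?g j)
      \<le> exp (1 - 1 / t) * exp (- \<bar>of_int j\<bar>)" .
  qed auto
  also have "(\<Sum>j\<in>{0,1}. ?g j) = of_real (sqrt 3)"
    by (simp add: complex_eq_iff cos_30 sin_30)
  also have "of_real (sqrt 3 * (sqrt t * euler_prod p / A)) - of_real (sqrt 3) = complex_of_real (sqrt 3 * (sqrt t * euler_prod p / A - 1))"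
    by (simp add: algebra_simps)
  also have "norm \<dots> = sqrt 3 * \<bar>sqrt t * euler_prod p / A - 1\<bar>" by (simp only: norm_of_real abs_mult) simp
  finally have *: "sqrt 3 * \<bar>sqrt t * euler_prod p / A - 1\<bar> \<le> exp (1 - 1 / t) * exp_abs_sum" .
  have "1 * \<bar>sqrt t * euler_prod p / A - 1\<bar> \<le> sqrt 3 * \<bar>sqrt t * euler_prod p / A - 1\<bar>"
    by (intro mult_right_mono) auto
  also note *
  also have "exp (1 - 1 / t) = exp 1 * exp (- 1 / t)" by (simp flip: exp_add)
  finally show ?thesis unfolding p_def A_def by (simp add: mult_ac)
qed

section \<open>Moments of powers of the hyperbolic secant\<close>

lemma integrable_abs_power_exp: "integrable lborel (\<lambda>u::real. \<bar>u\<bar> ^ k * exp (- \<bar>u\<bar>))"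
proof -
  let ?g = "\<lambda>x::real. x ^ k * exp (- x) * indicator {0..} x"
  have g: "integrable lborel ?g"
  proof (rule integrableI_nonneg)
    have "(\<integral>\<^sup>+x. ennreal (?g x) \<partial>lborel) = (\<integral>\<^sup>+x. ennreal (x ^ k * exp (- x)) * indicator {0..} x \<partial>lborel)"
      by (intro nn_integral_cong) (auto simp: indicator_def)
    then show "(\<integral>\<^sup>+x. ennreal (?g x) \<partial>lborel) < \<infinity>"
      using nn_intergal_power_times_exp_Ici[of k] by (simp add: ennreal_of_nat_eq_real_of_nat)
  qed (auto simp: indicator_def)
  have g': "integrable lborel (\<lambda>x. ?g (- x))"
    using lborel_integrable_real_affine[OF g, of "- 1" 0] by simp
  show ?thesis
  proof (rule Bochner_Integration.integrable_bound[OF Bochner_Integration.integrable_add[OF g g']])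
    show "AE x in lborel. norm (\<bar>x\<bar> ^ k * exp (- \<bar>x\<bar>)) \<le> norm (?g x + ?g (- x))"
      by (intro AE_I2) (auto simp: indicator_def abs_if)
  qed measurable
qed

lemma tendsto_abs_power_exp:
  "((\<lambda>u::real. \<bar>u\<bar> ^ k * exp (- \<bar>u\<bar>)) \<longlongrightarrow> 0) at_top"
  "((\<lambda>u::real. \<bar>u\<bar> ^ k * exp (- \<bar>u\<bar>)) \<longlongrightarrow> 0) at_bot"
proof -
  show 1: "((\<lambda>u::real. \<bar>u\<bar> ^ k * exp (- \<bar>u\<bar>)) \<longlongrightarrow> 0) at_top"
  proof (rule Lim_transform_eventually[OF tendsto_power_div_exp_0[of k]])
    show "eventually (\<lambda>u::real. u ^ k / exp u = \<bar>u\<bar> ^ k * exp (- \<bar>u\<bar>)) at_top"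
      using eventually_ge_at_top[of 0] by eventually_elim (simp add: exp_minus divide_inverse)
  qed
  show "((\<lambda>u::real. \<bar>u\<bar> ^ k * exp (- \<bar>u\<bar>)) \<longlongrightarrow> 0) at_bot"
    using filterlim_compose[OF 1 filterlim_uminus_at_top_at_bot] by simp
qed

lemma cosh_pi_ge: "cosh (pi * u) \<ge> exp \<bar>u\<bar> / 2"
proof -
  have "\<bar>u\<bar> * 1 \<le> \<bar>u\<bar> * pi" using pi_gt3 by (intro mult_left_mono) auto
  then have "exp \<bar>u\<bar> \<le> exp \<bar>pi * u\<bar>" by (simp add: abs_mult mult.commute)
  also have "\<dots> \<le> exp (pi * u) + exp (- (pi * u))" by (simp add: abs_if)
  finally show ?thesis by (simp add: cosh_def)
qed

lemma inverse_cosh_power_le: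
  assumes "n \<ge> 1"
  shows "1 / cosh (pi * u) ^ n \<le> 2 * exp (- \<bar>u\<bar>)"
proof -
  have "cosh (pi * u) ^ 1 \<le> cosh (pi * u) ^ n" by (rule power_increasing[OF assms cosh_real_ge_1])
  then have c: "cosh (pi * u) \<le> cosh (pi * u) ^ n" by (simp only: power_one_right)
  have "1 / cosh (pi * u) ^ n \<le> 1 / cosh (pi * u)"
    unfolding divide_inverse mult_1_left by (rule le_imp_inverse_le[OF c cosh_real_pos])
  also have "\<dots> \<le> 1 / (exp \<bar>u\<bar> / 2)" unfolding divide_inverse[of 1] mult_1_left by (rule le_imp_inverse_le[OF cosh_pi_ge]) simp
  also have "\<dots> = 2 * exp (- \<bar>u\<bar>)" by (simp add: exp_minus inverse_eq_divide)
  finally show ?thesis .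
qed

definition sech_moment :: "nat \<Rightarrow> nat \<Rightarrow> real" where
  "sech_moment k n = (\<integral>u. u ^ k / cosh (pi * u) ^ n \<partial>lborel)"

lemma cosh_pi_measurable [measurable]: "(\<lambda>u. cosh (pi * u)) \<in> borel_measurable borel"
  by (intro borel_measurable_continuous_onI continuous_intros)

lemma norm_sech_moment_integrand:
  assumes "n \<ge> 1" shows "\<bar>u ^ k / cosh (pi * u) ^ n\<bar> \<le> 2 * (\<bar>u\<bar> ^ k * exp (- \<bar>u\<bar>))"
proof -
  have "\<bar>u ^ k / cosh (pi * u) ^ n\<bar> = \<bar>u\<bar> ^ k * (1 / cosh (pi * u) ^ n)" by (simp add: abs_divide power_abs)
  also have "\<dots> \<le> \<bar>u\<bar> ^ k * (2 * exp (- \<bar>u\<bar>))" by (intro mult_left_mono inverse_cosh_power_le assms) auto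
  finally show ?thesis by simp
qed

lemma integrable_sech_moment:
  assumes "n \<ge> 1" shows "integrable lborel (\<lambda>u. u ^ k / cosh (pi * u) ^ n)"
  by (rule Bochner_Integration.integrable_bound[OF integrable_mult_right[OF integrable_abs_power_exp[of k], of 2]])
     (use norm_sech_moment_integrand[OF assms] in \<open>auto simp: abs_mult\<close>)

lemma integral_derivative_real_line:
  fixes F f :: "real \<Rightarrow> 'a::euclidean_space"
  assumes "\<And>x. (F has_vector_derivative f x) (at x)" "\<And>x. isCont f x" "integrable lborel f"
    and "(F \<longlongrightarrow> A) at_bot" "(F \<longlongrightarrow> B) at_top"
  shows "(\<integral>x. f x \<partial>lborel) = B - A"
proof -
  have "(LBINT x=-\<infinity>..\<infinity>. f x) = B - A"
    by (rule interval_integral_FTC_integrable)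
       (use assms in \<open>auto simp: set_integrable_def ereal_tendsto_simps1\<close>)
  then show ?thesis by (simp add: interval_lebesgue_integral_def set_lebesgue_integral_def)
qed

lemma sech_moment_0_1: "sech_moment 0 1 = 1"
proof -
  have "(\<integral>u. u ^ 0 / cosh (pi * u) ^ 1 \<partial>lborel) = 1 - 0"
  proof (rule integral_derivative_real_line[where F = "\<lambda>u. 2 / pi * arctan (exp (pi * u))"])
    show "((\<lambda>u. 2 / pi * arctan (exp (pi * u))) has_vector_derivative (u ^ 0 / cosh (pi * u) ^ 1)) (at u)" for u
    proof -
      have "((\<lambda>u. 2 / pi * arctan (exp (pi * u))) has_real_derivative (2 / pi * (inverse (1 + exp (pi * u) ^ 2) * (exp (pi * u) * pi)))) (at u)"
        by (auto intro!: derivative_eq_intros)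
      moreover have "2 / pi * (inverse (1 + exp (pi * u) ^ 2) * (exp (pi * u) * pi)) = u ^ 0 / cosh (pi * u) ^ 1"
      proof -
        have "1 + exp (pi * u) ^ 2 \<noteq> 0" by (smt (verit) zero_le_power2)
        then show ?thesis by (simp add: cosh_def exp_minus field_simps power2_eq_square)
      qed
      ultimately show ?thesis by (simp add: has_real_derivative_iff_has_vector_derivative)
    qed
    show "((\<lambda>u. 2 / pi * arctan (exp (pi * u))) \<longlongrightarrow> 1) at_top" by real_asymp
    show "((\<lambda>u. 2 / pi * arctan (exp (pi * u))) \<longlongrightarrow> 0) at_bot" by real_asymp
    show "integrable lborel (\<lambda>u. u ^ 0 / cosh (pi * u) ^ 1)" by (rule integrable_sech_moment) simp
  qed (auto intro!: continuous_intros)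
  then show ?thesis by (simp add: sech_moment_def)
qed

lemma tanh_square: "tanh (x::real) ^ 2 = 1 - (1 / cosh x) ^ 2"
proof -
  have "cosh x ^ 2 \<noteq> 0" by simp
  moreover have "sinh x ^ 2 = cosh x ^ 2 - 1" using hyperbolic_pythagoras[of x] by simp
  then have "tanh x ^ 2 = cosh x ^ 2 / cosh x ^ 2 - 1 / cosh x ^ 2"
    unfolding tanh_def power_divide by (simp only: diff_divide_distrib)
  ultimately show ?thesis by (simp add: power_one_over)
qed

lemma sech_moment_0_2: "sech_moment 0 2 = 2 / pi"
proof -
  have "(\<integral>u. u ^ 0 / cosh (pi * u) ^ 2 \<partial>lborel) = 1 / pi - (- 1 / pi)"
  proof (rule integral_derivative_real_line[where F = "\<lambda>u. tanh (pi * u) / pi"])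
    show "((\<lambda>u. tanh (pi * u) / pi) has_vector_derivative (u ^ 0 / cosh (pi * u) ^ 2)) (at u)" for u
    proof -
      have "((\<lambda>u. tanh (pi * u) / pi) has_real_derivative (((1 - tanh (pi * u) ^ 2) * pi) / pi)) (at u)"
        by (auto intro!: derivative_eq_intros)
      moreover have "((1 - tanh (pi * u) ^ 2) * pi) / pi = u ^ 0 / cosh (pi * u) ^ 2"
      proof -
        have "1 - tanh (pi * u) ^ 2 = 1 / cosh (pi * u) ^ 2"
          by (simp add: tanh_square power_one_over)
        then show ?thesis by simp
      qed
      ultimately show ?thesis by (simp add: has_real_derivative_iff_has_vector_derivative)
    qed
    have *: "filterlim (\<lambda>u. pi * u) at_top at_top" "filterlim (\<lambda>u. pi * u) at_bot at_bot" by real_asymp+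
    show "((\<lambda>u. tanh (pi * u) / pi) \<longlongrightarrow> 1 / pi) at_top"
      by (intro tendsto_divide tendsto_const filterlim_compose[OF tanh_real_at_top *(1)]) auto
    show "((\<lambda>u. tanh (pi * u) / pi) \<longlongrightarrow> - 1 / pi) at_bot"
      by (intro tendsto_divide tendsto_const filterlim_compose[OF tanh_real_at_bot *(2)]) auto
    show "integrable lborel (\<lambda>u. u ^ 0 / cosh (pi * u) ^ 2)" by (rule integrable_sech_moment) simp
  qed (auto intro!: continuous_intros)
  then show ?thesis by (simp add: sech_moment_def)
qed

text \<open>
  With \<open>X = 1 / cosh (pi * u)\<close> and \<open>T = tanh (pi * u)\<close> one has \<open>X' = - pi * X * T\<close>, \<open>T' = pi * X\<^sup>2\<close> and
  \<open>T\<^sup>2 = 1 - X\<^sup>2\<close>, so that the second derivative of \<open>X ^ n\<close> is a combination of \<open>X ^ n\<close> and \<open>X ^ (n + 2)\<close>.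
  The recurrence is two integrations by parts, done at once by integrating the derivative of
  \<open>W = u ^ k * (X ^ n)' - k * u ^ (k - 1) * X ^ n\<close>.
\<close>
lemma sech_moment_rec:
  assumes n: "n \<ge> 1"
  shows "sech_moment k (n + 2) = n / (n + 1) * sech_moment k n
           - k * (real k - 1) / (pi ^ 2 * n * (n + 1)) * (if k < 2 then 0 else sech_moment (k - 2) n)"
proof -
  define X where "X = (\<lambda>u. 1 / cosh (pi * u))"
  define T where "T = (\<lambda>u. tanh (pi * u))"
  define W where "W = (\<lambda>u. - (real n * pi) * (u ^ k * X u ^ n * T u) - real k * (u ^ (k - 1) * X u ^ n))"
  define W' where "W' = (\<lambda>u. (pi ^ 2 * real n ^ 2) * (u ^ k * X u ^ n) - (pi ^ 2 * real n * (real n + 1)) * (u ^ k * X u ^ (n + 2))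
       - (real k * real (k - 1)) * (u ^ (k - 2) * X u ^ n))"
  have X: "u ^ j * X u ^ m = u ^ j / cosh (pi * u) ^ m" for u j m by (simp add: X_def power_one_over)
  have i: "integrable lborel (\<lambda>u. u ^ j * X u ^ n)" for j
    unfolding X by (rule integrable_sech_moment[OF n])
  have i2: "integrable lborel (\<lambda>u. u ^ k * X u ^ (n + 2))" unfolding X by (rule integrable_sech_moment) simp
  have dX: "(X has_real_derivative - pi * (X u * T u)) (at u)" for u
    unfolding X_def T_def by (auto intro!: derivative_eq_intros simp: tanh_def)
  have dT: "(T has_real_derivative pi * X u ^ 2) (at u)" for u
    unfolding X_def T_def by (auto intro!: derivative_eq_intros simp: tanh_square[of "pi * u"])
  have T2: "T u ^ 2 = 1 - X u ^ 2" for u unfolding X_def T_def by (rule tanh_square)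
  have dXn: "((\<lambda>u. X u ^ n) has_real_derivative - real n * pi * (X u ^ n * T u)) (at u)" for u
  proof -
    have "((\<lambda>u. X u ^ n) has_real_derivative real n * (- pi * (X u * T u) * X u ^ (n - 1))) (at u)"
      using DERIV_power[OF dX, of n u] by simp
    moreover have "X u ^ n = X u * X u ^ (n - 1)" using n by (cases n) auto
    ultimately show ?thesis by (simp add: mult_ac)
  qed
  have "(\<integral>u. W' u \<partial>lborel) = 0 - 0"
  proof (rule integral_derivative_real_line[where F = W])
    show "integrable lborel W'" unfolding W'_def
      by (intro Bochner_Integration.integrable_diff integrable_mult_right i i2)
    show "isCont W' u" for u
    proof -
      have "isCont X u" by (rule DERIV_isCont[OF dX])
      then show ?thesis unfolding W'_def by (intro continuous_intros)
    qed
    show "(W has_vector_derivative W' u) (at u)" for u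
    proof -
      have dk: "((\<lambda>u. u ^ (k - 1)) has_real_derivative real (k - 1) * u ^ (k - 2)) (at u)"
        using DERIV_pow[of "k - 1" u] by (simp add: numeral_2_eq_2)
      have dk0: "((\<lambda>u. u ^ k) has_real_derivative real k * u ^ (k - 1)) (at u)"
        using DERIV_pow[of k u] by simp
      have "(W has_real_derivative - (real n * pi) * (((real k * u ^ (k - 1)) * X u ^ n + (- real n * pi * (X u ^ n * T u)) * u ^ k) * T u + (pi * X u ^ 2) * (u ^ k * X u ^ n))
          - real k * ((real (k - 1) * u ^ (k - 2)) * X u ^ n + (- real n * pi * (X u ^ n * T u)) * u ^ (k - 1))) (at u)"
        (is "(W has_real_derivative ?e) _")
        unfolding W_def by (intro DERIV_diff DERIV_cmult DERIV_mult dk dk0 dXn dT)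
      also have "?e =
          pi ^ 2 * real n ^ 2 * (u ^ k * X u ^ n) * T u ^ 2 - pi ^ 2 * real n * (u ^ k * X u ^ n * X u ^ 2)
          - real k * real (k - 1) * (u ^ (k - 2) * X u ^ n)"
        by (simp add: algebra_simps power2_eq_square)
      also have "\<dots> = W' u"
        unfolding W'_def T2 power_add by (simp add: algebra_simps power2_eq_square)
      finally show ?thesis by (simp add: has_real_derivative_iff_has_vector_derivative)
    qed
    let ?b = "\<lambda>u. (real n * pi) * (2 * (\<bar>u\<bar> ^ k * exp (- \<bar>u\<bar>))) + real k * (2 * (\<bar>u\<bar> ^ (k - 1) * exp (- \<bar>u\<bar>)))"
    have "\<bar>W u\<bar> \<le> ?b u" for u
    proof -
      have "\<bar>T u\<bar> \<le> 1" using tanh_real_bounds[of "pi * u"] by (simp add: T_def abs_le_iff)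
      then have "\<bar>u ^ k * X u ^ n\<bar> * \<bar>T u\<bar> \<le> (2 * (\<bar>u\<bar> ^ k * exp (- \<bar>u\<bar>))) * 1"
        unfolding X by (intro mult_mono norm_sech_moment_integrand n) auto
      then have 1: "\<bar>- (real n * pi) * (u ^ k * X u ^ n * T u)\<bar> \<le> (real n * pi) * (2 * (\<bar>u\<bar> ^ k * exp (- \<bar>u\<bar>)))"
        by (simp only: abs_mult abs_minus_cancel abs_of_nat abs_of_pos[OF pi_gt_zero] mult_1_right) (intro mult_left_mono, auto)
      have 2: "\<bar>real k * (u ^ (k - 1) * X u ^ n)\<bar> \<le> real k * (2 * (\<bar>u\<bar> ^ (k - 1) * exp (- \<bar>u\<bar>)))"
        unfolding X abs_mult[of "real k"] abs_of_nat by (intro mult_left_mono norm_sech_moment_integrand n) auto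
      have "\<bar>W u\<bar> \<le> \<bar>- (real n * pi) * (u ^ k * X u ^ n * T u)\<bar> + \<bar>real k * (u ^ (k - 1) * X u ^ n)\<bar>" unfolding W_def by (rule abs_triangle_ineq4)
      with 1 2 show ?thesis by linarith
    qed
    then have le: "norm (W u) \<le> ?b u" for u by simp
    have "(?b \<longlongrightarrow> (real n * pi) * (2 * 0) + real k * (2 * 0)) at_top"
      "(?b \<longlongrightarrow> (real n * pi) * (2 * 0) + real k * (2 * 0)) at_bot"
      by (intro tendsto_add tendsto_mult tendsto_const tendsto_abs_power_exp)+
    then show "(W \<longlongrightarrow> 0) at_top" "(W \<longlongrightarrow> 0) at_bot"
      using Lim_null_comparison[OF always_eventually[rule_format, OF le]] by simp_all
  qed
  moreover have "(\<integral>u. W' u \<partial>lborel) = (pi ^ 2 * real n ^ 2) * sech_moment k n - (pi ^ 2 * real n * (real n + 1)) * sech_moment k (n + 2) - (real k * real (k - 1)) * sech_moment (k - 2) n"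
    unfolding sech_moment_def X[symmetric] W'_def
      Bochner_Integration.integral_diff[OF Bochner_Integration.integrable_diff[OF integrable_mult_right[OF i] integrable_mult_right[OF i2]] integrable_mult_right[OF i]]
      Bochner_Integration.integral_diff[OF integrable_mult_right[OF i] integrable_mult_right[OF i2]] integral_mult_right_zero ..
  moreover define m where "m = (if k < 2 then 0 else sech_moment (k - 2) n)"
  moreover have "(real k * real (k - 1)) * sech_moment (k - 2) n = (real k * (real k - 1)) * m"
    by (auto simp: less_2_cases_iff m_def of_nat_diff)
  ultimately have eq: "pi ^ 2 * real n * (real n + 1) * sech_moment k (n + 2) = pi ^ 2 * real n ^ 2 * sech_moment k n - real k * (real k - 1) * m" by linarith
  have nz: "pi ^ 2 * real n * (real n + 1) \<noteq> 0" using n by (simp add: add_nonneg_eq_0_iff)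
  have "sech_moment k (n + 2) = (pi ^ 2 * real n ^ 2 * sech_moment k n - real k * (real k - 1) * m) / (pi ^ 2 * real n * (real n + 1))"
    unfolding eq[symmetric] using nz by simp
  also have "\<dots> = pi ^ 2 * real n ^ 2 * sech_moment k n / (pi ^ 2 * real n * (real n + 1)) - real k * (real k - 1) / (pi ^ 2 * real n * (real n + 1)) * m"
    by (simp only: diff_divide_distrib times_divide_eq_left)
  also have "pi ^ 2 * real n ^ 2 * sech_moment k n / (pi ^ 2 * real n * (real n + 1)) = real n / (real n + 1) * sech_moment k n"
    using n by (simp add: power2_eq_square)
  finally show ?thesis unfolding m_def by (simp add: add.commute)
qed

section \<open>Shifting the contour in the moment integrals\<close>

text \<open>
  Cauchy's theorem for the strip without contours: for a primitive \<open>H\<close> of \<open>h\<close> the integrand is the derivative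
  of \<open>F u = H (u + \<i>/2) - H (u - \<i>/2)\<close>, and \<open>F\<close> vanishes at both ends because \<open>\<bar>F u\<bar>\<close> is at most the
  supremum of \<open>\<bar>h\<bar>\<close> on the vertical segment at \<open>u\<close>.
\<close>
lemma strip_integral_eq_0:
  fixes h :: "complex \<Rightarrow> complex"
  assumes h: "h holomorphic_on {w. \<bar>Im w\<bar> < 1}"
    and b: "\<And>w. \<bar>Im w\<bar> \<le> 1/2 \<Longrightarrow> \<bar>Re w\<bar> \<ge> 1 \<Longrightarrow> norm (h w) \<le> b (Re w)"
    and lim: "(b \<longlongrightarrow> 0) at_top" "(b \<longlongrightarrow> 0) at_bot"
    and int: "integrable lborel (\<lambda>u::real. h (of_real u + \<i> / 2) - h (of_real u - \<i> / 2))"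
  shows "(\<integral>u. h (complex_of_real u + \<i> / 2) - h (complex_of_real u - \<i> / 2) \<partial>lborel) = 0"
proof -
  let ?S = "{w. \<bar>Im w\<bar> < 1}"
  have S: "?S = {w. Im w < 1} \<inter> {w. Im w > - 1}" by auto
  have op: "open ?S" unfolding S by (intro open_Int open_halfspace_Im_lt open_halfspace_Im_gt)
  have cv: "convex ?S" unfolding S by (intro convex_Int convex_halfspace_Im_lt convex_halfspace_Im_gt)
  obtain H where H: "\<And>w. w \<in> ?S \<Longrightarrow> (H has_field_derivative h w) (at w within ?S)"
    using holomorphic_convex_primitive'[OF cv op h] by blast
  have H': "(H has_field_derivative h w) (at w)" if "w \<in> ?S" for w
    using H[OF that] at_within_open[OF that op] by simp
  define F where "F = (\<lambda>u::real. H (of_real u + \<i> / 2) - H (of_real u - \<i> / 2))"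
  have le: "norm (F u) \<le> b u" if "\<bar>u\<bar> \<ge> 1" for u
  proof -
    let ?L = "closed_segment (of_real u - \<i> / 2) (of_real u + \<i> / 2 :: complex)"
    have seg: "Re w = u \<and> \<bar>Im w\<bar> \<le> 1/2" if w: "w \<in> ?L" for w
    proof -
      obtain r where r: "0 \<le> r" "r \<le> 1" "w = (1 - r) *\<^sub>R (of_real u - \<i> / 2) + r *\<^sub>R (of_real u + \<i> / 2)"
        using w[unfolded in_segment(1)] by (elim exE conjE)
      have "Re w = u" "Im w = r - 1 / 2" unfolding r(3) by (simp_all add: algebra_simps)
      then show ?thesis using r(1,2) by linarith
    qed
    have "norm (H (of_real u + \<i> / 2) - H (of_real u - \<i> / 2)) \<le> b u * norm ((of_real u + \<i> / 2) - (of_real u - \<i> / 2 :: complex))"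
    proof (rule field_differentiable_bound[of ?L])
      show "(H has_field_derivative h w) (at w within ?L)" if "w \<in> ?L" for w
        using seg[OF that] by (intro has_field_derivative_at_within[OF H']) auto
      show "norm (h w) \<le> b u" if "w \<in> ?L" for w
        using b[of w] seg[OF that] \<open>\<bar>u\<bar> \<ge> 1\<close> by simp
    qed auto
    then show ?thesis by (simp add: F_def)
  qed
  have "(\<integral>u. h (complex_of_real u + \<i> / 2) - h (complex_of_real u - \<i> / 2) \<partial>lborel) = 0 - 0"
  proof (rule integral_derivative_real_line[where F = F])
    show "(F has_vector_derivative h (of_real u + \<i> / 2) - h (of_real u - \<i> / 2)) (at u)" for u
    proof -
      have d: "((\<lambda>v. H (of_real v + c)) has_vector_derivative h (of_real u + c)) (at u)" if "\<bar>Im c\<bar> \<le> 1/2" for c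
      proof -
        have "((\<lambda>v. H (v + c)) has_field_derivative h (of_real u + c)) (at (of_real u))"
          using DERIV_shift[of H "h (of_real u + c)" "of_real u" c] H'[of "of_real u + c"] that by simp
        then show ?thesis by (rule has_vector_derivative_real_field)
      qed
      from has_vector_derivative_diff[OF d[of "\<i> / 2"] d[of "- \<i> / 2"]] show ?thesis unfolding F_def by simp
    qed
    have ch: "continuous_on ?S h" by (rule holomorphic_on_imp_continuous_on[OF h])
    show "isCont (\<lambda>u. h (of_real u + \<i> / 2) - h (of_real u - \<i> / 2)) u" for u
    proof -
      have "isCont (\<lambda>v::real. h (of_real v + c)) u" if "\<bar>Im c\<bar> \<le> 1/2" for c
      proof (rule isCont_o2[where g = h])
        show "isCont h (of_real u + c)"
          using ch op that by (subst (asm) continuous_on_eq_continuous_at) auto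
      qed (intro continuous_intros)
      from continuous_diff[OF this[of "\<i> / 2"] this[of "- \<i> / 2"]] show ?thesis by simp
    qed
    show "(F \<longlongrightarrow> 0) at_top"
      by (rule Lim_null_comparison[OF _ lim(1)])
         (use eventually_ge_at_top[of "1::real"] in eventually_elim, intro le, simp)
    show "(F \<longlongrightarrow> 0) at_bot"
      by (rule Lim_null_comparison[OF _ lim(2)])
         (use eventually_le_at_bot[of "-1::real"] in eventually_elim, intro le, simp)
  qed fact
  then show ?thesis by simp
qed

lemma sinh_pi_shift:
  "sinh (of_real pi * (of_real u + \<i> / 2)) = \<i> * of_real (cosh (pi * u))"
  "sinh (of_real pi * (of_real u - \<i> / 2)) = - \<i> * of_real (cosh (pi * u))"
proof -
  have e: "exp (of_real pi * (of_real u + \<i> / 2)) = of_real (exp (pi * u)) * \<i>"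
    "exp (- (of_real pi * (of_real u + \<i> / 2))) = of_real (exp (- (pi * u))) * - \<i>"
    "exp (of_real pi * (of_real u - \<i> / 2)) = of_real (exp (pi * u)) * - \<i>"
    "exp (- (of_real pi * (of_real u - \<i> / 2))) = of_real (exp (- (pi * u))) * \<i>"
    by (simp_all add: complex_eq_iff Re_exp Im_exp)
  show "sinh (of_real pi * (of_real u + \<i> / 2)) = \<i> * of_real (cosh (pi * u))"
    "sinh (of_real pi * (of_real u - \<i> / 2)) = - \<i> * of_real (cosh (pi * u))"
    unfolding sinh_def cosh_def e by (simp_all add: complex_eq_iff field_simps)
qed

lemma sinh_pi_nonzero:
  assumes "\<bar>Im w\<bar> < 1" "w \<noteq> 0" shows "sinh (of_real pi * w) \<noteq> 0"
proof
  assume "sinh (of_real pi * w) = 0"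
  then have "exp (of_real pi * w) = exp (- (of_real pi * w))" by (simp add: sinh_def)
  then have "exp (of_real pi * w) * exp (of_real pi * w) = exp (- (of_real pi * w)) * exp (of_real pi * w)" by simp
  then have "exp (2 * of_real pi * w) = 1" unfolding exp_add[symmetric] by (simp add: algebra_simps)
  then obtain n :: int where n: "Re (2 * of_real pi * w) = 0" "Im (2 * of_real pi * w) = of_int (2 * n) * pi"
    by (auto simp: exp_eq_1)
  then have "Re w = 0" "Im w = of_int n" by simp_all
  moreover from this have "n = 0" using assms(1) by simp
  ultimately show False using assms(2) by (simp add: complex_eq_iff)
qed

lemma norm_sinh_pi_ge:
  assumes "\<bar>Re w\<bar> \<ge> 1" shows "norm (sinh (of_real pi * w)) \<ge> exp \<bar>Re w\<bar> / 2"
proof -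
  let ?u = "Re w"
  have "\<bar>?u\<bar> * 3 \<le> \<bar>?u\<bar> * pi" using pi_gt3 by (intro mult_left_mono) auto
  then have "\<bar>?u\<bar> + 2 \<le> \<bar>pi * ?u\<bar>" using assms by (simp add: abs_mult mult.commute)
  then have "exp \<bar>?u\<bar> * exp 2 \<le> exp \<bar>pi * ?u\<bar>" by (simp flip: exp_add)
  moreover have "exp \<bar>?u\<bar> * 2 \<le> exp \<bar>?u\<bar> * exp 2" using exp_ge_add_one_self[of "2::real"] by (intro mult_left_mono) auto
  moreover have "exp (- \<bar>pi * ?u\<bar>) \<le> exp \<bar>?u\<bar>" by (intro exp_le_cancel_iff[THEN iffD2]) auto
  ultimately have "exp \<bar>?u\<bar> \<le> exp \<bar>pi * ?u\<bar> - exp (- \<bar>pi * ?u\<bar>)" by linarith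
  also have "\<dots> \<le> \<bar>exp (pi * ?u) - exp (- (pi * ?u))\<bar>" by (simp add: abs_if)
  also have "\<dots> = \<bar>norm (exp (of_real pi * w)) - norm (exp (- (of_real pi * w)))\<bar>" by (simp add: norm_exp_eq_Re)
  also have "\<dots> \<le> norm (exp (of_real pi * w) - exp (- (of_real pi * w)))" by (rule norm_triangle_ineq3)
  also have "\<dots> = 2 * norm (sinh (of_real pi * w))" by (simp add: sinh_def norm_scaleR)
  finally show ?thesis by simp
qed

text \<open>
  In the strip the only zero of \<open>sinh (pi * w)\<close> is \<open>w = 0\<close>, and it is simple.
\<close>
lemma holomorphic_x_over_sinh:
  "(\<lambda>w. if w = 0 then of_real (1 / pi) else w / sinh (of_real pi * w)) holomorphic_on {w. \<bar>Im w\<bar> < 1}"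
proof (rule no_isolated_singularity'[where K = "{0}"])
  let ?g = "\<lambda>w::complex. if w = 0 then of_real (1 / pi) else w / sinh (of_real pi * w)"
  have S: "{w. \<bar>Im w\<bar> < 1} = {w. Im w < 1} \<inter> {w. Im w > - 1}" by auto
  show op: "open {w. \<bar>Im w\<bar> < 1}" unfolding S by (intro open_Int open_halfspace_Im_lt open_halfspace_Im_gt)
  have "((\<lambda>w::complex. sinh (of_real pi * w)) has_field_derivative of_real pi) (at 0)"
    by (auto intro!: derivative_eq_intros)
  then have "((\<lambda>w::complex. sinh (of_real pi * w) / w) \<longlongrightarrow> of_real pi) (at 0)"
    by (simp add: has_field_derivative_iff)
  from tendsto_inverse[OF this] have "((\<lambda>w::complex. w / sinh (of_real pi * w)) \<longlongrightarrow> of_real (1 / pi)) (at 0)"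
    by (simp add: inverse_eq_divide)
  then have "(?g \<longlongrightarrow> of_real (1 / pi)) (at 0)"
    by (rule Lim_transform_eventually) (auto simp: eventually_at_filter)
  then show "(?g \<longlongrightarrow> ?g z) (at z within {w. \<bar>Im w\<bar> < 1})" if "z \<in> {0}" for z
    using that by (auto intro: tendsto_within_subset)
  have "(\<lambda>w. w / sinh (of_real pi * w)) holomorphic_on {w. \<bar>Im w\<bar> < 1} - {0}"
    unfolding sinh_def using sinh_pi_nonzero
    by (intro holomorphic_intros) (auto simp: sinh_def)
  then show "?g holomorphic_on {w. \<bar>Im w\<bar> < 1} - {0}"
    by (rule holomorphic_transform) auto
qed simp

lemma integrable_shifted_power:
  assumes "n \<ge> 1"
  shows "integrable lborel (\<lambda>u::real. (of_real u + c) ^ k / of_real (cosh (pi * u) ^ n) :: complex)"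
    and "(\<integral>u. (complex_of_real u + c) ^ k / of_real (cosh (pi * u) ^ n) \<partial>lborel) =
       (\<Sum>j\<le>k. of_nat (k choose j) * of_real (sech_moment j n) * c ^ (k - j))"
proof -
  have i: "integrable lborel (\<lambda>u. complex_of_real (u ^ j / cosh (pi * u) ^ n))" for j
    by (intro integrable_of_real integrable_sech_moment assms)
  have eq: "(of_real u + c) ^ k / of_real (cosh (pi * u) ^ n) =
     (\<Sum>j\<le>k. of_nat (k choose j) * c ^ (k - j) * of_real (u ^ j / cosh (pi * u) ^ n))" for u :: real
    unfolding binomial_ring sum_divide_distrib by (intro sum.cong refl) (simp add: mult_ac)
  show "integrable lborel (\<lambda>u::real. (of_real u + c) ^ k / of_real (cosh (pi * u) ^ n) :: complex)"
    unfolding eq by (intro Bochner_Integration.integrable_sum integrable_mult_right i)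
  show "(\<integral>u. (complex_of_real u + c) ^ k / of_real (cosh (pi * u) ^ n) \<partial>lborel) =
       (\<Sum>j\<le>k. of_nat (k choose j) * of_real (sech_moment j n) * c ^ (k - j))"
    unfolding eq
    by (subst Bochner_Integration.integral_sum)
       (use i in \<open>auto intro!: sum.cong integrable_mult_right simp: sech_moment_def integral_of_real[symmetric] simp del: integral_of_real of_real_divide of_real_power\<close>)
qed

text \<open>
  On the lines \<open>Im w = \<plusminus> 1/2\<close> the function \<open>sinh (pi * w)\<close> equals \<open>\<plusminus> \<i> * cosh (pi * u)\<close>. Hence shifting the
  line of integration of \<open>w ^ k / sinh (pi * w) ^ n\<close>, which is holomorphic in the strip for \<open>k \<ge> n\<close>, relates
  moments of the same \<open>n\<close>.
\<close>
lemma sech_moment_shift: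
  assumes "1 \<le> n" "n \<le> k"
  shows "(\<Sum>j\<le>k. of_nat (k choose j) * of_real (sech_moment j n) * ((\<i> / 2) ^ (k - j) - (- 1) ^ n * (- \<i> / 2) ^ (k - j))) = 0"
proof -
  let ?g = "\<lambda>w::complex. if w = 0 then of_real (1 / pi) else w / sinh (of_real pi * w)"
  define h where "h = (\<lambda>w. w ^ (k - n) * ?g w ^ n)"
  let ?I = "\<lambda>c. \<integral>u. (complex_of_real u + c) ^ k / of_real (cosh (pi * u) ^ n) \<partial>lborel"
  have h: "h w = w ^ k / sinh (of_real pi * w) ^ n" if "w \<noteq> 0" for w
    using that assms by (simp add: h_def power_divide power_add[symmetric])
  have h1: "h (of_real u + \<i> / 2) = (1 / \<i>) ^ n * ((of_real u + \<i> / 2) ^ k / of_real (cosh (pi * u) ^ n))" for u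
  proof -
    have "of_real u + \<i> / 2 \<noteq> 0" by (simp add: complex_eq_iff)
    then show ?thesis by (subst h) (simp_all only: sinh_pi_shift power_mult_distrib power_divide of_real_power power_one times_divide_times_eq mult_1_left, simp_all)
  qed
  have h2: "h (of_real u - \<i> / 2) = (1 / \<i>) ^ n * ((- 1) ^ n * ((of_real u + - \<i> / 2) ^ k / of_real (cosh (pi * u) ^ n)))" for u
  proof -
    have "of_real u - \<i> / 2 \<noteq> 0" by (simp add: complex_eq_iff)
    from h[OF this] have "h (of_real u - \<i> / 2) = (of_real u - \<i> / 2) ^ k / ((- \<i>) ^ n * of_real (cosh (pi * u)) ^ n)"
      by (simp only: sinh_pi_shift power_mult_distrib)
    also have "\<dots> = (1 / - \<i>) ^ n * ((of_real u - \<i> / 2) ^ k / of_real (cosh (pi * u) ^ n))"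
      by (simp only: power_divide of_real_power power_one times_divide_times_eq mult_1_left)
    also have "1 / - \<i> = (1 / \<i>) * (- 1)" by simp
    finally show ?thesis by (simp only: power_mult_distrib mult.assoc) simp
  qed
  note i = integrable_shifted_power(1)[OF assms(1)]
  have int: "integrable lborel (\<lambda>u::real. h (of_real u + \<i> / 2) - h (of_real u - \<i> / 2))"
    unfolding h1 h2 by (intro Bochner_Integration.integrable_diff integrable_mult_right i)
  have "0 = (\<integral>u. h (complex_of_real u + \<i> / 2) - h (complex_of_real u - \<i> / 2) \<partial>lborel)"
  proof (rule strip_integral_eq_0[symmetric, where b = "\<lambda>u. 2 ^ (k + n) * (\<bar>u\<bar> ^ k * exp (- \<bar>u\<bar>))"])
    show "h holomorphic_on {w. \<bar>Im w\<bar> < 1}"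
      unfolding h_def by (intro holomorphic_intros holomorphic_x_over_sinh)
    show "((\<lambda>u. 2 ^ (k + n) * (\<bar>u\<bar> ^ k * exp (- \<bar>u\<bar>))) \<longlongrightarrow> (0::real)) at_top"
      "((\<lambda>u. 2 ^ (k + n) * (\<bar>u\<bar> ^ k * exp (- \<bar>u\<bar>))) \<longlongrightarrow> (0::real)) at_bot"
      by (intro tendsto_mult_right_zero tendsto_abs_power_exp)+
    fix w :: complex assume w: "\<bar>Im w\<bar> \<le> 1/2" "\<bar>Re w\<bar> \<ge> 1"
    have "w \<noteq> 0" using w by auto
    have "norm w \<le> 2 * \<bar>Re w\<bar>" using cmod_le[of w] w by linarith
    then have 1: "norm w ^ k \<le> (2 * \<bar>Re w\<bar>) ^ k" by (intro power_mono) auto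
    have "(exp \<bar>Re w\<bar>) ^ 1 \<le> (exp \<bar>Re w\<bar>) ^ n" by (rule power_increasing[OF assms(1)]) simp
    then have "exp \<bar>Re w\<bar> / 2 ^ n \<le> (exp \<bar>Re w\<bar> / 2) ^ n" by (simp add: power_divide divide_right_mono)
    also have "\<dots> \<le> norm (sinh (of_real pi * w)) ^ n" by (intro power_mono norm_sinh_pi_ge w) auto
    finally have 2: "exp \<bar>Re w\<bar> / 2 ^ n \<le> norm (sinh (of_real pi * w)) ^ n" .
    have "norm (h w) = norm w ^ k / norm (sinh (of_real pi * w)) ^ n"
      unfolding h[OF \<open>w \<noteq> 0\<close>] by (simp add: norm_divide norm_power)
    also have "\<dots> \<le> (2 * \<bar>Re w\<bar>) ^ k / (exp \<bar>Re w\<bar> / 2 ^ n)"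
      by (rule frac_le[OF _ 1 _ 2]) auto
    also have "\<dots> = 2 ^ (k + n) * (\<bar>Re w\<bar> ^ k * exp (- \<bar>Re w\<bar>))"
      by (simp add: power_mult_distrib power_add exp_minus divide_inverse)
    finally show "norm (h w) \<le> 2 ^ (k + n) * (\<bar>Re w\<bar> ^ k * exp (- \<bar>Re w\<bar>))" .
  qed fact
  also have "\<dots> = (1 / \<i>) ^ n * ?I (\<i> / 2) - (1 / \<i>) ^ n * ((- 1) ^ n * ?I (- \<i> / 2))"
    unfolding h1 h2 Bochner_Integration.integral_diff[OF integrable_mult_right[OF i] integrable_mult_right[OF integrable_mult_right[OF i]]]
      integral_mult_right_zero ..
  also have "\<dots> = (1 / \<i>) ^ n * (?I (\<i> / 2) - (- 1) ^ n * ?I (- \<i> / 2))" by (simp only: right_diff_distrib)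
  finally have "?I (\<i> / 2) - (- 1) ^ n * ?I (- \<i> / 2) = 0" by simp
  then show ?thesis unfolding integrable_shifted_power(2)[OF assms(1)]
    by (simp add: sum_distrib_left sum_subtractf[symmetric] algebra_simps)
qed

section \<open>The higher Euler numbers are moments\<close>

text \<open>
  The exponential generating function of the moments.
\<close>
definition sech_fps :: "nat \<Rightarrow> complex fps" where
  "sech_fps n = Abs_fps (\<lambda>k. of_real (sech_moment k n) / fact k)"

text \<open>
  The coefficient of \<open>x ^ k\<close> in the product with exponentials is the binomial convolution of
  \<open>sech_moment_shift\<close>. The finitely many \<open>k < n\<close>, where the integrand has a pole, are the ones that need
  explicit integrals.
\<close>
lemma sech_fps_shift:
  assumes "1 \<le> n" "n \<le> k"
  shows "((fps_exp (\<i> / 2) - fps_const ((- 1) ^ n) * fps_exp (- \<i> / 2)) * sech_fps n) $ k = 0"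
proof -
  have "((fps_exp (\<i> / 2) - fps_const ((- 1) ^ n) * fps_exp (- \<i> / 2)) * sech_fps n) $ k =
     (\<Sum>j=0..k. ((\<i> / 2) ^ (k - j) / fact (k - j) - (- 1) ^ n * ((- \<i> / 2) ^ (k - j) / fact (k - j))) * (of_real (sech_moment j n) / fact j))"
    by (subst mult.commute, subst fps_mult_nth) (simp add: sech_fps_def mult_ac)
  also have "\<dots> = (\<Sum>j\<le>k. of_nat (k choose j) * of_real (sech_moment j n) * ((\<i> / 2) ^ (k - j) - (- 1) ^ n * (- \<i> / 2) ^ (k - j)) / fact k)"
    unfolding atMost_atLeast0
  proof (intro sum.cong refl)
    fix j assume "j \<in> {0..k}"
    then have "of_nat (k choose j) = (fact k / (fact j * fact (k - j)) :: complex)" by (intro binomial_fact) auto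
    then show "((\<i> / 2) ^ (k - j) / fact (k - j) - (- 1) ^ n * ((- \<i> / 2) ^ (k - j) / fact (k - j))) * (of_real (sech_moment j n) / fact j) =
      of_nat (k choose j) * of_real (sech_moment j n) * ((\<i> / 2) ^ (k - j) - (- 1) ^ n * (- \<i> / 2) ^ (k - j)) / fact k"
      by (simp add: divide_simps) (simp add: algebra_simps)
  qed
  also have "\<dots> = 0" unfolding sum_divide_distrib[symmetric] sech_moment_shift[OF assms] by simp
  finally show ?thesis .
qed

lemma sech_fps_1: "(fps_exp (\<i> / 2) + fps_exp (- \<i> / 2)) * sech_fps 1 = 2"
proof (rule fps_ext)
  fix k
  show "((fps_exp (\<i> / 2) + fps_exp (- \<i> / 2)) * sech_fps 1) $ k = (2 :: complex fps) $ k"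
  proof (cases "k = 0")
    case True
    then show ?thesis using sech_moment_0_1 by (simp add: fps_mult_nth sech_fps_def)
  next
    case False
    have eq: "fps_exp (\<i> / 2) - fps_const ((- 1) ^ 1) * fps_exp (- \<i> / 2) = fps_exp (\<i> / 2) + fps_exp (- \<i> / 2)"
      by (intro fps_ext) simp
    show ?thesis using sech_fps_shift[of 1 k, unfolded eq] False by (simp add: fps_numeral_nth)
  qed
qed

lemma sech_fps_2: "(fps_exp (\<i> / 2) - fps_exp (- \<i> / 2)) * sech_fps 2 = fps_const (2 * \<i> / of_real pi) * fps_X"
proof (rule fps_ext)
  fix k
  show "((fps_exp (\<i> / 2) - fps_exp (- \<i> / 2)) * sech_fps 2) $ k = (fps_const (2 * \<i> / of_real pi) * fps_X) $ k"
  proof (cases "k < 2")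
    case True
    then have "k = 0 \<or> k = 1" by auto
    then show ?thesis using sech_moment_0_2 by (auto simp: fps_mult_nth sech_fps_def)
  next
    case False
    then show ?thesis using sech_fps_shift[of 2 k] by simp
  qed
qed

lemma euler_fps: "(fps_exp 1 + fps_exp (- 1)) * (2 / (fps_exp 1 + fps_exp (- 1))) = (2 :: real fps)"
proof -
  define e where "e = (fps_exp 1 + fps_exp (- 1) :: real fps)"
  have e0: "e $ 0 \<noteq> 0" by (simp add: e_def)
  have "e * (2 / e) = 2 * (inverse e * e)" using e0 by (simp add: fps_divide_unit mult_ac)
  also have "\<dots> = 2" using inverse_mult_eq_1[OF e0] by simp
  finally show ?thesis unfolding e_def .
qed

lemma bernoulli_fps: "(fps_exp (1/2) - fps_exp (- 1/2)) * (fps_X * fps_exp (1/2) / (fps_exp 1 - 1)) = (fps_X :: real fps)"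
proof -
  let ?d = "fps_exp 1 - 1 :: real fps" and ?n = "fps_X * fps_exp (1/2) :: real fps"
  have d0: "?d \<noteq> 0"
  proof
    assume "?d = 0" then have "?d $ 1 = 0" by simp
    then show False by simp
  qed
  have n0: "?n \<noteq> 0"
  proof
    assume "?n = 0" then have "?n $ 1 = 0" by simp
    then show False by simp
  qed
  have "subdegree ?d \<le> 1" by (rule subdegree_leI) simp
  also have "1 \<le> subdegree ?n" using n0 by (intro subdegree_geI) auto
  finally have "?d dvd ?n" using d0 n0 by (simp add: fps_dvd_iff)
  then have "?d * (?n / ?d) = ?n" by simp
  then have "fps_exp (- 1/2) * ?d * (?n / ?d) = fps_exp (- 1/2) * ?n" by (simp only: mult.assoc)
  moreover have "fps_exp (- 1/2) * ?d = fps_exp (1/2) - fps_exp (- 1/2)"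
    by (simp add: algebra_simps fps_exp_add_mult[symmetric])
  moreover have "fps_exp (- 1/2) * ?n = fps_X"
  proof -
    have "fps_exp (- 1/2) * ?n = fps_X * (fps_exp (- 1/2) * fps_exp (1/2))" by (simp only: mult_ac)
    also have "fps_exp (- 1/2) * fps_exp (1/2) = (1 :: real fps)" unfolding fps_exp_add_mult[symmetric] by simp
    finally show ?thesis by simp
  qed
  ultimately show ?thesis by (simp only:)
qed

text \<open>
  Substituting \<open>c * x\<close> for the variable, here for a complex \<open>c\<close> and real series, is multiplicative.
\<close>
lemma fps_scaled_product:
  fixes A B :: "real fps"
  shows "Abs_fps (\<lambda>k. c ^ k * of_real (A $ k)) * Abs_fps (\<lambda>k. c ^ k * of_real (B $ k)) =
         Abs_fps (\<lambda>k. c ^ k * complex_of_real ((A * B) $ k))"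
proof (rule fps_ext)
  fix k
  have "(\<Sum>j=0..k. c ^ j * complex_of_real (A $ j) * (c ^ (k - j) * of_real (B $ (k - j)))) =
      (\<Sum>j=0..k. c ^ k * of_real (A $ j * B $ (k - j)))"
  proof (intro sum.cong refl)
    fix j assume "j \<in> {0..k}"
    then have "c ^ k = c ^ j * c ^ (k - j)" by (simp add: power_add[symmetric])
    then show "c ^ j * complex_of_real (A $ j) * (c ^ (k - j) * of_real (B $ (k - j))) = c ^ k * of_real (A $ j * B $ (k - j))"
      by simp
  qed
  then show "(Abs_fps (\<lambda>k. c ^ k * of_real (A $ k)) * Abs_fps (\<lambda>k. c ^ k * of_real (B $ k))) $ k =
         Abs_fps (\<lambda>k. c ^ k * complex_of_real ((A * B) $ k)) $ k"
    by (simp add: fps_mult_nth sum_distrib_left)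
qed

text \<open>
  Since \<open>(- 2 * \<i>) ^ (- k) = (\<i> / 2) ^ k\<close>, the generating function of the left-hand side is that of the Euler
  numbers at \<open>\<i> * x / 2\<close>. It satisfies the same linear equation as \<open>sech_fps 1\<close>.
\<close>
lemma higher_euler_1: "higher_euler k 1 = of_real (sech_moment k 1)"
proof -
  let ?E = "2 / (fps_exp 1 + fps_exp (- 1)) :: real fps"
  let ?Y = "Abs_fps (\<lambda>k. (\<i> / 2) ^ k * complex_of_real (?E $ k))"
  have A: "Abs_fps (\<lambda>k. (\<i> / 2) ^ k * complex_of_real ((fps_exp 1 + fps_exp (- 1)) $ k)) = fps_exp (\<i> / 2) + fps_exp (- \<i> / 2)"
    by (intro fps_ext) (simp add: algebra_simps power_mult_distrib[symmetric] add_divide_distrib)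
  have "(fps_exp (\<i> / 2) + fps_exp (- \<i> / 2)) * ?Y = Abs_fps (\<lambda>k. (\<i> / 2) ^ k * complex_of_real ((2 :: real fps) $ k))"
    unfolding A[symmetric] fps_scaled_product euler_fps ..
  also have "\<dots> = 2" by (intro fps_ext) (auto simp: fps_numeral_nth)
  finally have "(fps_exp (\<i> / 2) + fps_exp (- \<i> / 2)) * ?Y = (fps_exp (\<i> / 2) + fps_exp (- \<i> / 2)) * sech_fps 1"
    unfolding sech_fps_1 .
  moreover have "fps_exp (\<i> / 2) + fps_exp (- \<i> / 2) \<noteq> 0"
  proof
    assume "fps_exp (\<i> / 2) + fps_exp (- \<i> / 2) = 0"
    then have "(fps_exp (\<i> / 2) + fps_exp (- \<i> / 2)) $ 0 = 0" by simp
    then show False by simp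
  qed
  ultimately have "?Y = sech_fps 1" by simp
  then have "?Y $ k = sech_fps 1 $ k" by simp
  then have "(\<i> / 2) ^ k * complex_of_real (?E $ k) * fact k = of_real (sech_moment k 1)" by (simp add: sech_fps_def)
  moreover have "(- 2 * \<i>) powi (- int k) = (\<i> / 2) ^ k"
  proof -
    have "inverse (- 2 * \<i>) = \<i> / 2" by (simp add: complex_eq_iff)
    then show ?thesis by (simp only: power_int_minus power_int_of_nat power_inverse[symmetric])
  qed
  ultimately show ?thesis by (simp add: euler_number_def mult_ac)
qed

text \<open>
  Here \<open>\<i> ^ (- k) = (- \<i>) ^ k\<close>, so the generating function \<open>(x/2) / sinh (x/2)\<close> of the \<open>B\<^sub>k (1/2)\<close> is
  taken at \<open>- \<i> * x\<close>, up to the factor \<open>2 / pi\<close>.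
\<close>
lemma higher_euler_2: "higher_euler k 2 = of_real (sech_moment k 2)"
proof -
  let ?B = "fps_X * fps_exp (1/2) / (fps_exp 1 - 1) :: real fps"
  let ?Y = "Abs_fps (\<lambda>k. (- \<i>) ^ k * complex_of_real (?B $ k))"
  have A: "Abs_fps (\<lambda>k. (- \<i>) ^ k * complex_of_real ((fps_exp (1/2) - fps_exp (- 1/2)) $ k)) = - (fps_exp (\<i> / 2) - fps_exp (- \<i> / 2))"
  proof (rule fps_ext)
    fix k
    have "(- \<i>) ^ k * complex_of_real ((1/2) ^ k) = (- \<i> / 2) ^ k" "(- \<i>) ^ k * complex_of_real ((- 1/2) ^ k) = (\<i> / 2) ^ k"
      unfolding of_real_power power_mult_distrib[symmetric] by simp_all
    moreover have "(- \<i>) ^ k * complex_of_real ((fps_exp (1/2) - fps_exp (- 1/2)) $ k) =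
        ((- \<i>) ^ k * complex_of_real ((1/2) ^ k)) / fact k - ((- \<i>) ^ k * complex_of_real ((- 1/2) ^ k)) / fact k"
      by (simp add: diff_divide_distrib right_diff_distrib del: of_real_power)
    ultimately show "Abs_fps (\<lambda>k. (- \<i>) ^ k * complex_of_real ((fps_exp (1/2) - fps_exp (- 1/2)) $ k)) $ k = (- (fps_exp (\<i> / 2) - fps_exp (- \<i> / 2))) $ k"
      by simp
  qed
  have "- (fps_exp (\<i> / 2) - fps_exp (- \<i> / 2)) * ?Y = Abs_fps (\<lambda>k. (- \<i>) ^ k * complex_of_real ((fps_X :: real fps) $ k))"
    unfolding A[symmetric] fps_scaled_product bernoulli_fps ..
  also have "\<dots> = fps_const (- \<i>) * fps_X" by (intro fps_ext) (auto simp: fps_X_def)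
  finally have 1: "- (fps_exp (\<i> / 2) - fps_exp (- \<i> / 2)) * ?Y = fps_const (- \<i>) * fps_X" .
  have "(fps_exp (\<i> / 2) - fps_exp (- \<i> / 2)) * (fps_const (2 / of_real pi) * ?Y) =
      fps_const (- 2 / of_real pi) * (- (fps_exp (\<i> / 2) - fps_exp (- \<i> / 2)) * ?Y)"
  proof -
    have "fps_const (- 2 / of_real pi) = - fps_const (2 / of_real pi :: complex)" by (simp add: fps_const_neg)
    moreover have "E * (c * Y) = - c * (- E * Y)" for E c Y :: "complex fps" by (simp add: mult_ac)
    ultimately show ?thesis by (simp only:)
  qed
  also have "\<dots> = (fps_exp (\<i> / 2) - fps_exp (- \<i> / 2)) * sech_fps 2"
    unfolding 1 sech_fps_2 mult.assoc[symmetric] fps_const_mult by simp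
  finally have "(fps_exp (\<i> / 2) - fps_exp (- \<i> / 2)) * (fps_const (2 / of_real pi) * ?Y) = (fps_exp (\<i> / 2) - fps_exp (- \<i> / 2)) * sech_fps 2" .
  moreover have "fps_exp (\<i> / 2) - fps_exp (- \<i> / 2) \<noteq> 0"
  proof
    assume "fps_exp (\<i> / 2) - fps_exp (- \<i> / 2) = 0"
    then have "(fps_exp (\<i> / 2) - fps_exp (- \<i> / 2)) $ 1 = 0" by simp
    then show False by simp
  qed
  ultimately have "fps_const (2 / of_real pi) * ?Y = sech_fps 2" by simp
  then have "(fps_const (2 / of_real pi) * ?Y) $ k = sech_fps 2 $ k" by simp
  then have "2 / of_real pi * ((- \<i>) ^ k * complex_of_real (?B $ k)) * fact k = of_real (sech_moment k 2)" by (simp add: sech_fps_def)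
  moreover have "\<i> powi (- int k) = (- \<i>) ^ k"
    by (simp add: power_int_minus power_inverse[symmetric])
  moreover have "higher_euler k 2 = 2 * \<i> powi (- int k) / of_real pi * of_real (bernoulli_poly k (1/2))"
    by (simp only: numeral_2_eq_2 higher_euler.simps)
  ultimately show ?thesis by (simp add: bernoulli_poly_def mult_ac)
qed

theorem higher_euler_eq_sech_moment:
  assumes "n \<ge> 1" shows "higher_euler k n = of_real (sech_moment k n)"
  using assms
proof (induction k n rule: higher_euler.induct)
  case (2 k)
  then show ?case using higher_euler_1[of k] by simp
next
  case (3 k)
  then show ?case using higher_euler_2[of k] by (simp only: numeral_2_eq_2)
next
  case (4 k j)
  have IH: "higher_euler k (Suc j) = of_real (sech_moment k (Suc j))"
    "\<not> k < 2 \<Longrightarrow> higher_euler (k - 2) (Suc j) = of_real (sech_moment (k - 2) (Suc j))"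
    using 4 by auto
  have "higher_euler k (Suc (Suc (Suc j))) = of_nat (Suc j) / of_nat (Suc j + 1) * higher_euler k (Suc j)
        - of_nat k * (of_nat k - 1) / (of_real pi ^ 2 * of_nat (Suc j) * of_nat (Suc j + 1)) *
          (if k < 2 then 0 else higher_euler (k - 2) (Suc j))"
    by (simp only: higher_euler.simps Let_def)
  also have "\<dots> = of_real (real (Suc j) / (real (Suc j) + 1) * sech_moment k (Suc j)
           - real k * (real k - 1) / (pi ^ 2 * real (Suc j) * (real (Suc j) + 1)) * (if k < 2 then 0 else sech_moment (k - 2) (Suc j)))"
    using IH by (cases "k < 2") (simp_all add: add_ac)
  also have "\<dots> = of_real (sech_moment k (Suc j + 2))"
    by (subst sech_moment_rec) (simp_all add: add_ac)
  finally show ?case by simp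
qed simp

section \<open>The trace as an integral of a theta quotient\<close>

definition gauss_theta :: "real \<Rightarrow> real \<Rightarrow> real" where
  "gauss_theta t x = (\<Sum>\<^sub>\<infinity>j::int. exp (- pi * (x - of_int j) ^ 2 / t))"

text \<open>
  Theta inversion at a real point. The series is real, so the product is real as well.
\<close>
lemma gauss_theta:
  assumes t: "t > 0"
  shows "((\<lambda>j::int. exp (- pi * (x - of_int j) ^ 2 / t)) has_sum gauss_theta t x) UNIV"
    and "complex_of_real (gauss_theta t x) = of_real (sqrt t * euler_prod (exp (- pi * t)))
           * (theta_half (exp (- pi * t)) (cis (2 * pi * x)) * theta_half (exp (- pi * t)) (inverse (cis (2 * pi * x))))"
proof -
  let ?S = "of_real (sqrt t) * (of_real (euler_prod (exp (- pi * t))) * theta_half (exp (- pi * t)) (exp (2 * pi * \<i> * of_real x))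
       * theta_half (exp (- pi * t)) (exp (- (2 * pi * \<i> * of_real x))))"
  have "((\<lambda>j::int. exp (- pi * (complex_of_real x - of_int j) ^ 2 / t)) has_sum ?S) UNIV"
    by (rule theta_inversion[OF t])
  moreover have "exp (- pi * (complex_of_real x - of_int j) ^ 2 / t) = complex_of_real (exp (- pi * (x - of_int j) ^ 2 / t))" for j :: int
    by (simp add: exp_of_real[symmetric])
  ultimately have 1: "((\<lambda>j::int. complex_of_real (exp (- pi * (x - of_int j) ^ 2 / t))) has_sum ?S) UNIV" by (simp only:)
  from has_sum_Re[OF this] have 2: "((\<lambda>j::int. exp (- pi * (x - of_int j) ^ 2 / t)) has_sum Re ?S) UNIV"
    by (simp only: Re_complex_of_real)
  have 3: "gauss_theta t x = Re ?S" unfolding gauss_theta_def by (rule infsumI[OF 2])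
  show "((\<lambda>j::int. exp (- pi * (x - of_int j) ^ 2 / t)) has_sum gauss_theta t x) UNIV" unfolding 3 by (rule 2)
  have e: "exp (2 * pi * \<i> * of_real x) = cis (2 * pi * x)" "exp (- (2 * pi * \<i> * of_real x)) = inverse (cis (2 * pi * x))"
    unfolding exp_minus by (simp_all add: cis_conv_exp mult_ac)
  have "of_real (Re ?S) = ?S" by (rule has_sum_unique[OF has_sum_of_real[OF 2] 1])
  then show "complex_of_real (gauss_theta t x) = of_real (sqrt t * euler_prod (exp (- pi * t)))
           * (theta_half (exp (- pi * t)) (cis (2 * pi * x)) * theta_half (exp (- pi * t)) (inverse (cis (2 * pi * x))))"
    unfolding 3 e by (simp only: of_real_mult mult.assoc)
qed

context
  fixes p :: real
  assumes p: "0 < p" "p < 1"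
begin

lemma theta_half_holomorphic: "theta_half p holomorphic_on A"
proof -
  have "theta_half p holomorphic_on ball 0 r" for r
    by (rule power_series_holomorphic[where a = "\<lambda>k. of_real (euler_coeff p k)"]) (use theta_half_sums[OF p] in simp)
  then have "theta_half p field_differentiable at z" for z
    using holomorphic_on_imp_differentiable_at[of "theta_half p" "ball 0 (norm z + 1)" z] by simp
  then show ?thesis by (simp add: holomorphic_on_def field_differentiable_at_within)
qed

lemma theta_half_nonzero:
  assumes "norm z < 1 / p" shows "theta_half p z \<noteq> 0"
  unfolding theta_half_def
proof (rule prodinf_nonzero[OF convergent_theta_half[OF p]])
  fix j
  have "p ^ (2 * j + 1) \<le> p ^ 1" using p by (intro power_decreasing) auto
  then have "norm z * p ^ (2 * j + 1) \<le> norm z * p" by (intro mult_left_mono) auto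
  also have "\<dots> < 1" using assms p by (simp add: field_simps)
  finally have *: "norm z * p ^ (2 * j + 1) < 1" .
  show "1 + z * complex_of_real (p ^ (2 * j + 1)) \<noteq> 0"
  proof
    assume "1 + z * complex_of_real (p ^ (2 * j + 1)) = 0"
    then have "z * complex_of_real (p ^ (2 * j + 1)) = - 1" by (simp add: eq_neg_iff_add_eq_0 add.commute)
    then have "norm (z * complex_of_real (p ^ (2 * j + 1))) = 1" by simp
    then show False using * p by (simp add: norm_mult norm_power)
  qed
qed

text \<open>
  Regrouping the factors separates the part holomorphic in \<open>\<bar>z\<bar> < 1 / p\<close> from the same function of \<open>1 / z\<close>.
\<close>
lemma kw_product_eq_theta_half:
  assumes q: "\<And>j. nome_pow \<tau> (real j + 1 / 2) = of_real (p ^ (2 * j + 1))"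
  shows "kw_product m n \<tau> z = (theta_half p z ^ m / theta_half p (- z) ^ n) * (theta_half p (inverse z) ^ m / theta_half p (- inverse z) ^ n)"
proof -
  let ?x = "\<lambda>j. complex_of_real (p ^ (2 * j + 1))"
  have E: "(\<lambda>j. 1 + w * ?x j) has_prod theta_half p w" for w
    unfolding theta_half_def using convergent_theta_half[OF p] by (rule convergent_prod_has_prod)
  have "(\<lambda>j. ((1 + z * ?x j) ^ m * (1 + inverse z * ?x j) ^ m) / ((1 + (- z) * ?x j) ^ n * (1 + (- inverse z) * ?x j) ^ n))
     has_prod ((theta_half p z ^ m * theta_half p (inverse z) ^ m) / (theta_half p (- z) ^ n * theta_half p (- inverse z) ^ n))"
    by (intro has_prod_divide has_prod_mult has_prod_power E)
  moreover have "1 + (- w) * ?x j = 1 - w * ?x j" for w j by simp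
  ultimately show ?thesis unfolding kw_product_def q
    using has_prod_unique by (simp only:) (simp add: has_prod_iff mult_ac)
qed

text \<open>
  Both factors have convergent power series, in \<open>z\<close> and in \<open>1 / z\<close>, because \<open>theta_half p (- z)\<close> has no zero
  in \<open>\<bar>z\<bar> < 1 / p\<close>.
\<close>
lemma kw_product_Laurent:
  assumes q: "\<And>j. nome_pow \<tau> (real j + 1 / 2) = of_real (p ^ (2 * j + 1))"
  shows "\<exists>c. \<forall>z. p < norm z \<and> norm z < 1 / p \<longrightarrow> ((\<lambda>l. c l * z powi l) has_sum kw_product m n \<tau> z) UNIV"
proof -
  define g where "g = (\<lambda>z. theta_half p z ^ m / theta_half p (- z) ^ n)"
  define a where "a = (\<lambda>k. (deriv ^^ k) g 0 / fact k)"
  have "g holomorphic_on ball 0 (1 / p)"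
  proof -
    have "(\<lambda>z. theta_half p (- z)) holomorphic_on ball 0 (1 / p)"
      using holomorphic_on_compose[of uminus "ball 0 (1 / p)" "theta_half p"] theta_half_holomorphic
      by (simp add: o_def holomorphic_intros)
    then show ?thesis unfolding g_def using theta_half_nonzero
      by (intro holomorphic_intros theta_half_holomorphic) auto
  qed
  then have sums: "(\<lambda>k. a k * z ^ k) sums g z" if "norm z < 1 / p" for z
    using holomorphic_power_series[of g 0 "1 / p" z] that by (simp add: a_def)
  have abs: "summable (\<lambda>k. norm (a k * z ^ k))" if w: "norm z < 1 / p" for z
  proof -
    obtain r where r: "norm z < r" "r < 1 / p" using dense[OF w] by blast
    then have "norm (complex_of_real r) = r" using norm_ge_zero[of z] by (simp del: norm_ge_zero)
    then show ?thesis using r sums_summable[OF sums[of "of_real r"]]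
      by (intro powser_insidea[of _ "of_real r"]) auto
  qed
  have "((\<lambda>l. laurent_conv a a l * z powi l) has_sum kw_product m n \<tau> z) UNIV" if "p < norm z" "norm z < 1 / p" for z
  proof -
    have z: "z \<noteq> 0" using that p by auto
    have z': "norm (inverse z) < 1 / p" unfolding norm_inverse using less_imp_inverse_less[OF that(1) p(1)] by (simp only: inverse_eq_divide)
    have "kw_product m n \<tau> z = g z * g (inverse z)" unfolding g_def kw_product_eq_theta_half[OF q] by simp
    then show ?thesis by (simp only:) (intro has_sum_laurent_conv z sums abs z' that(2))
  qed
  then show ?thesis by blast
qed

end

definition theta_ratio :: "nat \<Rightarrow> nat \<Rightarrow> real \<Rightarrow> real \<Rightarrow> real" where
  "theta_ratio m n t x = gauss_theta t x ^ m / gauss_theta t (x + 1 / 2) ^ n"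

text \<open>
  At \<open>z = cis (2 * pi * x)\<close> the numerator of the generating function is a power of
  \<open>gauss_theta t x / (sqrt t * P)\<close>, and the change of sign in the denominator is a shift of \<open>x\<close> by \<open>1/2\<close>.
\<close>
theorem tr_L_eq_integral:
  assumes t: "t > 0"
  defines "P \<equiv> euler_prod (exp (- pi * t))"
  shows "integrable period (\<lambda>x. of_real (theta_ratio m n t x) * cis (- 2 * pi * of_int l * x))"
    and "tr_L m n l (\<i> * of_real t) = of_real (P * ((sqrt t * P) ^ n / (sqrt t * P) ^ m)) *
      (\<integral>x. of_real (theta_ratio m n t x) * cis (- 2 * pi * of_int l * x) \<partial>period)"
proof -
  define p where "p = exp (- pi * t)"
  define G where "G = sqrt t * P"
  let ?\<tau> = "\<i> * of_real t"
  have p: "0 < p" "p < 1" using t by (auto simp: p_def)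
  have P: "P > 0" unfolding P_def using euler_prod_pos[OF p] by (simp add: p_def)
  have G: "G > 0" using P t by (simp add: G_def)
  have nome: "nome_pow ?\<tau> s = of_real (exp (2 * s * (- pi * t)))" for s
    unfolding nome_pow_def exp_of_real[symmetric] by (rule arg_cong[of _ _ exp]) (simp add: complex_eq_iff)
  have q: "nome_pow ?\<tau> (real j + 1 / 2) = of_real (p ^ (2 * j + 1))" for j
  proof -
    have "2 * (real j + 1 / 2) = real (2 * j + 1)" by simp
    then show ?thesis unfolding nome p_def exp_of_nat_mult[symmetric] by (simp only:)
  qed
  have q1: "nome_pow ?\<tau> 1 = of_real (p ^ 2)"
    unfolding nome p_def exp_of_nat_mult[symmetric] by simp
  have "norm (nome_pow ?\<tau> 1) = p powr 2" unfolding q1 using p by (simp add: norm_power powr_realpow)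
  then have r: "norm (nome_pow ?\<tau> 1) powr (1 / 2) = p" "norm (nome_pow ?\<tau> 1) powr (- 1 / 2) = 1 / p"
    using p by (simp_all add: powr_powr powr_minus_divide)
  obtain c where c: "\<And>z. p < norm z \<Longrightarrow> norm z < 1 / p \<Longrightarrow> ((\<lambda>l. c l * z powi l) has_sum kw_product m n ?\<tau> z) UNIV"
    using kw_product_Laurent[OF p q] by blast
  have p1: "1 < 1 / p" using p by simp
  have chF: "chF m n l ?\<tau> = fourier_coeff (\<lambda>x. kw_product m n ?\<tau> (cis (2 * pi * x))) l"
    unfolding chF_def r by (rule laurent_coeff_eqI[OF p(2) p1 c])
  have kw: "kw_product m n ?\<tau> (cis (2 * pi * x)) = of_real (G ^ n / G ^ m) * of_real (theta_ratio m n t x)" for x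
  proof -
    let ?z = "cis (2 * pi * x)"
    have g1: "theta_half p ?z * theta_half p (inverse ?z) = of_real (gauss_theta t x / G)"
    proof -
      have "of_real (gauss_theta t x) = of_real G * (theta_half p ?z * theta_half p (inverse ?z))"
        unfolding G_def P_def p_def by (rule gauss_theta(2)[OF t])
      then show ?thesis unfolding of_real_divide using G by simp
    qed
    have "cis (2 * pi * (x + 1 / 2)) = cis (2 * pi * x) * cis pi" unfolding cis_mult by (simp add: algebra_simps)
    then have z': "cis (2 * pi * (x + 1 / 2)) = - ?z" by simp
    have g2: "theta_half p (- ?z) * theta_half p (- inverse ?z) = of_real (gauss_theta t (x + 1 / 2) / G)"
    proof -
      have "of_real (gauss_theta t (x + 1 / 2)) = of_real G * (theta_half p (- ?z) * theta_half p (- inverse ?z))"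
        using gauss_theta(2)[OF t, of "x + 1 / 2"] unfolding z' inverse_minus_eq G_def P_def p_def .
      then show ?thesis unfolding of_real_divide using G by simp
    qed
    have "kw_product m n ?\<tau> ?z = (theta_half p ?z * theta_half p (inverse ?z)) ^ m / (theta_half p (- ?z) * theta_half p (- inverse ?z)) ^ n"
      unfolding kw_product_eq_theta_half[OF p q] by (simp add: power_mult_distrib)
    also have "\<dots> = of_real ((gauss_theta t x / G) ^ m / (gauss_theta t (x + 1 / 2) / G) ^ n)"
      unfolding g1 g2 by simp
    also have "(gauss_theta t x / G) ^ m / (gauss_theta t (x + 1 / 2) / G) ^ n = (G ^ n / G ^ m) * theta_ratio m n t x"
      by (simp add: theta_ratio_def power_divide)
    finally show ?thesis by (simp only: of_real_mult)
  qed
  have cc: "((\<lambda>l. c l * z powi l) has_sum kw_product m n ?\<tau> z) UNIV" if "norm z = 1" for z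
    using c[of z] that p p1 by simp
  have eq: "kw_product m n ?\<tau> (cis (2 * pi * x)) * cis (- 2 * pi * of_int l * x) = of_real (G ^ n / G ^ m) * (of_real (theta_ratio m n t x) * cis (- 2 * pi * of_int l * x))" for x
    unfolding kw by (simp only: mult.assoc)
  have int: "integrable period (\<lambda>x. of_real (G ^ n / G ^ m) * (of_real (theta_ratio m n t x) * cis (- 2 * pi * of_int l * x)))"
    unfolding eq[symmetric] by (rule fourier_coeff_Laurent(1)[OF cc])
  have nz: "complex_of_real (G ^ n / G ^ m) \<noteq> 0" using G by simp
  show "integrable period (\<lambda>x. of_real (theta_ratio m n t x) * cis (- 2 * pi * of_int l * x))"
  proof -
    have "inverse (complex_of_real (G ^ n / G ^ m)) * (of_real (G ^ n / G ^ m) * y) = y" for y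
      by (simp only: mult.assoc[symmetric] left_inverse[OF nz] mult_1_left)
    then show ?thesis using integrable_mult_right[OF int, of "inverse (of_real (G ^ n / G ^ m))"] by (simp only:)
  qed
  have prod: "(\<Prod>j. 1 - nome_pow ?\<tau> 1 ^ Suc j) = of_real P"
  proof -
    have "(\<lambda>j. complex_of_real (1 - p ^ (2 * j + 2))) has_prod of_real P"
      unfolding has_prod_of_real_iff P_def euler_prod_def p_def[symmetric]
      using convergent_euler_prod[OF p] by (rule convergent_prod_has_prod)
    moreover have "complex_of_real (1 - p ^ (2 * j + 2)) = 1 - nome_pow ?\<tau> 1 ^ Suc j" for j
    proof -
      have "p ^ (2 * j + 2) = (p ^ 2) ^ Suc j" unfolding power_mult[symmetric] by (rule arg_cong[of _ _ "\<lambda>n. p ^ n"]) simp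
      then show ?thesis unfolding q1 by (simp only: of_real_diff of_real_1 of_real_power)
    qed
    ultimately show ?thesis using has_prod_unique by (simp only: has_prod_iff)
  qed
  show "tr_L m n l ?\<tau> = of_real (P * ((sqrt t * P) ^ n / (sqrt t * P) ^ m)) *
      (\<integral>x. of_real (theta_ratio m n t x) * cis (- 2 * pi * of_int l * x) \<partial>period)"
    unfolding tr_L_def chF prod fourier_coeff_def eq integral_mult_right_zero G_def[symmetric]
    by (simp add: mult_ac)
qed

section \<open>The theta quotient on one period\<close>

text \<open>
  For \<open>j \<noteq> 0\<close> the point \<open>x\<close> has distance at least \<open>\<bar>j\<bar> - 1/2\<close> from \<open>j\<close>. The error bound is absolute; relative to
  the main term it is not small at \<open>\<bar>x\<bar> = 1/2\<close>.
\<close>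
lemma gauss_theta_near_0:
  assumes t: "0 < t" "t \<le> 1" and x: "\<bar>x\<bar> \<le> 1 / 2"
  shows "exp (- pi * x ^ 2 / t) \<le> gauss_theta t x"
    and "gauss_theta t x - exp (- pi * x ^ 2 / t) \<le> exp 1 * exp_abs_sum * exp (- pi / (4 * t))"
proof -
  define s where "s = pi / t"
  have "1 * t \<le> pi" using t pi_gt3 by linarith
  then have s: "s \<ge> 1" using t by (simp add: s_def field_simps)
  have e: "- pi * y / t = - s * y" for y by (simp add: s_def)
  note hs = gauss_theta(1)[OF t(1), of x, unfolded e]
  show "exp (- pi * x ^ 2 / t) \<le> gauss_theta t x"
    unfolding e using finite_sum_le_has_sum[OF hs, of "{0}"] by simp
  have "norm (gauss_theta t x - (\<Sum>j\<in>{0::int}. exp (- s * (x - of_int j) ^ 2))) \<le> exp (1 - s / 4) * exp_abs_sum"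
  proof (rule has_sum_tail_bound[OF hs])
    fix j :: int assume "j \<notin> {0}"
    define a where "a = real_of_int \<bar>j\<bar>"
    have "1 \<le> \<bar>j\<bar>" using \<open>j \<notin> {0}\<close> by auto
    then have a: "a \<ge> 1" unfolding a_def by simp
    have "0 \<le> (a - 1) * (a - 1)" by simp
    then have a2: "a ^ 2 - a \<ge> a - 1" by (simp add: power2_eq_square algebra_simps)
    have "a - 1/2 \<le> \<bar>x - of_int j\<bar>" using x unfolding a_def by simp
    then have "(a - 1/2) ^ 2 \<le> \<bar>x - of_int j\<bar> ^ 2" using a by (intro power_mono) auto
    then have "a ^ 2 - a + 1/4 \<le> (x - of_int j) ^ 2" by (simp add: power2_eq_square algebra_simps)
    then have "s * (a ^ 2 - a + 1/4) \<le> s * (x - of_int j) ^ 2" using s by (intro mult_left_mono) auto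
    moreover have "1 * (a - 1) \<le> s * (a ^ 2 - a)" using s a a2 by (intro mult_mono) auto
    ultimately have "- s * (x - of_int j) ^ 2 \<le> (1 - s / 4) + - a" by (simp add: algebra_simps)
    then have "exp (- s * (x - of_int j) ^ 2) \<le> exp (1 - s / 4) * exp (- a)" unfolding exp_add[symmetric] by (simp only: exp_le_cancel_iff)
    then show "norm (exp (- s * (x - of_int j) ^ 2)) \<le> exp (1 - s / 4) * exp (- \<bar>of_int j\<bar>)" by (simp add: a_def)
  qed auto
  moreover have "exp (1 - s / 4) = exp 1 * exp (- pi / (4 * t))" unfolding exp_add[symmetric] by (simp add: s_def)
  ultimately show "gauss_theta t x - exp (- pi * x ^ 2 / t) \<le> exp 1 * exp_abs_sum * exp (- pi / (4 * t))"
    unfolding e by (simp add: mult_ac)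
qed

text \<open>
  After normalisation the summands are \<open>exp (- s * (j\<^sup>2 - j) - s * x * (1 - 2 * j))\<close> with \<open>s = pi / t\<close>; those for
  \<open>j = 0\<close> and \<open>j = 1\<close> add up to \<open>2 * c\<close>. For the other ones \<open>\<bar>x\<bar> \<le> 1/2\<close> leaves, relative to \<open>exp (s * \<bar>x\<bar>)\<close>,
  an exponent \<open>- s * D\<close> with \<open>D\<close> at least \<open>1\<close> and at least \<open>\<bar>j\<bar> - 1\<close>, so this error is relatively small on
  the whole period.
\<close>
lemma gauss_theta_near_half:
  fixes t x :: real
  assumes t: "0 < t" "t \<le> 1" and x: "\<bar>x\<bar> \<le> 1 / 2"
  defines "V \<equiv> exp (pi / (4 * t) + pi * x ^ 2 / t) * gauss_theta t (x + 1 / 2)"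
    and "c \<equiv> cosh (pi * x / t)"
  shows "2 * c \<le> V" and "V - 2 * c \<le> 2 * c * (exp 2 * exp_abs_sum * exp (- pi / (4 * t)))"
proof -
  define s where "s = pi / t"
  have "1 * t \<le> pi" using t pi_gt3 by linarith
  then have s: "s \<ge> 1" using t by (simp add: s_def field_simps)
  let ?v = "\<lambda>j::int. exp (- s * real_of_int (j ^ 2 - j) - s * x * real_of_int (1 - 2 * j))"
  have "((\<lambda>j::int. exp (pi / (4 * t) + pi * x ^ 2 / t) * exp (- pi * (x + 1 / 2 - of_int j) ^ 2 / t)) has_sum V) UNIV"
    unfolding V_def by (intro has_sum_cmult_right gauss_theta(1) t(1))
  moreover have "exp (pi / (4 * t) + pi * x ^ 2 / t) * exp (- pi * (x + 1 / 2 - of_int j) ^ 2 / t) = ?v j" for j :: int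
    unfolding exp_add[symmetric] s_def
    by (rule arg_cong[of _ _ exp]) (use t in \<open>simp add: field_simps power2_eq_square\<close>)
  ultimately have hs: "(?v has_sum V) UNIV" by (simp only:)
  have sum01: "(\<Sum>j\<in>{0, 1::int}. ?v j) = 2 * c" unfolding c_def cosh_def by (simp add: s_def)
  show "2 * c \<le> V" using finite_sum_le_has_sum[OF hs, of "{0, 1}"] unfolding sum01 by simp
  have "norm (V - (\<Sum>j\<in>{0, 1::int}. ?v j)) \<le> exp (s * \<bar>x\<bar> + 2 - s) * exp_abs_sum"
  proof (rule has_sum_tail_bound[OF hs])
    fix j :: int assume "j \<notin> {0, 1}"
    then have j: "j \<ge> 2 \<or> j \<le> - 1" by auto
    define a where "a = real_of_int \<bar>j\<bar>"
    define b where "b = real_of_int \<bar>1 - 2 * j\<bar>"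
    define D where "D = real_of_int (j ^ 2 - j) - (b - 1) / 2"
    have b: "b \<ge> 1" using j by (auto simp: b_def)
    have D: "D \<ge> 1" "D \<ge> a - 1"
    proof -
      have "D \<ge> 1 \<and> D \<ge> a - 1" using j
      proof
        assume "j \<ge> 2"
        then have "D = (real_of_int j - 1) ^ 2" "a = j" by (simp_all add: D_def b_def a_def power2_eq_square field_simps)
        moreover have "(real_of_int j - 1) * 1 \<le> (real_of_int j - 1) * (real_of_int j - 1)" using \<open>j \<ge> 2\<close> by (intro mult_left_mono) auto
        moreover have "1 \<le> real_of_int j - 1" using \<open>j \<ge> 2\<close> by linarith
        ultimately have "1 \<le> real_of_int j - 1" "real_of_int j - 1 \<le> D" "a - 1 = real_of_int j - 1"
          by (simp_all only: power2_eq_square mult_1_right)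
        then show ?thesis by linarith
      next
        assume j1: "j \<le> - 1"
        then have "D = (real_of_int j) ^ 2" "a = - j" by (simp_all add: D_def b_def a_def power2_eq_square field_simps)
        moreover have "(- real_of_int j) * 1 \<le> (- real_of_int j) * (- real_of_int j)" using j1 by (intro mult_left_mono) auto
        ultimately show ?thesis using j1 by (simp add: power2_eq_square)
      qed
      then show "D \<ge> 1" "D \<ge> a - 1" by auto
    qed
    have "- (x * real_of_int (1 - 2 * j)) \<le> \<bar>x\<bar> * b" unfolding b_def of_int_abs abs_mult[symmetric] by simp
    also have "\<dots> = \<bar>x\<bar> + \<bar>x\<bar> * (b - 1)" by (simp add: algebra_simps)
    also have "\<bar>x\<bar> * (b - 1) \<le> 1 / 2 * (b - 1)" using x b by (intro mult_right_mono) auto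
    finally have "- real_of_int (j ^ 2 - j) - x * real_of_int (1 - 2 * j) \<le> \<bar>x\<bar> - D" unfolding D_def by simp
    then have "s * (- real_of_int (j ^ 2 - j) - x * real_of_int (1 - 2 * j)) \<le> s * (\<bar>x\<bar> - D)" using s by (intro mult_left_mono) auto
    moreover have "(s - 1) * 1 \<le> (s - 1) * D" using s D by (intro mult_left_mono) auto
    ultimately have "- s * real_of_int (j ^ 2 - j) - s * x * real_of_int (1 - 2 * j) \<le> (s * \<bar>x\<bar> + 2 - s) + - a"
      using D by (simp add: algebra_simps)
    then have "?v j \<le> exp (s * \<bar>x\<bar> + 2 - s) * exp (- a)" unfolding exp_add[symmetric] by (simp only: exp_le_cancel_iff)
    then show "norm (?v j) \<le> exp (s * \<bar>x\<bar> + 2 - s) * exp (- \<bar>of_int j\<bar>)" by (simp add: a_def)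
  qed auto
  then have "V - 2 * c \<le> exp (s * \<bar>x\<bar> + 2 - s) * exp_abs_sum" unfolding sum01 by simp
  also have "exp (s * \<bar>x\<bar> + 2 - s) = exp (s * \<bar>x\<bar>) * (exp 2 * exp (- s))" unfolding exp_add[symmetric] by simp
  also have "exp (s * \<bar>x\<bar>) * (exp 2 * exp (- s)) * exp_abs_sum \<le> (2 * c) * (exp 2 * exp (- pi / (4 * t))) * exp_abs_sum"
  proof (intro mult_right_mono mult_mono exp_abs_sum_nonneg order_refl)
    have "exp (s * \<bar>x\<bar>) \<le> exp (s * x) + exp (- (s * x))" by (cases "x \<ge> 0") auto
    then show "exp (s * \<bar>x\<bar>) \<le> 2 * c" by (simp add: c_def cosh_def s_def)
    show "exp (- s) \<le> exp (- pi / (4 * t))" using t by (simp add: s_def field_simps)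
  qed (auto simp: c_def)
  finally show "V - 2 * c \<le> 2 * c * (exp 2 * exp_abs_sum * exp (- pi / (4 * t)))" by (simp only: mult_ac)
qed

lemma power_diff_le:
  fixes a b :: real
  assumes "0 \<le> b" "b \<le> a" "a \<le> 1"
  shows "a ^ n - b ^ n \<le> n * (a - b)"
  using norm_power_diff[of a b n] assms by (auto simp: abs_le_iff)

text \<open>
  The numerator may have a large relative error \<open>th / X - 1\<close> (bounded by \<open>a\<close> only), but one factor \<open>X\<close>
  remains since \<open>m > n\<close>, and it turns this error into the absolute error \<open>th - X\<close>. The denominator has a
  small relative error.
\<close>
lemma theta_ratio_perturbation:
  fixes X th V c :: real
  assumes X: "0 < X" "X \<le> 1" and th: "X \<le> th" "th - X \<le> \<eta>" "th - X \<le> a * X" and a: "a \<ge> 0"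
    and c: "c \<ge> 1" and V: "2 * c \<le> V" "V - 2 * c \<le> 2 * c * e" and mn: "m > n"
  shows "\<bar>2 ^ n * th ^ m / (V ^ n * X ^ n) - X ^ (m - n) / c ^ n\<bar> \<le> m * (1 + a) ^ m * \<eta> + n * e"
proof -
  define r where "r = th / X"
  define u where "u = 2 / V"
  define w where "w = 1 / c"
  have r: "1 \<le> r" "r \<le> 1 + a" using X th by (auto simp: r_def field_simps)
  have V0: "V > 0" using V c by linarith
  have uw: "0 < u" "u \<le> w" "w \<le> 1" using V c V0 by (auto simp: u_def w_def field_simps)
  have e1: "2 ^ n * th ^ m / (V ^ n * X ^ n) = X ^ (m - n) * (r ^ m * u ^ n)"
  proof -
    have "X ^ m = X ^ (m - n) * X ^ n" using mn by (simp add: power_add[symmetric])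
    then show ?thesis using X by (simp add: r_def u_def power_divide mult.commute)
  qed
  have e2: "X ^ (m - n) / c ^ n = X ^ (m - n) * w ^ n" by (simp add: w_def power_divide)
  have u1: "u ^ n \<le> 1" using uw by (intro power_le_one) auto
  have uwn: "u ^ n \<le> w ^ n" using uw by (intro power_mono) auto
  have r1: "1 \<le> r ^ m" using r by (simp add: one_le_power)
  (* dividing by 1 + a brings r and 1 into the unit interval, where power_diff_le applies *)
  have rm: "r ^ m - 1 \<le> (1 + a) ^ m * (m * (r - 1))"
  proof -
    have "(r / (1 + a)) ^ m - (1 / (1 + a)) ^ m \<le> m * (r / (1 + a) - 1 / (1 + a))"
      by (rule power_diff_le) (use r a in \<open>auto simp: divide_right_mono\<close>)
    also have "r / (1 + a) - 1 / (1 + a) = (r - 1) / (1 + a)" by (simp add: diff_divide_distrib)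
    also have "m * ((r - 1) / (1 + a)) \<le> m * ((r - 1) / 1)" using r a by (intro mult_left_mono divide_left_mono) auto
    finally have "(1 + a) ^ m * ((r / (1 + a)) ^ m - (1 / (1 + a)) ^ m) \<le> (1 + a) ^ m * (m * (r - 1))"
      using a by (intro mult_left_mono) auto
    moreover have "(1 + a) ^ m * ((r / (1 + a)) ^ m - (1 / (1 + a)) ^ m) = r ^ m - 1"
      using a by (simp add: power_divide right_diff_distrib)
    ultimately show ?thesis by simp
  qed
  have Xd: "X ^ (m - n) \<le> X" using X mn power_decreasing[of 1 "m - n" X] by simp
  have Xd0: "0 \<le> X ^ (m - n)" using X by simp
  have "\<bar>X ^ (m - n) * (r ^ m * u ^ n) - X ^ (m - n) * w ^ n\<bar> = X ^ (m - n) * \<bar>(r ^ m - 1) * u ^ n - (w ^ n - u ^ n)\<bar>"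
    using Xd0 by (simp add: abs_mult right_diff_distrib[symmetric] left_diff_distrib)
  also have "\<dots> \<le> X ^ (m - n) * ((r ^ m - 1) * 1 + (w ^ n - u ^ n))"
  proof (rule mult_left_mono[OF _ Xd0])
    have "(r ^ m - 1) * u ^ n \<le> (r ^ m - 1) * 1" using u1 r1 by (intro mult_left_mono) auto
    moreover have "0 \<le> (r ^ m - 1) * u ^ n" using r1 uw by simp
    ultimately show "\<bar>(r ^ m - 1) * u ^ n - (w ^ n - u ^ n)\<bar> \<le> (r ^ m - 1) * 1 + (w ^ n - u ^ n)" using uwn by linarith
  qed
  also have "\<dots> = X ^ (m - n) * (r ^ m - 1) + X ^ (m - n) * (w ^ n - u ^ n)" by (simp add: algebra_simps)
  also have "X ^ (m - n) * (r ^ m - 1) \<le> X * ((1 + a) ^ m * (m * (r - 1)))"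
    using Xd r1 rm X by (intro mult_mono) auto
  also have "\<dots> = m * (1 + a) ^ m * (th - X)"
  proof -
    have "X * (r - 1) = th - X" using X by (simp add: r_def field_simps)
    then have "m * (1 + a) ^ m * (X * (r - 1)) = m * (1 + a) ^ m * (th - X)" by (simp only:)
    then show ?thesis by (simp only: mult_ac)
  qed
  also have "\<dots> \<le> m * (1 + a) ^ m * \<eta>" using th a by (intro mult_left_mono) auto
  also have "X ^ (m - n) * (w ^ n - u ^ n) \<le> 1 * (n * e)"
  proof (rule mult_mono)
    (* the last two factors are at most 1 because c >= 1 and V >= 2 * c *)
    have "w - u = (V - 2 * c) / (2 * c) * (1 / c) * ((2 * c) / V)" using c V0 by (simp add: w_def u_def field_simps)
    also have "\<dots> \<le> e * 1 * 1"
    proof (intro mult_mono)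
      show "(V - 2 * c) / (2 * c) \<le> e" using V c by (simp add: field_simps)
      then show "0 \<le> e" "0 \<le> e * 1" using V c by (smt (verit) divide_nonneg_nonneg)+
    qed (use c V V0 in auto)
    finally have "w - u \<le> e" by simp
    then have "n * (w - u) \<le> n * e" by (intro mult_left_mono) auto
    with power_diff_le[of u w n] uw show "w ^ n - u ^ n \<le> n * e" by simp
  qed (use X uwn in \<open>auto intro: power_le_one\<close>)
  finally show ?thesis unfolding e1 e2 by simp
qed

text \<open>
  The bound of \<open>theta_ratio_perturbation\<close> with the constants of the two preceding theta estimates; it is
  independent of \<open>t\<close> and \<open>x\<close>.
\<close>
definition theta_ratio_const :: "nat \<Rightarrow> nat \<Rightarrow> real" where
  "theta_ratio_const m n = m * (1 + exp 1 * exp_abs_sum) ^ m * (exp 1 * exp_abs_sum) + n * (exp 2 * exp_abs_sum)"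

theorem theta_ratio_approx:
  assumes t: "0 < t" "t \<le> 1" and x: "\<bar>x\<bar> \<le> 1 / 2" and mn: "m > n"
  shows "\<bar>2 ^ n * exp (- pi * n / (4 * t)) * theta_ratio m n t x - exp (- pi * real (m - n) * x ^ 2 / t) / cosh (pi * x / t) ^ n\<bar>
    \<le> theta_ratio_const m n * exp (- pi / (4 * t))"
proof -
  define X where "X = exp (- pi * x ^ 2 / t)"
  define c where "c = cosh (pi * x / t)"
  define V where "V = exp (pi / (4 * t) + pi * x ^ 2 / t) * gauss_theta t (x + 1 / 2)"
  let ?S = "exp_abs_sum" and ?E = "exp (- pi / (4 * t))"
  note G1 = gauss_theta_near_0[OF t x, folded X_def]
  note G2 = gauss_theta_near_half[OF t x, folded V_def c_def]
  have X: "0 < X" "X \<le> 1" using t by (auto simp: X_def)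
  have "x ^ 2 \<le> 1 / 4"
  proof -
    have "\<bar>x\<bar> ^ 2 \<le> (1 / 2) ^ 2" using x by (intro power_mono) auto
    then show ?thesis by (simp add: power2_eq_square)
  qed
  then have "pi * x ^ 2 / t \<le> pi * (1 / 4) / t" using t by (intro divide_right_mono mult_left_mono) auto
  then have EX: "?E \<le> X" unfolding X_def by simp
  have aX: "gauss_theta t x - X \<le> (exp 1 * ?S) * X"
    by (rule order_trans[OF G1(2)]) (intro mult_left_mono EX, simp add: exp_abs_sum_nonneg)
  have "\<bar>2 ^ n * gauss_theta t x ^ m / (V ^ n * X ^ n) - X ^ (m - n) / c ^ n\<bar>
      \<le> m * (1 + exp 1 * ?S) ^ m * (exp 1 * ?S * ?E) + n * (exp 2 * ?S * ?E)"
    by (rule theta_ratio_perturbation[OF X G1 aX _ _ G2 mn]) (auto simp: exp_abs_sum_nonneg c_def cosh_real_ge_1)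
  also have "\<dots> = theta_ratio_const m n * ?E" unfolding theta_ratio_const_def by (simp add: algebra_simps)
  also have "X ^ (m - n) = exp (- pi * real (m - n) * x ^ 2 / t)"
    unfolding X_def exp_of_nat_mult[symmetric] by (simp add: mult_ac)
  also have "2 ^ n * gauss_theta t x ^ m / (V ^ n * X ^ n) = 2 ^ n * exp (- pi * n / (4 * t)) * theta_ratio m n t x"
  proof -
    have "V * X = exp (pi / (4 * t)) * gauss_theta t (x + 1 / 2)"
      unfolding V_def X_def exp_add by (simp add: exp_minus)
    then have "V ^ n * X ^ n = exp (pi / (4 * t)) ^ n * gauss_theta t (x + 1 / 2) ^ n"
      by (simp only: power_mult_distrib[symmetric])
    also have "exp (pi / (4 * t)) ^ n = 1 / exp (- pi * n / (4 * t))"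
      unfolding exp_of_nat_mult[symmetric] by (simp add: exp_minus field_simps)
    finally show ?thesis unfolding theta_ratio_def by simp
  qed
  finally show ?thesis unfolding c_def .
qed

section \<open>Expansion of the phase integral\<close>

text \<open>
  In the left half-plane all derivatives of the exponential are bounded by \<open>1\<close>, so the remainder has no
  exponential factor.
\<close>
lemma norm_exp_minus_Taylor_le:
  fixes y :: complex
  assumes "Re y \<le> 0"
  shows "norm (exp y - (\<Sum>r\<le>N. y ^ r / fact r)) \<le> norm y ^ Suc N / fact N"
proof -
  have "norm (exp y - (\<Sum>i\<le>N. exp 0 * (y - 0) ^ i / fact i)) \<le> 1 * norm (y - 0) ^ Suc N / fact N"
  proof (rule complex_Taylor[where S = "{z. Re z \<le> 0}" and f = "\<lambda>i. exp"])
    show "convex {z. Re z \<le> 0}" by (rule convex_halfspace_Re_le)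
    show "(exp has_field_derivative exp x) (at x within {z. Re z \<le> 0})" for x :: complex
      by (rule has_field_derivative_at_within[OF DERIV_exp])
  qed (use assms in auto)
  then show ?thesis by simp
qed

lemma exp_minus_inverse_le_power:
  fixes c t :: real
  assumes "c > 0" "t > 0"
  shows "exp (- c / t) \<le> fact k / c ^ k * t ^ k"
proof -
  define x where "x = c / t"
  have x: "x > 0" using assms by (simp add: x_def)
  have "x ^ k / fact k \<le> exp x"
    using sum_le_suminf[OF summable_exp[of x], of "{k}"] x by (simp add: exp_def divide_inverse mult.commute)
  then have "inverse (exp x) \<le> inverse (x ^ k / fact k)" using x by (intro le_imp_inverse_le) auto
  also have "inverse (x ^ k / fact k) = fact k / c ^ k * t ^ k" using assms by (simp add: x_def power_divide)
  finally show ?thesis by (simp add: x_def exp_minus)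
qed

text \<open>
  The exponent after the substitution \<open>x = t * u\<close>: the Gaussian from the theta quotient and the Fourier
  mode.
\<close>
definition quad_phase :: "nat \<Rightarrow> int \<Rightarrow> real \<Rightarrow> real \<Rightarrow> complex" where
  "quad_phase d l t u = - of_real (pi * t) * (of_nat d * of_real u ^ 2 + 2 * \<i> * of_int l * of_real u)"

definition phase_integral :: "nat \<Rightarrow> nat \<Rightarrow> int \<Rightarrow> real \<Rightarrow> complex" where
  "phase_integral n d l t = (\<integral>u. exp (quad_phase d l t u) / of_real (cosh (pi * u) ^ n) \<partial>lborel)"

lemma Re_quad_phase: "t > 0 \<Longrightarrow> Re (quad_phase d l t u) \<le> 0"
  unfolding quad_phase_def by (simp add: power2_eq_square)

lemma norm_quad_phase_le:
  assumes "t > 0"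
  shows "norm (quad_phase d l t u) \<le> pi * t * (real d + 2 * \<bar>real_of_int l\<bar>) * (1 + u ^ 2)"
proof -
  let ?w = "of_nat d * of_real u ^ 2 + 2 * \<i> * of_int l * of_real u :: complex"
  have "0 \<le> (\<bar>u\<bar> - 1) ^ 2" "0 \<le> u ^ 2" by auto
  moreover have "(\<bar>u\<bar> - 1) ^ 2 = u ^ 2 - 2 * \<bar>u\<bar> + 1" by (simp add: power2_eq_square algebra_simps)
  ultimately have u: "\<bar>u\<bar> \<le> 1 + u ^ 2" by linarith
  have "norm ?w \<le> real d * u ^ 2 + 2 * \<bar>real_of_int l\<bar> * \<bar>u\<bar>"
    by (rule norm_triangle_le) (simp add: norm_mult norm_power)
  also have "\<dots> \<le> real d * (1 + u ^ 2) + 2 * \<bar>real_of_int l\<bar> * (1 + u ^ 2)"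
    using u by (intro add_mono mult_left_mono) auto
  also have "\<dots> = (real d + 2 * \<bar>real_of_int l\<bar>) * (1 + u ^ 2)" by (simp add: algebra_simps)
  finally have "pi * t * norm ?w \<le> pi * t * ((real d + 2 * \<bar>real_of_int l\<bar>) * (1 + u ^ 2))"
    using assms by (intro mult_left_mono) auto
  moreover have "norm (quad_phase d l t u) = pi * t * norm ?w"
    unfolding quad_phase_def norm_mult norm_minus_cancel norm_of_real using assms by simp
  ultimately show ?thesis by (simp only: mult.assoc)
qed

lemma integrable_phase:
  assumes "n \<ge> 1" "t > 0"
  shows "integrable lborel (\<lambda>u. exp (quad_phase d l t u) / of_real (cosh (pi * u) ^ n))"
proof (rule Bochner_Integration.integrable_bound)
  show "integrable lborel (\<lambda>u. u ^ 0 / cosh (pi * u) ^ n)" by (rule integrable_sech_moment[OF assms(1)])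
  show "(\<lambda>u. exp (quad_phase d l t u) / of_real (cosh (pi * u) ^ n)) \<in> borel_measurable lborel"
    unfolding quad_phase_def measurable_lborel2
    by (intro borel_measurable_continuous_onI continuous_intros) auto
  have "norm (exp (quad_phase d l t u)) \<le> 1" for u using Re_quad_phase[OF assms(2), of d l u] by simp
  then show "AE u in lborel. norm (exp (quad_phase d l t u) / of_real (cosh (pi * u) ^ n)) \<le> norm (u ^ 0 / cosh (pi * u) ^ n)"
    by (intro AE_I2) (simp add: norm_divide norm_power divide_right_mono del: norm_exp_eq_Re)
qed

lemma integrable_one_plus_square_sech:
  assumes "n \<ge> 1"
  shows "integrable lborel (\<lambda>u. (1 + u ^ 2) ^ k / cosh (pi * u) ^ n)"
proof -
  have "(1 + u ^ 2) ^ k / cosh (pi * u) ^ n = (\<Sum>j\<le>k. of_nat (k choose j) * (u ^ (2 * (k - j)) / cosh (pi * u) ^ n))" for u :: real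
    unfolding binomial_ring by (simp add: sum_divide_distrib power_mult)
  then show ?thesis
    by (simp only:) (intro Bochner_Integration.integrable_sum integrable_mult_right integrable_sech_moment assms)
qed

text \<open>
  The binomial theorem for \<open>((m - n) * u\<^sup>2 + 2 * \<i> * l * u) ^ r\<close> gives powers \<open>u ^ (k + r)\<close>, whose moments are the
  numbers in \<open>asym_coeff\<close>.
\<close>
lemma has_integral_phase_power:
  assumes n: "n \<ge> 1" and mn: "m > n"
  shows "has_bochner_integral lborel (\<lambda>u. quad_phase (m - n) l t u ^ r / fact r / of_real (cosh (pi * u) ^ n))
           (asym_coeff m n l r * of_real (t ^ r / fact r))"
proof -
  have b: "has_bochner_integral lborel (\<lambda>u. complex_of_real (u ^ j / cosh (pi * u) ^ n)) (higher_euler j n)" for j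
    unfolding higher_euler_eq_sech_moment[OF n] sech_moment_def
    using integrable_sech_moment[OF n, of j] by (intro has_bochner_integral_of_real) (simp add: has_bochner_integral_iff)
  have d: "of_nat (m - n) = (of_nat m - of_nat n :: complex)" using mn by (simp add: of_nat_diff)
  let ?a = "\<lambda>k. of_nat (r choose k) * (of_nat m - of_nat n) ^ k * (2 * \<i> * of_int l) ^ (r - k)"
  let ?C = "(- of_real pi) ^ r * complex_of_real (t ^ r / fact r)"
  have "has_bochner_integral lborel (\<lambda>u. ?C * (\<Sum>k=0..r. ?a k * complex_of_real (u ^ (k + r) / cosh (pi * u) ^ n)))
     (?C * (\<Sum>k=0..r. ?a k * higher_euler (k + r) n))"
    by (intro has_bochner_integral_mult_right has_bochner_integral_sum b)
  moreover have "?C * (\<Sum>k=0..r. ?a k * complex_of_real (u ^ (k + r) / cosh (pi * u) ^ n))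
      = quad_phase (m - n) l t u ^ r / fact r / of_real (cosh (pi * u) ^ n)" for u
  proof -
    have "(of_nat (m - n) * of_real u ^ 2 + 2 * \<i> * of_int l * complex_of_real u) ^ r =
      (\<Sum>k=0..r. ?a k * complex_of_real (u ^ (k + r)))"
      unfolding binomial_ring d atMost_atLeast0
    proof (intro sum.cong refl)
      fix k assume "k \<in> {0..r}"
      then have "k + r = 2 * k + (r - k)" by simp
      then have "complex_of_real (u ^ (k + r)) = (of_real u ^ 2) ^ k * of_real u ^ (r - k)"
        by (simp only: power_add power_mult of_real_mult of_real_power)
      then show "of_nat (r choose k) * ((of_nat m - of_nat n) * of_real u ^ 2) ^ k * (2 * \<i> * of_int l * complex_of_real u) ^ (r - k) =
        ?a k * complex_of_real (u ^ (k + r))"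
        by (simp only: power_mult_distrib mult_ac)
    qed
    then have "quad_phase (m - n) l t u ^ r = (- of_real (pi * t)) ^ r *
      (\<Sum>k=0..r. ?a k * complex_of_real (u ^ (k + r)))"
      unfolding quad_phase_def power_mult_distrib by (simp only:)
    moreover have "(- of_real (pi * t)) ^ r = (- of_real pi) ^ r * complex_of_real t ^ r"
      unfolding power_mult_distrib[symmetric] by simp
    ultimately show ?thesis
      by (simp add: sum_divide_distrib[symmetric] mult_ac)
  qed
  ultimately show ?thesis unfolding asym_coeff_def by (simp only: mult_ac)
qed

text \<open>
  Each power of the exponent carries one factor \<open>t\<close>, and the polynomials in \<open>u\<close> left over are integrable
  against \<open>1 / cosh (pi * u) ^ n\<close>. The bound is uniform in \<open>t\<close>.
\<close>
lemma phase_integral_expansion: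
  assumes n: "n \<ge> 1" and mn: "m > n"
  obtains C where "\<And>t. t > 0 \<Longrightarrow> norm (phase_integral n (m - n) l t - (\<Sum>r\<le>N. asym_coeff m n l r * of_real (t ^ r / fact r))) \<le> C * t ^ Suc N"
proof
  define b where "b = pi * (real (m - n) + 2 * \<bar>real_of_int l\<bar>)"
  fix t :: real assume t: "t > 0"
  let ?y = "quad_phase (m - n) l t" and ?c = "\<lambda>u. complex_of_real (cosh (pi * u) ^ n)"
  let ?d = "\<lambda>u. exp (?y u) / ?c u - (\<Sum>r\<le>N. ?y u ^ r / fact r / ?c u)"
  let ?g = "\<lambda>u. ((b * t) ^ Suc N / fact N) * ((1 + u ^ 2) ^ Suc N / cosh (pi * u) ^ n)"
  have p: "has_bochner_integral lborel (\<lambda>u. \<Sum>r\<le>N. ?y u ^ r / fact r / ?c u) (\<Sum>r\<le>N. asym_coeff m n l r * of_real (t ^ r / fact r))"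
    by (intro has_bochner_integral_sum has_integral_phase_power n mn)
  have e: "has_bochner_integral lborel (\<lambda>u. exp (?y u) / ?c u) (phase_integral n (m - n) l t)"
    using integrable_phase[OF n t] by (simp add: has_bochner_integral_iff phase_integral_def)
  note diff = has_bochner_integral_diff[OF e p]
  note D = has_bochner_integral_integral_eq[OF diff]
  have "norm (\<integral>u. ?d u \<partial>lborel)
     \<le> (\<integral>u. ?g u \<partial>lborel)"
  proof (rule Bochner_Integration.integral_norm_bound_integral)
    show "integrable lborel ?d" using diff by (simp add: has_bochner_integral_iff)
    show "integrable lborel ?g"
      by (intro integrable_mult_right integrable_one_plus_square_sech n)
    fix u
    have "norm (?d u) = norm (exp (?y u) - (\<Sum>r\<le>N. ?y u ^ r / fact r)) / cosh (pi * u) ^ n"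
      unfolding sum_divide_distrib[symmetric] diff_divide_distrib[symmetric] norm_divide by (simp add: norm_power)
    also have "\<dots> \<le> (norm (?y u) ^ Suc N / fact N) / cosh (pi * u) ^ n"
      by (intro divide_right_mono norm_exp_minus_Taylor_le Re_quad_phase t) simp
    also have "\<dots> \<le> ((b * t * (1 + u ^ 2)) ^ Suc N / fact N) / cosh (pi * u) ^ n"
      using norm_quad_phase_le[OF t, of "m - n" l u] unfolding b_def
      by (intro divide_right_mono power_mono) (auto simp: mult_ac)
    also have "\<dots> = ?g u"
      unfolding power_mult_distrib[of "b * t"] by simp
    finally show "norm (?d u) \<le> ?g u" .
  qed
  also have "\<dots> = (b ^ Suc N / fact N * (\<integral>u. (1 + u ^ 2) ^ Suc N / cosh (pi * u) ^ n \<partial>lborel)) * t ^ Suc N"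
    unfolding integral_mult_right_zero power_mult_distrib[of b t] by simp
  finally show "norm (phase_integral n (m - n) l t - (\<Sum>r\<le>N. asym_coeff m n l r * of_real (t ^ r / fact r))) \<le>
      (b ^ Suc N / fact N * (\<integral>u. (1 + u ^ 2) ^ Suc N / cosh (pi * u) ^ n \<partial>lborel)) * t ^ Suc N"
    unfolding D .
qed

text \<open>
  Outside the period \<open>\<bar>t * u\<bar> \<ge> 1/2\<close>, so that the integrand may be multiplied by \<open>(2 * t * \<bar>u\<bar>) ^ k \<ge> 1\<close>;
  this replaces a tail estimate by a moment.
\<close>
lemma truncated_phase_integral:
  assumes n: "n \<ge> 1" and t: "t > 0"
  shows "norm (inverse (of_real t) * (\<integral>x. of_real (exp (- pi * real d * x ^ 2 / t) / cosh (pi * x / t) ^ n) * cis (- 2 * pi * of_int l * x) \<partial>period)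
      - phase_integral n d l t) \<le> 2 ^ k * (\<integral>u. \<bar>u\<bar> ^ k / cosh (pi * u) ^ n \<partial>lborel) * t ^ k"
proof -
  let ?f = "\<lambda>x. of_real (exp (- pi * real d * x ^ 2 / t) / cosh (pi * x / t) ^ n) * cis (- 2 * pi * of_int l * x)"
  let ?e = "\<lambda>u. exp (quad_phase d l t u) / of_real (cosh (pi * u) ^ n)"
  let ?I = "indicator {- (1 / 2)..<1 / 2} :: real \<Rightarrow> real"
  have fe: "?f (t * u) = ?e u" for u
  proof -
    have "quad_phase d l t u = of_real (- pi * real d * (t * u) ^ 2 / t) + \<i> * of_real (- 2 * pi * of_int l * (t * u))"
      unfolding quad_phase_def using t by (simp add: complex_eq_iff power2_eq_square field_simps)
    then have "exp (quad_phase d l t u) = of_real (exp (- pi * real d * (t * u) ^ 2 / t)) * cis (- 2 * pi * of_int l * (t * u))"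
      by (simp only: exp_add exp_of_real cis_conv_exp)
    moreover have "pi * (t * u) / t = pi * u" using t by simp
    ultimately show ?thesis by (simp only: of_real_divide) simp
  qed
  have "(\<integral>x. ?f x \<partial>period) = (\<integral>x. ?I x *\<^sub>R ?f x \<partial>lborel)"
    unfolding period_def by (subst integral_restrict_space) auto
  also have "\<dots> = \<bar>t\<bar> *\<^sub>R (\<integral>u. ?I (0 + t * u) *\<^sub>R ?f (0 + t * u) \<partial>lborel)"
    by (rule lborel_integral_real_affine) (use t in simp)
  also have "\<dots> = of_real t * (\<integral>u. ?I (t * u) *\<^sub>R ?e u \<partial>lborel)"
    using t by (simp only: add_0 fe) (simp add: scaleR_conv_of_real)
  finally have 1: "inverse (of_real t) * (\<integral>x. ?f x \<partial>period) = (\<integral>u. ?I (t * u) *\<^sub>R ?e u \<partial>lborel)" using t by simp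
  have int: "integrable lborel ?e" by (rule integrable_phase[OF n t])
  have Im: "(\<lambda>u. ?I (t * u)) \<in> borel_measurable lborel"
  proof -
    have "?I \<in> borel_measurable borel" by simp
    then show ?thesis by (intro measurable_compose[of "\<lambda>u. t * u" lborel borel ?I]) auto
  qed
  have intI: "integrable lborel (\<lambda>u. ?I (t * u) *\<^sub>R ?e u)"
    by (rule Bochner_Integration.integrable_bound[OF int borel_measurable_scaleR[OF Im borel_measurable_integrable[OF int]]])
       (auto simp: indicator_def)
  have intk: "integrable lborel (\<lambda>u. 2 ^ k * t ^ k * (\<bar>u\<bar> ^ k / cosh (pi * u) ^ n))"
    using integrable_norm[OF integrable_sech_moment[OF n, of k]] by (intro integrable_mult_right) (simp add: power_abs abs_divide)
  have "norm (\<integral>u. ?I (t * u) *\<^sub>R ?e u - ?e u \<partial>lborel) \<le> (\<integral>u. 2 ^ k * t ^ k * (\<bar>u\<bar> ^ k / cosh (pi * u) ^ n) \<partial>lborel)"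
  proof (rule Bochner_Integration.integral_norm_bound_integral)
    show "integrable lborel (\<lambda>u. ?I (t * u) *\<^sub>R ?e u - ?e u)" using intI int by (rule Bochner_Integration.integrable_diff)
    fix u
    show "norm (?I (t * u) *\<^sub>R ?e u - ?e u) \<le> 2 ^ k * t ^ k * (\<bar>u\<bar> ^ k / cosh (pi * u) ^ n)"
    proof (cases "t * u \<in> {- (1 / 2)..<1 / 2}")
      case True
      then show ?thesis using t by (simp del: atLeastLessThan_iff)
    next
      case False
      then have "1 / 2 \<le> \<bar>t * u\<bar>" by auto
      then have "1 \<le> 2 * t * \<bar>u\<bar>" using t by (simp add: abs_mult)
      then have "1 \<le> (2 * t * \<bar>u\<bar>) ^ k" by (rule one_le_power)
      then have "1 / cosh (pi * u) ^ n \<le> (2 * t * \<bar>u\<bar>) ^ k / cosh (pi * u) ^ n" by (intro divide_right_mono) auto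
      moreover have "norm (?e u) \<le> 1 / cosh (pi * u) ^ n"
        using Re_quad_phase[OF t, of d l u] by (simp add: norm_divide norm_power divide_right_mono)
      ultimately have "norm (?e u) \<le> (2 * t * \<bar>u\<bar>) ^ k / cosh (pi * u) ^ n" by linarith
      then show ?thesis using False by (simp add: power_mult_distrib norm_divide norm_power del: atLeastLessThan_iff)
    qed
  qed fact
  then show ?thesis
    unfolding 1 phase_integral_def Bochner_Integration.integral_diff[OF intI int] integral_mult_right_zero by (simp only: mult_ac)
qed

section \<open>The asymptotic expansion of the trace\<close>

text \<open>
  The Fourier coefficient of the theta quotient, rescaled so that it converges as \<open>t \<rightarrow> 0\<close>: the factors
  \<open>2 ^ n * exp (- pi * n / (4 * t))\<close> normalise the denominator, and \<open>1 / t\<close> is the Jacobian of \<open>x = t * u\<close>.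
\<close>
definition scaled_coeff :: "nat \<Rightarrow> nat \<Rightarrow> int \<Rightarrow> real \<Rightarrow> complex" where
  "scaled_coeff m n l t = inverse (of_real t) *
     (\<integral>x. of_real (2 ^ n * exp (- pi * n / (4 * t)) * theta_ratio m n t x) * cis (- 2 * pi * of_int l * x) \<partial>period)"

lemma scaled_coeff_expansion:
  assumes n: "n \<ge> 1" and mn: "m > n"
  obtains C where "\<And>t. 0 < t \<Longrightarrow> t \<le> 1 \<Longrightarrow>
    norm (scaled_coeff m n l t - (\<Sum>r\<le>N. asym_coeff m n l r * of_real (t ^ r / fact r))) \<le> C * t ^ Suc N"
proof -
  obtain C1 where C1: "\<And>t. t > 0 \<Longrightarrow> norm (phase_integral n (m - n) l t - (\<Sum>r\<le>N. asym_coeff m n l r * of_real (t ^ r / fact r))) \<le> C1 * t ^ Suc N"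
    using phase_integral_expansion[OF n mn, of l N] by blast
  define C2 where "C2 = 2 ^ Suc N * (\<integral>u. \<bar>u\<bar> ^ Suc N / cosh (pi * u) ^ n \<partial>lborel)"
  (* exp (- pi / (4 * t)) is bounded by t ^ (N + 2): one power is lost to the factor 1 / t *)
  define C3 where "C3 = theta_ratio_const m n * (fact (N + 2) / (pi / 4) ^ (N + 2))"
  have c0: "theta_ratio_const m n \<ge> 0" unfolding theta_ratio_const_def using exp_abs_sum_nonneg by simp
  have "norm (scaled_coeff m n l t - (\<Sum>r\<le>N. asym_coeff m n l r * of_real (t ^ r / fact r))) \<le> (C1 + C2 + C3) * t ^ Suc N"
    if t: "0 < t" "t \<le> 1" for t
  proof -
    let ?S = "\<Sum>r\<le>N. asym_coeff m n l r * of_real (t ^ r / fact r)"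
    let ?cis = "\<lambda>x. cis (- 2 * pi * of_int l * x)"
    let ?R = "\<lambda>x. 2 ^ n * exp (- pi * n / (4 * t)) * theta_ratio m n t x"
    let ?M = "\<lambda>x. exp (- pi * real (m - n) * x ^ 2 / t) / cosh (pi * x / t) ^ n"
    let ?J = "inverse (complex_of_real t) * (\<integral>x. of_real (?M x) * ?cis x \<partial>period)"
    have iR: "integrable period (\<lambda>x. of_real (?R x) * ?cis x)"
    proof -
      have "integrable period (\<lambda>x. of_real (2 ^ n * exp (- pi * n / (4 * t))) * (of_real (theta_ratio m n t x) * ?cis x))"
        by (intro integrable_mult_right tr_L_eq_integral(1) t(1))
      then show ?thesis by (simp only: of_real_mult mult.assoc)
    qed
    have iM: "integrable period (\<lambda>x. of_real (?M x) * ?cis x)"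
    proof (rule integrable_period_mode)
      show "(\<lambda>x. complex_of_real (?M x)) \<in> borel_measurable period"
        by (intro borel_measurable_period borel_measurable_continuous_onI continuous_intros) (use t in auto)
      fix x
      have "1 \<le> cosh (pi * x / t) ^ n" by (intro one_le_power cosh_real_ge_1)
      moreover have "exp (- pi * real (m - n) * x ^ 2 / t) \<le> 1" using t by simp
      ultimately have "?M x \<le> 1 / 1" by (intro frac_le) auto
      then show "norm (complex_of_real (?M x)) \<le> 1" unfolding norm_of_real by simp
    qed
    have "norm (\<integral>x. of_real (?R x) * ?cis x - of_real (?M x) * ?cis x \<partial>period) \<le>
        (\<integral>x. theta_ratio_const m n * exp (- pi / (4 * t)) \<partial>period)"
    proof (rule Bochner_Integration.integral_norm_bound_integral)
      show "integrable period (\<lambda>x. of_real (?R x) * ?cis x - of_real (?M x) * ?cis x)" by (rule Bochner_Integration.integrable_diff[OF iR iM])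
      show "integrable period (\<lambda>x. theta_ratio_const m n * exp (- pi / (4 * t)))"
        by (rule integrable_period_bounded[where B = "\<bar>theta_ratio_const m n * exp (- pi / (4 * t))\<bar>"]) auto
      fix x assume "x \<in> space period"
      then have "\<bar>x\<bar> \<le> 1 / 2" by auto
      from theta_ratio_approx[OF t this mn]
      have "\<bar>?R x - ?M x\<bar> \<le> theta_ratio_const m n * exp (- pi / (4 * t))" .
      moreover have "norm (of_real (?R x) * ?cis x - of_real (?M x) * ?cis x) = \<bar>?R x - ?M x\<bar>"
        unfolding left_diff_distrib[symmetric] of_real_diff[symmetric] norm_mult norm_cis norm_of_real mult_1_right ..
      ultimately show "norm (of_real (?R x) * ?cis x - of_real (?M x) * ?cis x) \<le> theta_ratio_const m n * exp (- pi / (4 * t))" by (simp only:)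
    qed
    also have "\<dots> = theta_ratio_const m n * exp (- pi / (4 * t))" by simp
    also have "\<dots> \<le> theta_ratio_const m n * (fact (N + 2) / (pi / 4) ^ (N + 2) * t ^ (N + 2))"
      using exp_minus_inverse_le_power[of "pi / 4" t "N + 2"] t by (intro mult_left_mono c0) (simp add: divide_divide_eq_left)
    also have "\<dots> = t * (C3 * t ^ Suc N)" unfolding C3_def by simp
    finally have b: "norm (\<integral>x. of_real (?R x) * ?cis x - of_real (?M x) * ?cis x \<partial>period) \<le> t * (C3 * t ^ Suc N)" .
    have eq: "scaled_coeff m n l t - ?J = inverse (of_real t) * (\<integral>x. of_real (?R x) * ?cis x - of_real (?M x) * ?cis x \<partial>period)"
      unfolding scaled_coeff_def Bochner_Integration.integral_diff[OF iR iM] by (simp only: right_diff_distrib)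
    have "norm (inverse (complex_of_real t)) = inverse t" unfolding norm_inverse norm_of_real using t by simp
    then have "norm (scaled_coeff m n l t - ?J) \<le> inverse t * (t * (C3 * t ^ Suc N))"
      unfolding eq norm_mult using b t by (simp only:) (intro mult_left_mono, auto)
    also have "inverse t * (t * (C3 * t ^ Suc N)) = C3 * t ^ Suc N" using t by simp
    finally have 3: "norm (scaled_coeff m n l t - ?J) \<le> C3 * t ^ Suc N" .
    have 2: "norm (?J - phase_integral n (m - n) l t) \<le> C2 * t ^ Suc N"
      unfolding C2_def by (rule truncated_phase_integral[OF n t(1)])
    note 1 = C1[OF t(1)]
    have "norm (a - d) \<le> norm (a - b) + norm (b - c) + norm (c - d)" for a b c d :: complex
    proof -
      have "norm ((a - b) + (b - c) + (c - d)) \<le> norm (a - b) + norm (b - c) + norm (c - d)"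
        by (intro norm_triangle_mono order_refl)
      then show ?thesis by simp
    qed
    from this[of "scaled_coeff m n l t" ?S ?J "phase_integral n (m - n) l t"]
    show ?thesis using 1 2 3 unfolding distrib_right by linarith
  qed
  then show ?thesis using that by blast
qed

text \<open>
  The Euler product divided by its asymptotic main term.
\<close>
definition eta_ratio :: "real \<Rightarrow> real" where
  "eta_ratio t = sqrt t * euler_prod (exp (- pi * t)) / exp (pi * t / 12 - pi / (12 * t))"

text \<open>
  Bookkeeping of the explicit factors, valid for every \<open>t > 0\<close>. Of the \<open>m - n\<close> Euler products in the
  denominator one cancels against the product in \<open>tr_L\<close>; the exponentials in the statement are
  \<open>exp (pi * n / (4 * t))\<close> and the main terms of the remaining \<open>m - n - 1\<close>.
\<close>
lemma tr_L_factorisation: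
  assumes t: "t > 0" and mn: "m > n"
  shows "tr_L m n l (\<i> * of_real t) =
     of_real (exp (pi * t / 12 * (real n - real m + 1) + pi / (12 * t) * (real m + 2 * real n - 1)) * (sqrt t / 2 ^ n))
     * (of_real ((1 / eta_ratio t) ^ (m - n - 1)) * scaled_coeff m n l t)"
proof -
  define P where "P = euler_prod (exp (- pi * t))"
  define A where "A = exp (pi * t / 12 - pi / (12 * t))"
  define g where "g = sqrt t * P"
  define k where "k = m - n - 1"
  have m: "m = n + Suc k" using mn by (simp add: k_def)
  have P: "P > 0" unfolding P_def using euler_prod_pos[of "exp (- pi * t)"] t by simp
  have g: "g > 0" using P t by (simp add: g_def)
  have gA: "g = A * eta_ratio t" unfolding eta_ratio_def g_def P_def A_def by simp
  let ?I = "\<integral>x. of_real (theta_ratio m n t x) * cis (- 2 * pi * of_int l * x) \<partial>period"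
  have sc: "scaled_coeff m n l t = inverse (of_real t) * (of_real (2 ^ n * exp (- pi * n / (4 * t))) * ?I)"
    unfolding scaled_coeff_def of_real_mult mult.assoc integral_mult_right_zero ..
  have P': "P * (g ^ n / g ^ m) = sqrt t / t * (1 / g) ^ k"
  proof -
    have "P = g / sqrt t" using t by (simp add: g_def)
    moreover have "g ^ m = g ^ n * (g * g ^ k)" unfolding m power_add by simp
    ultimately have "P * (g ^ n / g ^ m) = 1 / sqrt t * (1 / g) ^ k" using g by (simp add: power_one_over)
    also have "1 / sqrt t = sqrt t / t" using t by (simp add: field_simps)
    finally show ?thesis .
  qed
  have ex: "exp (pi * t / 12 * (real n - real m + 1) + pi / (12 * t) * (real m + 2 * real n - 1)) = (1 / A) ^ k / exp (- pi * n / (4 * t))"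
  proof -
    have "(1 / A) ^ k / exp (- pi * n / (4 * t)) = exp (of_nat k * - (pi * t / 12 - pi / (12 * t)) - (- pi * n / (4 * t)))"
    proof -
      have "exp (of_nat k * z - w) = exp z ^ k / exp w" for z w :: real by (simp only: exp_diff exp_of_nat_mult)
      then show ?thesis unfolding A_def by (simp only: exp_minus[of "pi * t / 12 - pi / (12 * t)"] inverse_eq_divide)
    qed
    also have "of_nat k * - (pi * t / 12 - pi / (12 * t)) - (- pi * n / (4 * t)) =
        pi * t / 12 * (real n - real m + 1) + pi / (12 * t) * (real m + 2 * real n - 1)"
      using t unfolding m by (simp add: field_simps)
    finally show ?thesis ..
  qed
  have "P * (g ^ n / g ^ m) = (1 / A) ^ k / exp (- pi * n / (4 * t)) * (sqrt t / 2 ^ n) * ((1 / eta_ratio t) ^ k * (inverse t * (2 ^ n * exp (- pi * n / (4 * t)))))"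
  proof -
    have alg: "s / t * (a * b) = a / E * (s / T) * (b * (inverse t * (T * E)))" if "E \<noteq> 0" "T \<noteq> 0" for a b s T E :: real
      using that t by (simp add: field_simps)
    have g': "(1 / g) ^ k = (1 / A) ^ k * (1 / eta_ratio t) ^ k"
      unfolding gA power_mult_distrib[symmetric] by simp
    show ?thesis unfolding P' g' by (rule alg) simp_all
  qed
  then have "complex_of_real (P * (g ^ n / g ^ m)) = of_real ((1 / A) ^ k / exp (- pi * n / (4 * t)) * (sqrt t / 2 ^ n)) * (of_real ((1 / eta_ratio t) ^ k) * (inverse (of_real t) * of_real (2 ^ n * exp (- pi * n / (4 * t)))))"
    by (simp only: of_real_mult of_real_inverse)
  then show ?thesis
    unfolding tr_L_eq_integral(2)[OF t] P_def[symmetric] g_def[symmetric] sc ex k_def[symmetric] by (simp only: mult.assoc)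
qed

text \<open>
  The relative error of the Euler product is \<open>O(exp (- 1 / t))\<close>; for small \<open>t\<close> it is below \<open>1/2\<close>, which keeps the
  reciprocal away from its pole.
\<close>
lemma inverse_eta_ratio_power_asymp:
  obtains C t0 where "0 < t0" "t0 \<le> 1" "\<And>t. 0 < t \<Longrightarrow> t \<le> t0 \<Longrightarrow> \<bar>(1 / eta_ratio t) ^ k - 1\<bar> \<le> C * t ^ j"
proof -
  define B where "B = exp 1 * exp_abs_sum"
  have B: "B \<ge> 0" using exp_abs_sum_nonneg by (simp add: B_def)
  (* on this range B * t is below 1/2 *)
  define t0 where "t0 = 1 / (2 * B + 2)"
  have t0: "0 < t0" "t0 \<le> 1" using B by (auto simp: t0_def field_simps)
  have "\<bar>(1 / eta_ratio t) ^ k - 1\<bar> \<le> (2 ^ k * (k * (2 * (B * fact j)))) * t ^ j" if t: "0 < t" "t \<le> t0" for t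
  proof -
    define G where "G = eta_ratio t"
    define D where "D = 1 / G"
    have G1: "\<bar>G - 1\<bar> \<le> B * exp (- 1 / t)" unfolding G_def eta_ratio_def B_def by (rule euler_prod_asymp) (use t t0 in auto)
    also have "\<dots> \<le> B * t" using exp_minus_inverse_le_power[of 1 t 1] t B by (intro mult_left_mono) auto
    also have "\<dots> \<le> B * t0" using t B by (intro mult_left_mono) auto
    also have "\<dots> \<le> 1 / 2" using B by (simp add: t0_def field_simps)
    finally have G: "1 / 2 \<le> G" by linarith
    have D: "0 < D" "D \<le> 2" using G by (auto simp: D_def field_simps)
    have D1: "\<bar>D - 1\<bar> \<le> 2 * \<bar>G - 1\<bar>"
    proof -
      have "\<bar>D - 1\<bar> = D * \<bar>G - 1\<bar>"
      proof -
        have "D - 1 = - (D * (G - 1))" using G by (simp add: D_def field_simps)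
        then show ?thesis using D by (simp add: abs_mult)
      qed
      also have "\<dots> \<le> 2 * \<bar>G - 1\<bar>" using D by (intro mult_right_mono) auto
      finally show ?thesis .
    qed
    have "\<bar>(D / 2) ^ k - (1 / 2) ^ k\<bar> \<le> k * \<bar>D / 2 - 1 / 2\<bar>"
      using norm_power_diff[of "D / 2" "1 / 2" k] D by simp
    also have "\<dots> \<le> k * \<bar>D - 1\<bar>" by (intro mult_left_mono) (auto simp: abs_if)
    finally have "2 ^ k * \<bar>(D / 2) ^ k - (1 / 2) ^ k\<bar> \<le> 2 ^ k * (k * \<bar>D - 1\<bar>)" by (intro mult_left_mono) auto
    moreover have "2 ^ k * \<bar>(D / 2) ^ k - (1 / 2) ^ k\<bar> = \<bar>D ^ k - 1\<bar>"
    proof -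
      have "D ^ k - 1 = 2 ^ k * ((D / 2) ^ k - (1 / 2) ^ k)" by (simp add: power_divide right_diff_distrib)
      then show ?thesis by (simp add: abs_mult)
    qed
    ultimately have "\<bar>D ^ k - 1\<bar> \<le> 2 ^ k * (k * \<bar>D - 1\<bar>)" by simp
    also have "\<dots> \<le> 2 ^ k * (k * (2 * (B * (fact j * t ^ j))))"
    proof (intro mult_left_mono)
      have "2 * \<bar>G - 1\<bar> \<le> 2 * (B * exp (- 1 / t))" by (rule mult_left_mono[OF G1]) simp
      with D1 have "\<bar>D - 1\<bar> \<le> 2 * (B * exp (- 1 / t))" by (rule order_trans)
      also have "\<dots> \<le> 2 * (B * (fact j * t ^ j))"
        using exp_minus_inverse_le_power[of 1 t j] t B by (intro mult_left_mono) auto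
      finally show "\<bar>D - 1\<bar> \<le> 2 * (B * (fact j * t ^ j))" .
    qed auto
    finally show ?thesis unfolding D_def G_def by (simp only: mult.assoc)
  qed
  then show ?thesis using that t0 by blast
qed

theorem theorem1p2:
  fixes l :: int and m n N :: nat
  assumes "n \<ge> 1" and "m > n"
  shows "\<exists>R :: real \<Rightarrow> complex.
    R \<in> O[at_right 0](\<lambda>t. of_real (t ^ (N + 1))) \<and>
    (\<forall>t::real. t > 0 \<longrightarrow>
      tr_L m n l (\<i> * of_real t) =
        of_real (exp (pi * t / 12 * (real n - real m + 1)
                      + pi / (12 * t) * (real m + 2 * real n - 1))
                 * (sqrt t / 2 ^ n))
        * ((\<Sum>r=0..N. asym_coeff m n l r * of_real (t ^ r / fact r)) + R t))"
proof -
  define S where "S = (\<lambda>t. \<Sum>r\<le>N. asym_coeff m n l r * complex_of_real (t ^ r / fact r))"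
  (* R collects the error of the prefactor, D t - 1, and that of the scaled coefficient *)
  define D where "D = (\<lambda>t. (1 / eta_ratio t) ^ (m - n - 1))"
  define R where "R = (\<lambda>t. of_real (D t) * scaled_coeff m n l t - S t)"
  obtain C where C: "\<And>t. 0 < t \<Longrightarrow> t \<le> 1 \<Longrightarrow> norm (scaled_coeff m n l t - S t) \<le> C * t ^ Suc N"
    unfolding S_def using scaled_coeff_expansion[OF assms, of l N] by blast
  obtain C' t0 where t0: "0 < t0" "t0 \<le> 1"
    and e: "\<And>t. 0 < t \<Longrightarrow> t \<le> t0 \<Longrightarrow> \<bar>(1 / eta_ratio t) ^ (m - n - 1) - 1\<bar> \<le> C' * t ^ Suc N"
    by (rule inverse_eta_ratio_power_asymp[of "m - n - 1" "Suc N"]) (rule that)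
  have C': "\<bar>D t - 1\<bar> \<le> C' * t ^ Suc N" if "0 < t" "t \<le> t0" for t
    unfolding D_def by (rule e[OF that])
  define B where "B = (\<Sum>r\<le>N. norm (asym_coeff m n l r))"
  have SB: "norm (S t) \<le> B" if "0 < t" "t \<le> 1" for t
    unfolding S_def B_def
  proof (rule sum_norm_le)
    fix r
    have "t ^ r \<le> 1" using that by (intro power_le_one) auto
    then have "t ^ r \<le> fact r" using fact_ge_1[of r, where ?'a = real] by (rule order_trans)
    then have "t ^ r / fact r \<le> 1" by (rule divide_le_eq_1_pos[THEN iffD2, OF fact_gt_zero])
    then have "norm (asym_coeff m n l r) * (t ^ r / fact r) \<le> norm (asym_coeff m n l r) * 1" by (intro mult_left_mono) auto
    then show "norm (asym_coeff m n l r * complex_of_real (t ^ r / fact r)) \<le> norm (asym_coeff m n l r)"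
      unfolding norm_mult norm_of_real using that by simp
  qed
  have "R \<in> O[at_right 0](\<lambda>t. of_real (t ^ (N + 1)))"
  proof (rule bigoI)
    have "eventually (\<lambda>t. t \<in> {0<..<t0}) (at_right 0)" by (rule eventually_at_right_real[OF t0(1)])
    then show "eventually (\<lambda>t. norm (R t) \<le> (C' * (C + B) + C) * norm (complex_of_real (t ^ (N + 1)))) (at_right 0)"
    proof eventually_elim
      case (elim t)
      then have t: "0 < t" "t \<le> t0" "t \<le> 1" using t0 by auto
      have C0: "0 \<le> C * t ^ Suc N" using C[OF t(1,3)] norm_ge_zero order_trans by blast
      moreover have "0 < t ^ Suc N" using t(1) by (rule zero_less_power)
      ultimately have "C \<ge> 0" by (meson mult_neg_pos not_le)
      have C'0: "0 \<le> C' * t ^ Suc N" using C'[OF t(1,2)] by linarith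
      have "norm (scaled_coeff m n l t) \<le> norm (scaled_coeff m n l t - S t) + norm (S t)"
        using norm_triangle_ineq[of "scaled_coeff m n l t - S t" "S t"] by simp
      also have "\<dots> \<le> C * t ^ Suc N + B" using C[OF t(1,3)] SB[OF t(1,3)] by (intro add_mono)
      also have "C * t ^ Suc N \<le> C * 1" using t \<open>C \<ge> 0\<close> by (intro mult_left_mono power_le_one) auto
      finally have Q: "norm (scaled_coeff m n l t) \<le> C + B" by simp
      have "R t = of_real (D t - 1) * scaled_coeff m n l t + (scaled_coeff m n l t - S t)"
        by (simp add: R_def algebra_simps)
      also have "norm \<dots> \<le> \<bar>D t - 1\<bar> * norm (scaled_coeff m n l t) + norm (scaled_coeff m n l t - S t)"
        by (rule norm_triangle_le) (simp add: norm_mult del: of_real_diff)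
      also have "\<dots> \<le> (C' * t ^ Suc N) * (C + B) + C * t ^ Suc N"
        using C'[OF t(1,2)] Q C[OF t(1,3)] C'0 by (intro add_mono mult_mono) auto
      also have "\<dots> = (C' * (C + B) + C) * norm (complex_of_real (t ^ (N + 1)))"
        unfolding norm_of_real using t by (simp add: algebra_simps)
      finally show ?case .
    qed
  qed
  moreover have "of_real ((1 / eta_ratio t) ^ (m - n - 1)) * scaled_coeff m n l t = (\<Sum>r=0..N. asym_coeff m n l r * of_real (t ^ r / fact r)) + R t" for t
    unfolding R_def D_def S_def atMost_atLeast0 by simp
  ultimately show ?thesis
    using tr_L_factorisation[OF _ assms(2)] by (intro exI[of _ R]) (simp only:, simp)
qed

end
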